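(* Let $Y_1,\dots,Y_m$ be independent $\mathbb{Z}^d$-valued random vectors with finite third moments, means $\mu_i$ and covariance matrices $S_i$; let $W:=\sum_{i=1}^mY_i$, $\mu:=\sum_i\mu_i$, and assume $S:=\sum_iS_i$ is positive definite. Let $u_i:=\min_{1\le j\le d}\{1-d_{TV}(\mathcal{L}(Y_i),\mathcal{L}(Y_i+e^{(j)}))\}$, $s_m:=\sum_iu_i$ and $\tilde s_m:=s_m-\max_{1\le i\le m}u_i$, assumed positive. Let $Y_i'$ be independent copies of $Y_i$ (independent of everything else), $\chi:=m^{-1}\sum_{i=1}^m\mathbb{E}|Y_i'-Y_i|^3$, $\sigma^2:=2S/m$ and $L:=m^{-1/2}\chi\{\mathrm{Tr}(\sigma^2)\}^{-3/2}$. Then $d_{TV}(\mathcal{L}(W),\mathcal{DN}_d(\mu,S))\le C\,d^{7/2}\log m\,\bigl(L+(d/m)^{1/2}\bigr)\sqrt{m/\tilde s_m}$, for a constant $C$ depending only on $\mathrm{Sp}'(S/m)$.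
   Context: $\mathcal{DN}_d(m',V)$ is the discrete normal distribution on $\mathbb{Z}^d$: it assigns to $(i_1,\dots,i_d)\in\mathbb{Z}^d$ the $\mathcal N_d(m',V)$-probability of the box $\prod_k[i_k-\tfrac12,i_k+\tfrac12)$. For positive definite symmetric $M$, $\mathrm{Sp}'(M):=\{\lambda_{\min}(M),\lambda_{\max}(M),d^{-1}\mathrm{Tr}(M)\}$. $|\cdot|$ is the Euclidean norm; $e^{(j)}$ the $j$-th coordinate vector. *)

theory Defs
  imports "HOL-Probability.Probability"
begin

text \<open>Vectors of Z^d and R^d are represented as functions on nat, meaningful on
  indices below d; d x d matrices as functions nat => nat => real.\<close>

definition zvec :: "nat \<Rightarrow> (nat \<Rightarrow> int) set" where
  "zvec d = {x. \<forall>k\<ge>d. x k = 0}"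

definition enorm :: "nat \<Rightarrow> (nat \<Rightarrow> int) \<Rightarrow> real" where
  "enorm d x = sqrt (\<Sum>k<d. (real_of_int (x k))\<^sup>2)"

definition unit_shift :: "nat \<Rightarrow> (nat \<Rightarrow> int) \<Rightarrow> (nat \<Rightarrow> int)" where
  "unit_shift j x = (\<lambda>k. x k + (if k = j then 1 else 0))"

definition dtv :: "'a measure \<Rightarrow> 'a measure \<Rightarrow> real" where
  "dtv M N = Sup {\<bar>measure M A - measure N A\<bar> | A. A \<in> sets M \<inter> sets N}"

definition sum_law :: "nat \<Rightarrow> (nat \<Rightarrow> (nat \<Rightarrow> int) pmf) \<Rightarrow> (nat \<Rightarrow> int) pmf" where
  "sum_law m Y = map_pmf (\<lambda>\<omega>. \<lambda>k. \<Sum>i<m. \<omega> i k) (Pi_pmf {..<m} (\<lambda>_. 0) Y)"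

definition mean_vec :: "(nat \<Rightarrow> int) pmf \<Rightarrow> nat \<Rightarrow> real" where
  "mean_vec p k = measure_pmf.expectation p (\<lambda>x. real_of_int (x k))"

definition cov_mat :: "(nat \<Rightarrow> int) pmf \<Rightarrow> nat \<Rightarrow> nat \<Rightarrow> real" where
  "cov_mat p j k = measure_pmf.expectation p
     (\<lambda>x. (real_of_int (x j) - mean_vec p j) * (real_of_int (x k) - mean_vec p k))"

definition pos_def :: "nat \<Rightarrow> (nat \<Rightarrow> nat \<Rightarrow> real) \<Rightarrow> bool" where
  "pos_def d M \<longleftrightarrow> (\<forall>j<d. \<forall>k<d. M j k = M k j) \<and>
     (\<forall>v::nat \<Rightarrow> real. (\<exists>k<d. v k \<noteq> 0) \<longrightarrow> (\<Sum>j<d. \<Sum>k<d. v j * M j k * v k) > 0)"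

definition mat_trace :: "nat \<Rightarrow> (nat \<Rightarrow> nat \<Rightarrow> real) \<Rightarrow> real" where
  "mat_trace d M = (\<Sum>k<d. M k k)"

definition is_eigenvalue :: "nat \<Rightarrow> (nat \<Rightarrow> nat \<Rightarrow> real) \<Rightarrow> real \<Rightarrow> bool" where
  "is_eigenvalue d M l \<longleftrightarrow> (\<exists>v::nat \<Rightarrow> real. (\<exists>k<d. v k \<noteq> 0) \<and>
     (\<forall>i<d. (\<Sum>j<d. M i j * v j) = l * v i))"

definition lambda_min :: "nat \<Rightarrow> (nat \<Rightarrow> nat \<Rightarrow> real) \<Rightarrow> real" where
  "lambda_min d M = Min {l. is_eigenvalue d M l}"

definition lambda_max :: "nat \<Rightarrow> (nat \<Rightarrow> nat \<Rightarrow> real) \<Rightarrow> real" where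
  "lambda_max d M = Max {l. is_eigenvalue d M l}"

definition mat_det :: "nat \<Rightarrow> (nat \<Rightarrow> nat \<Rightarrow> real) \<Rightarrow> real" where
  "mat_det d M = (\<Sum>p | p permutes {..<d}. of_int (sign p) * (\<Prod>i<d. M i (p i)))"

definition mat_inv :: "nat \<Rightarrow> (nat \<Rightarrow> nat \<Rightarrow> real) \<Rightarrow> (nat \<Rightarrow> nat \<Rightarrow> real)" where
  "mat_inv d M = (THE T. (\<forall>i j. (i \<ge> d \<or> j \<ge> d) \<longrightarrow> T i j = 0) \<and>
      (\<forall>i<d. \<forall>j<d. (\<Sum>k<d. M i k * T k j) = (if i = j then 1 else 0)))"

definition normal_density_d ::
  "nat \<Rightarrow> (nat \<Rightarrow> real) \<Rightarrow> (nat \<Rightarrow> nat \<Rightarrow> real) \<Rightarrow> (nat \<Rightarrow> real) \<Rightarrow> real" where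
  "normal_density_d d mu V x =
     (2 * pi) powr (- real d / 2) * mat_det d V powr (-1/2) *
     exp (- (1/2) * (\<Sum>i<d. \<Sum>j<d. (x i - mu i) * mat_inv d V i j * (x j - mu j)))"

definition normal_d :: "nat \<Rightarrow> (nat \<Rightarrow> real) \<Rightarrow> (nat \<Rightarrow> nat \<Rightarrow> real) \<Rightarrow> (nat \<Rightarrow> real) measure" where
  "normal_d d mu V = density (PiM {..<d} (\<lambda>_. lborel)) (\<lambda>x. ennreal (normal_density_d d mu V x))"

text \<open>Rounding map: x lies in the box prod_k [i_k - 1/2, i_k + 1/2) iff round_box d x = i.\<close>
definition round_box :: "nat \<Rightarrow> (nat \<Rightarrow> real) \<Rightarrow> (nat \<Rightarrow> int)" where
  "round_box d x = (\<lambda>k. if k < d then \<lfloor>x k + 1/2\<rfloor> else 0)"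

definition discrete_normal :: "nat \<Rightarrow> (nat \<Rightarrow> real) \<Rightarrow> (nat \<Rightarrow> nat \<Rightarrow> real) \<Rightarrow> (nat \<Rightarrow> int) measure" where
  "discrete_normal d mu V = distr (normal_d d mu V) (count_space UNIV) (round_box d)"

end

theory Submission
  imports Defs "HOL-Library.Function_Algebras" "Jordan_Normal_Form.Spectral_Radius"
begin

text \<open>
  Whiten with a Cholesky factor \<open>S = B B\<^sup>T\<close>, \<open>A = B\<^sup>-\<^sup>1\<close>: with \<open>U\<close> uniform on the unit cube centred at 0 and
  \<open>V = A (W + U - \<mu>)\<close>, rounding \<open>\<mu> + B V\<close> returns \<open>W\<close>, and rounding \<open>\<mu> + B G\<close> for a standard Gaussian \<open>G\<close>
  gives the discrete normal law. For \<open>f\<close> the indicator of a set composed with this rounding, follow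
  \<open>F(\<phi>) = E f(cos \<phi> V + sin \<phi> G)\<close> from \<open>sin \<phi> = m\<^sup>-\<^sup>2\<close>, where it is close to its value for \<open>W\<close>, to
  \<open>\<phi> = \<pi>/2\<close>, where it is the value for the discrete normal law.

  The derivative \<open>F'(\<phi>)\<close> is a Stein operator applied to a Gaussian smoothing of \<open>f\<close>. Exchanging each summand
  with an independent copy turns the drift term into increments of the gradient of the smoothed function
  along the integer vectors \<open>Y\<^sub>i - Y\<^sub>i'\<close>; these are compared with the averaged second derivatives, which are
  at most of order \<open>cot \<phi>\<close>. The comparison costs only one translation of the sum of the other summands,
  that is, a factor \<open>s\<^sup>-\<^sup>1\<^sup>/\<^sup>2\<close> in total variation, and the cube variable \<open>U\<close> makes this available for
  non-integer translations too. Integrating \<open>cot \<phi>\<close> produces the factor \<open>log m\<close>.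
\<close>

section \<open>Shifts of sums of independent lattice vectors\<close>

text \<open>The test function is an indicator, and this shapes the argument. After smoothing at
  angle \<phi>, the increments that arise cost one factor cot \<phi>; one derivative more would cost
  a second factor, and cot^2 \<phi> does not integrate to a logarithm. So no Taylor remainder is
  formed. Two mean values of the same second-order quantity, at points that differ by a translation,
  are compared instead, and the law of the sum supplies the smoothness that the function lacks. When
  one summand is exchanged, only the others can absorb a translation, which is why the largest u_i
  is taken off s_m. Each summand contains a fair coin flip along e^(j) with probability at least
  u_i, and a binomial number of R flips is moved by one unit at a cost of order R^(-1/2). The
  starting angle balances two effects: with b = sin \<phi>, rounding the perturbed point goes wrong
  with probability of order b d m for bounded Tr(S)/(d m). Thus b = m^(-2) leaves only d/m, while
  ln(1/b) = 2 ln m still has the order of the logarithm in the claim.\<close>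

definition shift_avg :: "'a::ab_group_add \<Rightarrow> ('a \<Rightarrow> real) \<Rightarrow> 'a \<Rightarrow> real" where
  "shift_avg e f x = (f x + f (x + e)) / 2"

text \<open>\<open>N\<close> counts fair coin flips in direction \<open>e\<close>. This is the
  change in the mean of \<open>f\<close> when a Binomial(N, 1/2) number of steps is increased by
  one.\<close>

definition shift_diff :: "'a::ab_group_add \<Rightarrow> nat \<Rightarrow> ('a \<Rightarrow> real) \<Rightarrow> 'a \<Rightarrow> real" where
  "shift_diff e N f x = (shift_avg e ^^ N) f (x + e) - (shift_avg e ^^ N) f x"

lemma shift_diff_Suc:
  "shift_diff e (Suc N) f x = (shift_diff e N f x + shift_diff e N f (x + e)) / 2"
  by (simp add: shift_diff_def shift_avg_def field_simps)

text \<open>Iterated averaging is an expectation over a Binomial(N, 1/2) number of steps; its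
  weights are the Bernstein polynomials at 1/2, and the induction is Pascal's rule.\<close>

lemma shift_avg_power:
  "(shift_avg e ^^ N) f x = (\<Sum>k\<le>N. Bernstein N k (1/2) * f (((\<lambda>x. x + e) ^^ k) x))"
proof (induction N arbitrary: x)
  case 0
  then show ?case by (simp add: Bernstein_def)
next
  case (Suc N)
  let ?\<phi> = "\<lambda>k. f (((\<lambda>x. x + e) ^^ k) x)"
  let ?B = "\<lambda>N k. Bernstein N k (1/2)"
  have B: "?B M k = real (M choose k) / 2 ^ M" if "k \<le> M" for M k
    using that by (simp add: Bernstein_def power_one_over flip: power_add)
  have step: "?B (Suc N) (Suc k) = (?B N k + ?B N (Suc k)) / 2" if "k \<le> N" for k
  proof (cases "Suc k \<le> N")
    case True
    then show ?thesis by (simp add: B add_divide_distrib)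
  next
    case False
    then have "k = N" using that by simp
    then show ?thesis by (simp add: B) (simp add: Bernstein_def)
  qed
  have z: "?B N (Suc N) = 0" by (simp add: Bernstein_def)
  have "(shift_avg e ^^ Suc N) f x = ((\<Sum>k\<le>N. ?B N k * ?\<phi> k) + (\<Sum>k\<le>N. ?B N k * ?\<phi> (Suc k))) / 2"
    unfolding funpow.simps o_apply shift_avg_def[of e "(shift_avg e ^^ N) f"] Suc
    using funpow_swap1[of "\<lambda>x. x + e" _ x] by simp
  also have "(\<Sum>k\<le>N. ?B N k * ?\<phi> k) = (\<Sum>k\<le>Suc N. ?B N k * ?\<phi> k)" using z by simp
  also have "\<dots> = ?B N 0 * ?\<phi> 0 + (\<Sum>k\<le>N. ?B N (Suc k) * ?\<phi> (Suc k))"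
    by (rule sum.atMost_Suc_shift)
  also have "(?B N 0 * ?\<phi> 0 + (\<Sum>k\<le>N. ?B N (Suc k) * ?\<phi> (Suc k)) + (\<Sum>k\<le>N. ?B N k * ?\<phi> (Suc k))) / 2
     = ?B (Suc N) 0 * ?\<phi> 0 + (\<Sum>k\<le>N. ?B (Suc N) (Suc k) * ?\<phi> (Suc k))"
  proof -
    have "(\<Sum>k\<le>N. ?B (Suc N) (Suc k) * ?\<phi> (Suc k)) =
        (\<Sum>k\<le>N. (?B N k + ?B N (Suc k)) / 2 * ?\<phi> (Suc k))"
      by (intro sum.cong) (simp_all add: step)
    also have "\<dots> = ((\<Sum>k\<le>N. ?B N (Suc k) * ?\<phi> (Suc k)) + (\<Sum>k\<le>N. ?B N k * ?\<phi> (Suc k))) / 2"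
      unfolding sum.distrib[symmetric] sum_divide_distrib
      by (intro sum.cong refl) (simp add: algebra_simps)
    finally have 1: "(\<Sum>k\<le>N. ?B (Suc N) (Suc k) * ?\<phi> (Suc k)) = \<dots>" .
    have 2: "?B (Suc N) 0 = ?B N 0 / 2" by (simp add: Bernstein_def)
    show ?thesis unfolding 1 2 by (simp add: field_simps)
  qed
  also have "\<dots> = (\<Sum>k\<le>Suc N. ?B (Suc N) k * ?\<phi> k)"
    by (rule sum.atMost_Suc_shift[symmetric])
  finally show ?case .
qed

text \<open>Four times the binomial variance n/4, obtained from the factorial moments of the
  Bernstein weights.\<close>

lemma Bernstein_half_second_moment:
  "(\<Sum>k\<le>n. Bernstein n k (1/2) * (2 * real k - real n)\<^sup>2) = real n"
proof -
  have "(\<Sum>k\<le>n. Bernstein n k (1/2) * (2 * real k - real n)\<^sup>2) =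
    4 * (\<Sum>k\<le>n. real k * (real k - 1) * Bernstein n k (1/2)) +
    (4 - 4 * real n) * (\<Sum>k\<le>n. real k * Bernstein n k (1/2)) + (real n)\<^sup>2 * (\<Sum>k\<le>n. Bernstein n k (1/2))"
    unfolding sum_distrib_left sum.distrib[symmetric]
    by (intro sum.cong refl) (simp add: power2_eq_square algebra_simps)
  also have "\<dots> = real n"
    unfolding sum_k_Bernstein sum_kk_Bernstein sum_Bernstein by (simp add: power2_eq_square algebra_simps)
  finally show ?thesis .
qed

text \<open>The difference of two neighbouring Binomial(N) weights is a Binomial(N + 1) weight times
  a centred linear factor. Cauchy-Schwarz and the binomial variance then give decay like N^(-1/2),
  with no regularity of \<open>f\<close>.\<close>

lemma shift_diff_bound:
  assumes M: "\<And>x. \<bar>f x\<bar> \<le> M"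
  shows "\<bar>shift_diff e N f x\<bar> \<le> 2 * M / sqrt (real N + 1)"
proof -
  let ?\<phi> = "\<lambda>k. f (((\<lambda>x. x + e) ^^ k) x)"
  let ?B = "\<lambda>N k. Bernstein N k (1/2)"
  let ?n = "Suc N"
  \<comment> \<open>\<open>c (Suc k)\<close> will be the difference of the weights at
    \<open>k\<close> and \<open>Suc k\<close>, and \<open>c 0\<close> minus the weight at 0, so a
    single formula also covers both boundary terms of the summation by parts.\<close>
  define c where "c k = ?B ?n k * (2 * real k - real ?n) * (2 / real ?n)" for k
  have B: "?B M k = real (M choose k) / 2 ^ M" if "k \<le> M" for M k
    using that by (simp add: Bernstein_def power_one_over flip: power_add)
  have z: "?B N (Suc N) = 0" by (simp add: Bernstein_def)
  have cSuc: "c (Suc k) = ?B N k - ?B N (Suc k)" if "k \<le> N" for k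
  proof -
    have 1: "real (Suc k) * real (?n choose Suc k) = real ?n * real (N choose k)"
      by (simp only: of_nat_mult[symmetric] Suc_times_binomial)
    have "?n * (N choose Suc k) = (?n - Suc k) * (?n choose Suc k)"
      using binomial_absorb_comp[of ?n "Suc k"] by simp
    then have 2: "real ?n * real (N choose Suc k) = (real ?n - real (Suc k)) * real (?n choose Suc k)"
      using that by (metis Suc_le_mono of_nat_diff of_nat_mult)
    have b: "?B N (Suc k) = real (N choose Suc k) / 2 ^ N"
      by (cases "Suc k \<le> N") (simp add: B, simp add: Bernstein_def binomial_eq_0)
    have "c (Suc k) = (real (Suc k) * real (?n choose Suc k) - (real ?n - real (Suc k)) * real (?n choose Suc k)) / (2 ^ N * real ?n)"
      using that by (simp add: c_def B) (simp add: field_simps)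
    also have "\<dots> = (real ?n * real (N choose k) - real ?n * real (N choose Suc k)) / (2 ^ N * real ?n)"
      by (simp only: 1 2)
    also have "\<dots> = ?B N k - ?B N (Suc k)"
      using that by (simp only: b B) (simp add: divide_simps, simp add: algebra_simps)
    finally show ?thesis .
  qed
  have "?B ?n 0 = ?B N 0 / 2" by (simp add: Bernstein_def)
  then have c0: "c 0 = - ?B N 0" by (simp add: c_def del: of_nat_Suc)
  have "shift_diff e N f x = (\<Sum>k\<le>N. ?B N k * ?\<phi> (Suc k)) - (\<Sum>k\<le>N. ?B N k * ?\<phi> k)"
    using funpow_swap1[of "\<lambda>x. x + e" _ x] by (simp add: shift_diff_def shift_avg_power)
  also have "(\<Sum>k\<le>N. ?B N k * ?\<phi> k) = (\<Sum>k\<le>Suc N. ?B N k * ?\<phi> k)" using z by simp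
  also have "\<dots> = ?B N 0 * ?\<phi> 0 + (\<Sum>k\<le>N. ?B N (Suc k) * ?\<phi> (Suc k))"
    by (rule sum.atMost_Suc_shift)
  also have "(\<Sum>k\<le>N. ?B N k * ?\<phi> (Suc k)) - \<dots> = c 0 * ?\<phi> 0 + (\<Sum>k\<le>N. c (Suc k) * ?\<phi> (Suc k))"
  proof -
    have "(\<Sum>k\<le>N. c (Suc k) * ?\<phi> (Suc k)) = (\<Sum>k\<le>N. (?B N k - ?B N (Suc k)) * ?\<phi> (Suc k))"
      by (intro sum.cong) (simp_all add: cSuc)
    then show ?thesis by (simp add: c0 sum_subtractf left_diff_distrib)
  qed
  also have "\<dots> = (\<Sum>k\<le>?n. c k * ?\<phi> k)"
    by (rule sum.atMost_Suc_shift[symmetric])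
  finally have eq: "shift_diff e N f x = (\<Sum>k\<le>?n. c k * ?\<phi> k)" .
  have M0: "0 \<le> M" using M[of x] by linarith
  have "\<bar>shift_diff e N f x\<bar> \<le> (\<Sum>k\<le>?n. \<bar>c k\<bar> * M)"
    unfolding eq
  proof (rule order_trans[OF sum_abs], rule sum_mono)
    fix k
    show "\<bar>c k * ?\<phi> k\<bar> \<le> \<bar>c k\<bar> * M" unfolding abs_mult by (intro mult_left_mono M abs_ge_zero)
  qed
  also have "\<dots> = (\<Sum>k\<le>?n. sqrt (?B ?n k) * (sqrt (?B ?n k) * \<bar>2 * real k - real ?n\<bar>)) * (2 / real ?n * M)"
    unfolding sum_distrib_right
    by (intro sum.cong refl) (simp add: c_def abs_mult Bernstein_nonneg mult.assoc[symmetric])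
  also have "\<dots> \<le> sqrt (real ?n) * (2 / real ?n * M)"
  proof (rule mult_right_mono)
    have "(\<Sum>k\<le>?n. sqrt (?B ?n k) * (sqrt (?B ?n k) * \<bar>2 * real k - real ?n\<bar>))
      \<le> L2_set (\<lambda>k. sqrt (?B ?n k)) {..?n} * L2_set (\<lambda>k. sqrt (?B ?n k) * \<bar>2 * real k - real ?n\<bar>) {..?n}"
      using L2_set_mult_ineq[of "\<lambda>k. sqrt (?B ?n k)" "\<lambda>k. sqrt (?B ?n k) * \<bar>2 * real k - real ?n\<bar>" "{..?n}"]
      by (simp add: abs_mult Bernstein_nonneg del: sum.atMost_Suc)
    also have "\<dots> = 1 * sqrt (real ?n)"
    proof -
      have "L2_set (\<lambda>k. sqrt (?B ?n k)) {..?n} = 1"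
        unfolding L2_set_def by (simp add: Bernstein_nonneg del: sum.atMost_Suc)
      moreover have "L2_set (\<lambda>k. sqrt (?B ?n k) * \<bar>2 * real k - real ?n\<bar>) {..?n} = sqrt (real ?n)"
        unfolding L2_set_def power_mult_distrib
        using Bernstein_half_second_moment[of ?n] by (simp add: Bernstein_nonneg del: sum.atMost_Suc of_nat_Suc)
      ultimately show ?thesis by simp
    qed
    finally show "(\<Sum>k\<le>?n. sqrt (?B ?n k) * (sqrt (?B ?n k) * \<bar>2 * real k - real ?n\<bar>)) \<le> sqrt (real ?n)"
      by simp
  qed (use M0 in simp)
  also have "\<dots> = 2 * M / sqrt (real N + 1)"
    by (simp add: field_simps real_sqrt_mult_self)
  finally show ?thesis .
qed

section \<open>Reciprocal moments of a random number of coin flips\<close>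

lemma sqrt_convex_comb_le:
  assumes "0 \<le> q" "q \<le> 1" "0 \<le> a" "0 \<le> b"
  shows "q * sqrt a + (1 - q) * sqrt b \<le> sqrt (q * a + (1 - q) * b)"
proof (rule real_le_rsqrt)
  have "q * a + (1 - q) * b - (q * sqrt a + (1 - q) * sqrt b)\<^sup>2 = q * (1 - q) * (sqrt a - sqrt b)\<^sup>2"
  proof -
    have "a = sqrt a ^ 2" "b = sqrt b ^ 2" using assms by auto
    then have "q * a + (1 - q) * b = q * (sqrt a)\<^sup>2 + (1 - q) * (sqrt b)\<^sup>2" by simp
    then show ?thesis by (simp add: power2_eq_square algebra_simps)
  qed
  also have "\<dots> \<ge> 0" using assms by simp
  finally show "(q * sqrt a + (1 - q) * sqrt b)\<^sup>2 \<le> q * a + (1 - q) * b" by simp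
qed

text \<open>For R a sum of independent Bernoulli(\<open>q i\<close>) variables the product is E z^R,
  so the integral is E[1 / (N + 1 + R)]: a reciprocal moment of the number of flips when
  \<open>N\<close> of them are certain and R are random.\<close>

definition mixed_moment :: "('i \<Rightarrow> real) \<Rightarrow> 'i set \<Rightarrow> nat \<Rightarrow> real" where
  "mixed_moment q I N = integral {0..1} (\<lambda>z. z ^ N * (\<Prod>i\<in>I. 1 - q i * (1 - z)))"

lemma mixed_moment_empty: "mixed_moment q {} N = 1 / (real N + 1)"
proof -
  have "((\<lambda>z::real. z ^ N) has_integral (1 ^ Suc N / real (Suc N) - 0 ^ Suc N / real (Suc N))) {0..1}"
  proof (rule fundamental_theorem_of_calculus)
    show "((\<lambda>z. z ^ Suc N / real (Suc N)) has_vector_derivative z ^ N) (at z within {0..1})" for z :: real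
      using DERIV_cdivide[OF DERIV_pow[of "Suc N" z "{0..1}"], of "real (Suc N)"]
      by (simp add: has_real_derivative_iff_has_vector_derivative[symmetric] del: of_nat_Suc power_Suc)
  qed simp
  then show ?thesis by (simp add: mixed_moment_def integral_unique field_simps)
qed

text \<open>Conditioning on the Bernoulli variable of \<open>i\<close>: success turns
  \<open>N\<close> into \<open>N + 1\<close>.\<close>

lemma mixed_moment_insert:
  assumes "finite I" "i \<notin> I"
  shows "mixed_moment q (insert i I) N = q i * mixed_moment q I (Suc N) + (1 - q i) * mixed_moment q I N"
proof -
  have [simp]: "(\<lambda>z. z ^ N * (\<Prod>i\<in>I. 1 - q i * (1 - z))) integrable_on {0..1}" for N
    by (intro integrable_continuous_real continuous_intros)
  have "mixed_moment q (insert i I) N = integral {0..1} (\<lambda>z. q i * (z ^ Suc N * (\<Prod>i\<in>I. 1 - q i * (1 - z)))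
      + (1 - q i) * (z ^ N * (\<Prod>i\<in>I. 1 - q i * (1 - z))))"
    unfolding mixed_moment_def using assms by (intro integral_cong) (simp add: algebra_simps)
  also have "\<dots> = q i * mixed_moment q I (Suc N) + (1 - q i) * mixed_moment q I N"
    unfolding mixed_moment_def
    by (subst integral_add) (simp_all only: integral_mult_right, (intro integrable_continuous_real continuous_intros)+)
  finally show ?thesis .
qed

lemma mixed_moment_nonneg:
  assumes "\<And>i. i \<in> I \<Longrightarrow> 0 \<le> q i \<and> q i \<le> 1"
  shows "0 \<le> mixed_moment q I N"
  unfolding mixed_moment_def
proof (rule integral_nonneg)
  fix z :: real assume z: "z \<in> {0..1}"
  have "0 \<le> 1 - q i * (1 - z)" if "i \<in> I" for i
    using assms[OF that] z mult_mono[of "q i" 1 "1 - z" 1] by simp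
  then show "0 \<le> z ^ N * (\<Prod>i\<in>I. 1 - q i * (1 - z))" using z by (auto intro!: mult_nonneg_nonneg prod_nonneg)
qed (intro integrable_continuous_real continuous_intros)

text \<open>Each factor is at most exp(-q_i (1 - z)), and the integral of exp(-s (1 - z)) is (1 -
  exp(-s)) / s.\<close>

lemma mixed_moment_le:
  assumes "\<And>i. i \<in> I \<Longrightarrow> 0 \<le> q i \<and> q i \<le> 1" "finite I" and s: "0 < s" "s \<le> (\<Sum>i\<in>I. q i)"
  shows "mixed_moment q I 0 \<le> 1 / s"
proof -
  have "((\<lambda>z. exp (- (s * (1 - z)))) has_integral (exp (- (s * (1 - 1))) / s - exp (- (s * (1 - 0))) / s)) {0..1}"
    by (rule fundamental_theorem_of_calculus)
       (use s in \<open>auto intro!: derivative_eq_intros simp: has_real_derivative_iff_has_vector_derivative[symmetric]\<close>)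
  then have E: "integral {0..1} (\<lambda>z. exp (- (s * (1 - z)))) = (1 - exp (- s)) / s"
    by (simp add: integral_unique diff_divide_distrib)
  have "mixed_moment q I 0 \<le> integral {0..1} (\<lambda>z. exp (- (s * (1 - z))))"
    unfolding mixed_moment_def
  proof (rule integral_le)
    fix z :: real assume z: "z \<in> {0..1}"
    have 0: "0 \<le> 1 - q i * (1 - z)" if "i \<in> I" for i
      using assms(1)[OF that] z mult_mono[of "q i" 1 "1 - z" 1] by simp
    have e: "1 - q i * (1 - z) \<le> exp (- (q i * (1 - z)))" for i
      using exp_ge_add_one_self[of "- (q i * (1 - z))"] by linarith
    have "(\<Prod>i\<in>I. 1 - q i * (1 - z)) \<le> (\<Prod>i\<in>I. exp (- (q i * (1 - z))))"
      by (intro prod_mono conjI 0 e)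
    also have "\<dots> = exp (- ((\<Sum>i\<in>I. q i) * (1 - z)))"
      using \<open>finite I\<close> by (simp add: exp_sum[symmetric] sum_negf sum_distrib_right)
    also have "\<dots> \<le> exp (- (s * (1 - z)))" using s z by (auto intro!: mult_right_mono)
    finally show "z ^ 0 * (\<Prod>i\<in>I. 1 - q i * (1 - z)) \<le> exp (- (s * (1 - z)))" by simp
  qed (intro integrable_continuous_real continuous_intros)+
  also have "\<dots> \<le> 1 / s" unfolding E using s by (intro divide_right_mono) auto
  finally show ?thesis .
qed

section \<open>Integration over discrete laws\<close>

lemma
  fixes f :: "'a \<times> 'b \<Rightarrow> real"
  assumes f: "integrable (pair_pmf p q) f"
  shows integrable_pair_pmf_fst: "integrable p (\<lambda>x. \<integral>y. f (x, y) \<partial>q)"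
    and integral_pair_pmf: "(\<integral>z. f z \<partial>pair_pmf p q) = (\<integral>x. \<integral>y. f (x, y) \<partial>q \<partial>p)"
proof -
  \<comment> \<open>For a nonnegative integrand a finite iterated integral forces almost all inner
    integrals to be finite. The signed case is the difference of its two parts, on the almost sure
    event where both inner integrals exist.\<close>
  have nonneg: "(AE x in p. integrable q (\<lambda>y. g (x, y))) \<and> integrable p (\<lambda>x. \<integral>y. g (x, y) \<partial>q) \<and>
      (\<integral>z. g z \<partial>pair_pmf p q) = (\<integral>x. \<integral>y. g (x, y) \<partial>q \<partial>p)"
    if g: "integrable (pair_pmf p q) g" and g0: "\<And>z. 0 \<le> g z" for g :: "'a \<times> 'b \<Rightarrow> real"
  proof -
    have fin: "(\<integral>\<^sup>+x. \<integral>\<^sup>+y. g (x, y) \<partial>q \<partial>p) < \<infinity>"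
      using g g0 by (simp add: integrable_iff_bounded nn_integral_pair_pmf')
    have "AE x in p. (\<integral>\<^sup>+y. g (x, y) \<partial>q) \<noteq> \<infinity>"
      by (rule nn_integral_PInf_AE) (use fin in auto)
    then have int: "AE x in p. integrable q (\<lambda>y. g (x, y))"
      by eventually_elim (use g0 in \<open>auto simp: integrable_iff_bounded top.not_eq_extremum\<close>)
    have eq: "(\<integral>\<^sup>+x. ennreal (\<integral>y. g (x, y) \<partial>q) \<partial>p) = (\<integral>\<^sup>+x. \<integral>\<^sup>+y. g (x, y) \<partial>q \<partial>p)"
      by (rule nn_integral_cong_AE, use int in eventually_elim) (use g0 in \<open>simp add: nn_integral_eq_integral\<close>)
    have nn: "0 \<le> (\<integral>y. g (x, y) \<partial>q)" for x by (simp add: g0)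
    have i2: "integrable p (\<lambda>x. \<integral>y. g (x, y) \<partial>q)"
      using fin eq nn by (simp add: integrable_iff_bounded)
    have "ennreal (\<integral>z. g z \<partial>pair_pmf p q) = ennreal (\<integral>x. \<integral>y. g (x, y) \<partial>q \<partial>p)"
      using g g0 i2 nn eq by (simp add: nn_integral_eq_integral[symmetric] nn_integral_pair_pmf')
    then show ?thesis using int i2 g0 by (simp add: ennreal_inj)
  qed
  let ?g = "\<lambda>z. max 0 (f z)" and ?h = "\<lambda>z. max 0 (- f z)"
  have g: "integrable (pair_pmf p q) ?g" and h: "integrable (pair_pmf p q) ?h"
    using f by (intro integrable_max integrable_zero integrable_minus; simp)+
  note G = nonneg[OF g max.cobounded1] and H = nonneg[OF h max.cobounded1]
  have fgh: "f z = ?g z - ?h z" for z by simp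
  have A: "AE x in p. integrable q (\<lambda>y. f (x, y)) \<and> (\<integral>y. f (x, y) \<partial>q) = (\<integral>y. ?g (x, y) \<partial>q) - (\<integral>y. ?h (x, y) \<partial>q)"
    using conjunct1[OF G] conjunct1[OF H]
    by eventually_elim (subst (1 2) fgh, auto)
  have A2: "AE x in p. (\<integral>y. ?g (x, y) \<partial>q) - (\<integral>y. ?h (x, y) \<partial>q) = (\<integral>y. f (x, y) \<partial>q)"
    using A by eventually_elim simp
  have i: "integrable p (\<lambda>x. (\<integral>y. ?g (x, y) \<partial>q) - (\<integral>y. ?h (x, y) \<partial>q))"
    using G H by (intro Bochner_Integration.integrable_diff) auto
  then show "integrable p (\<lambda>x. \<integral>y. f (x, y) \<partial>q)"
    by (subst integrable_cong_AE[symmetric, OF _ _ A2]) auto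
  have "(\<integral>z. f z \<partial>pair_pmf p q) = (\<integral>z. ?g z \<partial>pair_pmf p q) - (\<integral>z. ?h z \<partial>pair_pmf p q)"
    by (subst fgh, rule Bochner_Integration.integral_diff[OF g h])
  also have "\<dots> = (\<integral>x. (\<integral>y. ?g (x, y) \<partial>q) - (\<integral>y. ?h (x, y) \<partial>q) \<partial>p)"
    using G H by (subst Bochner_Integration.integral_diff) auto
  also have "\<dots> = (\<integral>x. \<integral>y. f (x, y) \<partial>q \<partial>p)"
    by (rule integral_cong_AE[OF _ _ A2]) auto
  finally show "(\<integral>z. f z \<partial>pair_pmf p q) = (\<integral>x. \<integral>y. f (x, y) \<partial>q \<partial>p)" .
qed

lemma integrable_pmf_bounded:
  fixes f :: "'a \<Rightarrow> real"
  assumes "\<And>x. \<bar>f x\<bar> \<le> M"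
  shows "integrable (measure_pmf p) f"
  by (rule measure_pmf.integrable_const_bound[where B=M]) (use assms in auto)

text \<open>Covers nonintegrable \<open>f\<close> as well: such an integral is 0 by convention, and
  \<open>0 \<le> M\<close> follows from the bound at any point.\<close>

lemma abs_expectation_le:
  fixes f :: "'a \<Rightarrow> real"
  assumes "prob_space N" "\<And>x. \<bar>f x\<bar> \<le> M"
  shows "\<bar>\<integral>x. f x \<partial>N\<bar> \<le> M"
proof -
  interpret prob_space N by fact
  have M: "0 \<le> M" using assms(2)[of undefined] by linarith
  show ?thesis
  proof (cases "integrable N f")
    case True
    have "\<bar>\<integral>x. f x \<partial>N\<bar> \<le> (\<integral>x. \<bar>f x\<bar> \<partial>N)" by (rule integral_abs_bound)
    also have "\<dots> \<le> (\<integral>x. M \<partial>N)" by (intro integral_mono integrable_abs True) (use assms in auto)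
    finally show ?thesis by (simp add: prob_space)
  qed (simp add: not_integrable_integral_eq M)
qed

section \<open>Independent sums and the overlap of a law with its translate\<close>

definition sum_pmf :: "'i set \<Rightarrow> ('i \<Rightarrow> 'a::ab_group_add pmf) \<Rightarrow> 'a pmf" where
  "sum_pmf I Y = map_pmf (\<lambda>\<omega>. \<Sum>i\<in>I. \<omega> i) (Pi_pmf I 0 Y)"

lemma sum_pmf_empty: "sum_pmf {} Y = return_pmf 0"
  by (simp add: sum_pmf_def)

lemma sum_pmf_insert:
  fixes Y :: "'i \<Rightarrow> 'a::ab_group_add pmf"
  assumes "finite I" "i \<notin> I"
  shows "sum_pmf (insert i I) Y = map_pmf (\<lambda>(y, w). y + w) (pair_pmf (Y i) (sum_pmf I Y))"
proof -
  have "(\<Sum>j\<in>insert i I. (f(i := y)) j) = y + (\<Sum>j\<in>I. f j)" for f and y :: 'a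
  proof -
    have "(\<Sum>j\<in>I. (f(i := y)) j) = (\<Sum>j\<in>I. f j)" using assms by (intro sum.cong) auto
    then show ?thesis using assms by simp
  qed
  then show ?thesis unfolding sum_pmf_def
    by (simp add: Pi_pmf_insert[OF assms] pair_map_pmf2 map_pmf_comp case_prod_beta' apsnd_def map_prod_def del: fun_upd_apply)
qed

text \<open>The mass common to \<open>p\<close> and its translate by \<open>e\<close>, that is, one
  minus their total variation distance.\<close>

definition shift_overlap :: "'a::ab_group_add \<Rightarrow> 'a pmf \<Rightarrow> real" where
  "shift_overlap e p = (\<integral>x. min (pmf p x) (pmf p (x - e)) \<partial>count_space UNIV)"

lemma integral_pmf_count_space:
  fixes f :: "'a \<Rightarrow> real"
  shows "(\<integral>x. f x \<partial>measure_pmf p) = (\<integral>x. pmf p x * f x \<partial>count_space UNIV)"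
  by (simp add: measure_pmf_eq_density integral_density)

lemma integral_count_space_shift:
  fixes f :: "'a::ab_group_add \<Rightarrow> real"
  shows "(\<integral>x. f (x + e) \<partial>count_space UNIV) = (\<integral>x. f x \<partial>count_space UNIV)"
    and "integrable (count_space UNIV) f \<Longrightarrow> integrable (count_space UNIV) (\<lambda>x. f (x + e))"
proof -
  have b: "bij_betw (\<lambda>x. x + e) UNIV UNIV"
    by (rule bij_betw_byWitness[where f' = "\<lambda>x. x - e"]) auto
  have d: "distr (count_space UNIV) (count_space UNIV) (\<lambda>x. x + e) = count_space UNIV"
    by (rule distr_bij_count_space[OF b])
  show "(\<integral>x. f (x + e) \<partial>count_space UNIV) = (\<integral>x. f x \<partial>count_space UNIV)"
    by (subst (2) d[symmetric], subst integral_distr) auto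
  show "integrable (count_space UNIV) (\<lambda>x. f (x + e))" if "integrable (count_space UNIV) f"
    using that by (subst (asm) d[symmetric], subst (asm) integrable_distr_eq) auto
qed

lemma integrable_count_space_bounded_mult:
  fixes f g :: "'a \<Rightarrow> real"
  assumes "integrable (count_space UNIV) f" "\<And>x. \<bar>g x\<bar> \<le> M"
  shows "integrable (count_space UNIV) (\<lambda>x. f x * g x)"
proof (rule Bochner_Integration.integrable_bound[where f="\<lambda>x. M * f x"])
  show "AE x in count_space UNIV. norm (f x * g x) \<le> norm (M * f x)"
  proof (rule AE_I2)
    fix x
    have "0 \<le> M" using assms(2)[of x] by linarith
    then show "norm (f x * g x) \<le> norm (M * f x)"
      using mult_left_mono[OF assms(2)[of x], of "\<bar>f x\<bar>"] by (simp add: abs_mult mult.commute)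
  qed
qed (use assms in auto)

lemma abs_integral_count_space_mult_le:
  fixes f g :: "'a \<Rightarrow> real"
  assumes f: "integrable (count_space UNIV) f" and f0: "\<And>x. 0 \<le> f x" and g: "\<And>x. \<bar>g x\<bar> \<le> M"
  shows "\<bar>\<integral>x. f x * g x \<partial>count_space UNIV\<bar> \<le> (\<integral>x. f x \<partial>count_space UNIV) * M"
proof -
  have "\<bar>\<integral>x. f x * g x \<partial>count_space UNIV\<bar> \<le> (\<integral>x. \<bar>f x * g x\<bar> \<partial>count_space UNIV)"
    by (rule integral_abs_bound)
  also have "\<dots> \<le> (\<integral>x. f x * M \<partial>count_space UNIV)"
    by (intro integral_mono integrable_abs integrable_count_space_bounded_mult[OF f g] integrable_mult_left f)
       (use f0 g in \<open>auto simp: abs_mult intro!: mult_left_mono\<close>)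
  finally show ?thesis by simp
qed

lemma shift_overlap_bounds: "0 \<le> shift_overlap e p" "shift_overlap e p \<le> 1"
  and integrable_min_pmf_shift: "integrable (count_space UNIV) (\<lambda>x. min (pmf p x) (pmf p (x - e)))"
proof -
  show i: "integrable (count_space UNIV) (\<lambda>x. min (pmf p x) (pmf p (x - e)))"
    by (rule Bochner_Integration.integrable_bound[OF integrable_pmf[of UNIV p]]) auto
  show "0 \<le> shift_overlap e p" unfolding shift_overlap_def by (simp add: integral_nonneg)
  have "shift_overlap e p \<le> (\<integral>x. pmf p x \<partial>count_space UNIV)"
    unfolding shift_overlap_def by (intro integral_mono i integrable_pmf) auto
  then show "shift_overlap e p \<le> 1" by (simp add: integral_pmf)
qed

text \<open>The overlap \<open>q = min p (p (\<sqdot> - e))\<close> satisfies \<open>p \<ge> (q + q (\<sqdot> + e)) / 2\<close>, so a random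
  vector with law \<open>p\<close> contains, with probability the mass of \<open>q\<close>, a fair coin flip in direction \<open>e\<close>.\<close>

lemma abs_expectation_shift_avg_le:
  fixes G :: "'a::ab_group_add \<Rightarrow> real"
  assumes B0: "\<And>z. \<bar>G z\<bar> \<le> B0" and B1: "\<And>z. \<bar>shift_avg e G z\<bar> \<le> B1"
  shows "\<bar>\<integral>y. G (x + y) \<partial>measure_pmf p\<bar> \<le> shift_overlap e p * B1 + (1 - shift_overlap e p) * B0"
proof -
  let ?C = "count_space UNIV :: 'a measure"
  define q where "q y = min (pmf p y) (pmf p (y - e))" for y
  define r where "r y = pmf p y - (q y + q (y + e)) / 2" for y
  have qi: "integrable ?C q" unfolding q_def by (rule integrable_min_pmf_shift)
  have qi': "integrable ?C (\<lambda>y. q (y + e))" by (rule integral_count_space_shift(2)[OF qi])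
  have q0: "0 \<le> q y" for y by (simp add: q_def)
  \<comment> \<open>Both \<open>q y\<close> and \<open>q (y + e)\<close> are at most
    \<open>pmf p y\<close>, hence so is their mean.\<close>
  have r0: "0 \<le> r y" for y by (auto simp: r_def q_def min_def)
  have pi: "integrable ?C (pmf p)" by (rule integrable_pmf)
  have ri: "integrable ?C r" unfolding r_def using qi qi' pi by auto
  have qo: "(\<integral>y. q y \<partial>?C) = shift_overlap e p" by (simp add: q_def shift_overlap_def)
  have rint: "(\<integral>y. r y \<partial>?C) = 1 - shift_overlap e p"
    unfolding r_def using qi qi' pi by (simp add: integral_count_space_shift(1) qo integral_pmf)
  have Gb: "\<bar>G (x + y)\<bar> \<le> B0" "\<bar>G (x + (y - e))\<bar> \<le> B0" for y by (rule B0)+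
  note I = integrable_count_space_bounded_mult[OF _ Gb(1)] integrable_count_space_bounded_mult[OF _ Gb(2)]
  have "(\<integral>y. G (x + y) \<partial>measure_pmf p) = (\<integral>y. (q y * G (x + y) + q (y + e) * G (x + y)) / 2 + r y * G (x + y) \<partial>?C)"
    unfolding integral_pmf_count_space by (intro Bochner_Integration.integral_cong refl) (simp add: r_def field_simps)
  also have "\<dots> = ((\<integral>y. q y * G (x + y) \<partial>?C) + (\<integral>y. q (y + e) * G (x + y) \<partial>?C)) / 2 + (\<integral>y. r y * G (x + y) \<partial>?C)"
    using I(1)[OF qi] I(1)[OF qi'] I(1)[OF ri] by simp
  \<comment> \<open>After reindexing, the two outcomes of the flip sit at y - e and y, and together
    they form \<open>shift_avg e G\<close>.\<close>
  also have "(\<integral>y. q (y + e) * G (x + y) \<partial>?C) = (\<integral>y. q y * G (x + (y - e)) \<partial>?C)"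
    using integral_count_space_shift(1)[of "\<lambda>y. q y * G (x + (y - e))" e] by simp
  also have "((\<integral>y. q y * G (x + y) \<partial>?C) + (\<integral>y. q y * G (x + (y - e)) \<partial>?C)) / 2 =
      (\<integral>y. q y * shift_avg e G (x + (y - e)) \<partial>?C)"
    unfolding Bochner_Integration.integral_add[OF I(1)[OF qi] I(2)[OF qi], symmetric]
      Bochner_Integration.integral_divide_zero[symmetric]
    by (intro Bochner_Integration.integral_cong refl) (simp add: shift_avg_def algebra_simps)
  finally have "\<bar>\<integral>y. G (x + y) \<partial>measure_pmf p\<bar> \<le>
      \<bar>\<integral>y. q y * shift_avg e G (x + (y - e)) \<partial>?C\<bar> + \<bar>\<integral>y. r y * G (x + y) \<partial>?C\<bar>"
    by linarith
  also have "\<dots> \<le> (\<integral>y. q y \<partial>?C) * B1 + (\<integral>y. r y \<partial>?C) * B0"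
    by (intro add_mono abs_integral_count_space_mult_le qi q0 ri r0 B0 B1)
  finally show ?thesis by (simp add: qo rint)
qed

text \<open>Induction over the summands with \<open>N\<close> arbitrary: a new summand either
  provides one more flip, turning \<open>N\<close> into \<open>Suc N\<close>, or leaves
  \<open>N\<close> alone. Concavity of the square root moves this mixture under the root, where it
  becomes the recursion of \<open>mixed_moment\<close>.\<close>

lemma abs_expectation_shift_diff_le:
  fixes f :: "'a::ab_group_add \<Rightarrow> real"
  assumes "finite I" and M: "\<And>x. \<bar>f x\<bar> \<le> M"
  shows "\<bar>\<integral>w. shift_diff e N f (x + w) \<partial>measure_pmf (sum_pmf I Y)\<bar>
    \<le> 2 * M * sqrt (mixed_moment (\<lambda>i. shift_overlap e (Y i)) I N)"
  using \<open>finite I\<close>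
proof (induction I arbitrary: N x rule: finite_induct)
  case empty
  then show ?case
    using shift_diff_bound[of f M e N x] M by (simp add: sum_pmf_empty mixed_moment_empty real_sqrt_divide)
next
  case (insert i I)
  let ?q = "\<lambda>i. shift_overlap e (Y i)"
  let ?G = "\<lambda>N z. \<integral>w. shift_diff e N f (z + w) \<partial>measure_pmf (sum_pmf I Y)"
  have M0: "0 \<le> M" using M[of 0] by linarith
  have bd: "\<bar>shift_diff e N f z\<bar> \<le> 2 * M / sqrt (real N + 1)" for N z
    by (rule shift_diff_bound[OF M])
  note int = integrable_pmf_bounded[OF bd]
  have av: "shift_avg e (?G N) z = ?G (Suc N) z" for z
  proof -
    have "shift_avg e (?G N) z = (\<integral>w. (shift_diff e N f (z + w) + shift_diff e N f (z + e + w)) / 2 \<partial>measure_pmf (sum_pmf I Y))"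
      unfolding shift_avg_def Bochner_Integration.integral_divide_zero
      by (subst Bochner_Integration.integral_add) (rule int refl)+
    also have "\<dots> = ?G (Suc N) z"
      by (simp add: shift_diff_Suc algebra_simps)
    finally show ?thesis .
  qed
  have "(\<integral>w. shift_diff e N f (x + w) \<partial>measure_pmf (sum_pmf (insert i I) Y)) =
      (\<integral>y. ?G N (x + y) \<partial>measure_pmf (Y i))"
    unfolding sum_pmf_insert[OF insert.hyps] integral_map_pmf
    by (subst integral_pair_pmf) (auto intro!: integrable_pmf_bounded[OF bd] simp: case_prod_beta add.assoc)
  also have "\<bar>\<dots>\<bar> \<le> ?q i * (2 * M * sqrt (mixed_moment ?q I (Suc N))) + (1 - ?q i) * (2 * M * sqrt (mixed_moment ?q I N))"
    by (rule abs_expectation_shift_avg_le) (use insert.IH av in auto)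
  also have "\<dots> = 2 * M * (?q i * sqrt (mixed_moment ?q I (Suc N)) + (1 - ?q i) * sqrt (mixed_moment ?q I N))"
    by (simp add: algebra_simps)
  also have "\<dots> \<le> 2 * M * sqrt (mixed_moment ?q (insert i I) N)"
    unfolding mixed_moment_insert[OF insert.hyps]
    by (intro mult_left_mono sqrt_convex_comb_le mixed_moment_nonneg) (use M0 shift_overlap_bounds in auto)
  finally show ?case .
qed

text \<open>With no certain flip, N = 0, all the smoothness comes from the random flips; their mean
  number is at least \<open>s\<close>, and E[1 / (1 + R)] is at most 1/s.\<close>

lemma expectation_sum_pmf_shift_le:
  fixes f :: "'a::ab_group_add \<Rightarrow> real"
  assumes "finite I" and M: "\<And>x. \<bar>f x\<bar> \<le> M" and s: "0 < s" "s \<le> (\<Sum>i\<in>I. shift_overlap e (Y i))"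
  shows "\<bar>(\<integral>w. f (w + e) \<partial>measure_pmf (sum_pmf I Y)) - (\<integral>w. f w \<partial>measure_pmf (sum_pmf I Y))\<bar> \<le> 2 * M / sqrt s"
proof -
  have M0: "0 \<le> M" using M[of 0] by linarith
  have "(\<integral>w. f (w + e) \<partial>measure_pmf (sum_pmf I Y)) - (\<integral>w. f w \<partial>measure_pmf (sum_pmf I Y)) =
      (\<integral>w. shift_diff e 0 f (0 + w) \<partial>measure_pmf (sum_pmf I Y))"
    using integrable_pmf_bounded[of f M] integrable_pmf_bounded[of "\<lambda>w. f (w + e)" M] M
    by (simp add: shift_diff_def)
  also have "\<bar>\<dots>\<bar> \<le> 2 * M * sqrt (mixed_moment (\<lambda>i. shift_overlap e (Y i)) I 0)"
    by (rule abs_expectation_shift_diff_le[OF assms(1) M])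
  also have "\<dots> \<le> 2 * M * sqrt (1 / s)"
    by (intro mult_left_mono real_sqrt_le_mono mixed_moment_le assms) (use M0 shift_overlap_bounds in auto)
  finally show ?thesis by (simp add: real_sqrt_divide)
qed

text \<open>The overlap is one minus the excess of \<open>p\<close> over its translate on the set
  where \<open>p\<close> is larger, and that set is a competitor in the supremum. Thus the
  quantities u_i become a supply of coin flips.\<close>

lemma dtv_pmf_le_shift_overlap:
  "1 - dtv (measure_pmf p) (measure_pmf (map_pmf (\<lambda>x. x + e) p)) \<le> shift_overlap e p"
proof -
  let ?p' = "map_pmf (\<lambda>x. x + e) p"
  have p': "pmf ?p' x = pmf p (x - e)" for x
    using pmf_map_inj'[of "\<lambda>x. x + e" p "x - e"] by (simp add: inj_on_def)
  define A where "A = {x. pmf p x > pmf ?p' x}"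
  have eq: "shift_overlap e p = (\<integral>x. pmf p x - (pmf p x * indicator A x - pmf ?p' x * indicator A x) \<partial>count_space UNIV)"
    unfolding shift_overlap_def by (intro Bochner_Integration.integral_cong refl) (auto simp: A_def p' indicator_def)
  have eq2: "(\<integral>x. pmf p x - (pmf p x * indicator A x - pmf ?p' x * indicator A x) \<partial>count_space UNIV) = 1 - (measure p A - measure ?p' A)"
  proof -
    have i: "integrable (count_space UNIV) (\<lambda>x. pmf r x * indicator A x)" for r :: "'a pmf"
      by (rule integrable_count_space_bounded_mult[of _ _ 1]) (auto simp: integrable_pmf indicator_def)
    have m: "(\<integral>x. pmf r x * indicator A x \<partial>count_space UNIV) = measure r A" for r :: "'a pmf"
      by (simp add: integral_pmf_count_space[symmetric])
    show ?thesis using i integrable_pmf[of UNIV p] by (simp add: m integral_pmf)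
  qed
  have "measure p A - measure ?p' A \<le> dtv (measure_pmf p) (measure_pmf ?p')"
  proof -
    have "\<bar>measure p A - measure ?p' A\<bar> \<le> dtv (measure_pmf p) (measure_pmf ?p')"
      unfolding dtv_def
    proof (rule cSup_upper)
      show "bdd_above {\<bar>measure (measure_pmf p) A - measure (measure_pmf ?p') A\<bar> |A. A \<in> sets (measure_pmf p) \<inter> sets (measure_pmf ?p')}"
        by (rule bdd_aboveI[of _ 1]) (auto simp: abs_le_iff intro: order_trans[OF _ measure_pmf.prob_le_1] intro!: diff_le_eq[THEN iffD2] add_increasing2)
    qed auto
    then show ?thesis by linarith
  qed
  then show ?thesis using eq eq2 by linarith
qed

section \<open>Cholesky factors and the smallest eigenvalue\<close>

definition quad_form :: "nat \<Rightarrow> (nat \<Rightarrow> nat \<Rightarrow> real) \<Rightarrow> (nat \<Rightarrow> real) \<Rightarrow> real" where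
  "quad_form d M v = (\<Sum>j<d. \<Sum>k<d. v j * M j k * v k)"

definition mat_vec :: "nat \<Rightarrow> (nat \<Rightarrow> nat \<Rightarrow> real) \<Rightarrow> (nat \<Rightarrow> real) \<Rightarrow> nat \<Rightarrow> real" where
  "mat_vec d M v i = (\<Sum>j<d. M i j * v j)"

text \<open>A triangular factor is preferred to the symmetric square root: its determinant is the
  product of the diagonal, and Lebesgue measure can be transformed one coordinate at a time. The
  zeros above the diagonal are demanded at all indices, not only below \<open>d\<close>.\<close>

definition is_cholesky :: "nat \<Rightarrow> (nat \<Rightarrow> nat \<Rightarrow> real) \<Rightarrow> (nat \<Rightarrow> nat \<Rightarrow> real) \<Rightarrow> bool" where
  "is_cholesky d S B \<longleftrightarrow> (\<forall>i j. i < j \<longrightarrow> B i j = 0) \<and> (\<forall>i<d. 0 < B i i) \<and>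
     (\<forall>i<d. \<forall>j<d. (\<Sum>k<d. B i k * B j k) = S i j)"

definition is_lower_inverse :: "nat \<Rightarrow> (nat \<Rightarrow> nat \<Rightarrow> real) \<Rightarrow> (nat \<Rightarrow> nat \<Rightarrow> real) \<Rightarrow> bool" where
  "is_lower_inverse d B A \<longleftrightarrow> (\<forall>i<d. \<forall>j<d. (\<Sum>k<d. A i k * B k j) = (if i = j then 1 else 0)) \<and>
     (\<forall>i<d. \<forall>j<d. (\<Sum>k<d. B i k * A k j) = (if i = j then 1 else 0))"

lemma sum_delta_lessThan:
  fixes d j :: nat
  shows "j < d \<Longrightarrow> (\<Sum>k<d. (if k = j then 1 else 0) * f k) = (f j :: real)"
  "j < d \<Longrightarrow> (\<Sum>k<d. (if j = k then 1 else 0) * f k) = (f j :: real)"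
  "j < d \<Longrightarrow> (\<Sum>k<d. f k * (if k = j then 1 else 0)) = (f j :: real)"
  "j < d \<Longrightarrow> (\<Sum>k<d. f k * (if j = k then 1 else 0)) = (f j :: real)"
  by - (subst sum.remove[of _ j], auto intro!: sum.neutral)+

lemma left_inverse_right_inverse:
  fixes A B :: "nat \<Rightarrow> nat \<Rightarrow> real"
  assumes "\<forall>i<d. \<forall>j<d. (\<Sum>k<d. A i k * B k j) = (if i = j then 1 else 0)"
  shows "\<forall>i<d. \<forall>j<d. (\<Sum>k<d. B i k * A k j) = (if i = j then 1 else 0)"
proof -
  define A' where "A' = mat d d (\<lambda>(i, j). A i j)"
  define B' where "B' = mat d d (\<lambda>(i, j). B i j)"
  have c: "A' \<in> carrier_mat d d" "B' \<in> carrier_mat d d" by (simp_all add: A'_def B'_def)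
  have "A' * B' = 1\<^sub>m d"
    by (rule eq_matI) (use assms in \<open>auto simp: A'_def B'_def scalar_prod_def atLeast0LessThan\<close>)
  then have "B' * A' = 1\<^sub>m d"
    using mat_mult_left_right_inverse[OF c] by simp
  then have "(B' * A') $$ (i, j) = (if i = j then 1 else 0)" if "i < d" "j < d" for i j
    using that by simp
  then show ?thesis by (auto simp: A'_def B'_def scalar_prod_def atLeast0LessThan)
qed

lemma cholesky_inverse_exists:
  assumes "is_cholesky d S B"
  shows "\<exists>A. is_lower_inverse d B A"
proof -
  define B' where "B' = mat d d (\<lambda>(i, j). B i j)"
  have c: "B' \<in> carrier_mat d d" by (simp add: B'_def)
  have "det B' = prod_list (diag_mat B')"
    by (rule det_lower_triangular[OF _ c]) (use assms in \<open>auto simp: B'_def is_cholesky_def\<close>)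
  also have "\<dots> = (\<Prod>i<d. B i i)"
    by (simp add: prod_list_diag_prod B'_def atLeast0LessThan)
  also have "\<dots> \<noteq> 0" using assms by (force simp: is_cholesky_def)
  finally have "B' \<in> Units (ring_mat TYPE(real) d ())"
    using det_non_zero_imp_unit[OF c] by simp
  then obtain A' where A': "A' \<in> carrier_mat d d" "A' * B' = 1\<^sub>m d"
    unfolding Units_def by (auto simp: ring_mat_simps)
  have dA: "dim_row A' = d" "dim_col A' = d" using A' by auto
  have "(\<Sum>k<d. A' $$ (i, k) * B k j) = (if i = j then 1 else 0)" if "i < d" "j < d" for i j
  proof -
    have "(A' * B') $$ (i, j) = (if i = j then 1 else 0)" using A' dA that by simp
    then show ?thesis using that dA by (simp add: B'_def scalar_prod_def atLeast0LessThan)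
  qed
  then have "\<forall>i<d. \<forall>j<d. (\<Sum>k<d. A' $$ (i, k) * B k j) = (if i = j then 1 else 0)" by blast
  from this left_inverse_right_inverse[OF this] show ?thesis
    unfolding is_lower_inverse_def by (intro exI[of _ "\<lambda>i k. A' $$ (i, k)"] conjI)
qed

lemma mat_vec_compose:
  "mat_vec d M (mat_vec d N v) i = (\<Sum>j<d. (\<Sum>k<d. M i k * N k j) * v j)"
  unfolding mat_vec_def sum_distrib_left sum_distrib_right
  by (subst sum.swap) (simp add: mult.assoc)

lemma mat_vec_inverse:
  assumes "is_lower_inverse d B A" "i < d"
  shows "mat_vec d A (mat_vec d B v) i = v i" "mat_vec d B (mat_vec d A v) i = v i"
  using assms by (simp_all add: mat_vec_compose is_lower_inverse_def sum_delta_lessThan)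

lemma quad_form_cholesky:
  assumes "is_cholesky d S B"
  shows "quad_form d S v = (\<Sum>k<d. (\<Sum>i<d. B i k * v i)\<^sup>2)"
proof -
  have "quad_form d S v = (\<Sum>i<d. \<Sum>j<d. \<Sum>k<d. v i * B i k * (B j k * v j))"
    unfolding quad_form_def
  proof (intro sum.cong refl)
    fix i j assume "i \<in> {..<d}" "j \<in> {..<d}"
    then have "S i j = (\<Sum>k<d. B i k * B j k)" using assms by (simp add: is_cholesky_def)
    then show "v i * S i j * v j = (\<Sum>k<d. v i * B i k * (B j k * v j))"
      by (simp add: sum_distrib_left sum_distrib_right mult_ac)
  qed
  also have "\<dots> = (\<Sum>i<d. \<Sum>k<d. \<Sum>j<d. v i * B i k * (B j k * v j))"
    by (intro sum.cong refl sum.swap)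
  also have "\<dots> = (\<Sum>k<d. \<Sum>i<d. \<Sum>j<d. v i * B i k * (B j k * v j))" by (rule sum.swap)
  also have "\<dots> = (\<Sum>k<d. (\<Sum>i<d. B i k * v i)\<^sup>2)"
    by (intro sum.cong refl) (simp add: power2_eq_square sum_product mult_ac)
  finally show ?thesis .
qed

text \<open>Induction with a Schur complement: the new row \<open>r\<close> solves B r = (last
  column of S), and the new diagonal entry is the square root of S_dd - |r|^2, so the point is that
  this number is positive.\<close>

lemma cholesky_exists: "pos_def d S \<Longrightarrow> \<exists>B. is_cholesky d S B"
proof (induction d)
  case 0
  show ?case by (rule exI[of _ "\<lambda>i j. 0"]) (simp add: is_cholesky_def)
next
  case (Suc d)
  have sym: "S j k = S k j" if "j < Suc d" "k < Suc d" for j k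
    using Suc.prems that by (simp add: pos_def_def)
  have pos: "0 < quad_form (Suc d) S v" if "\<exists>k<Suc d. v k \<noteq> 0" for v
    using Suc.prems that unfolding pos_def_def quad_form_def by blast
  have qf: "quad_form (Suc d) S v = quad_form d S v + 2 * v d * (\<Sum>j<d. S j d * v j) + v d * S d d * v d" for v
  proof -
    have "(\<Sum>k<d. v d * S d k * v k) = v d * (\<Sum>j<d. S j d * v j)"
      unfolding sum_distrib_left by (intro sum.cong refl) (simp add: sym[of d])
    moreover have "(\<Sum>k<d. v k * S k d * v d) = v d * (\<Sum>j<d. S j d * v j)"
      unfolding sum_distrib_left by (intro sum.cong refl) simp
    ultimately show ?thesis by (simp add: quad_form_def sum.distrib)
  qed
  have "pos_def d S"
    unfolding pos_def_def
  proof (intro conjI allI impI)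
    fix v :: "nat \<Rightarrow> real" assume v: "\<exists>k<d. v k \<noteq> 0"
    then have "0 < quad_form (Suc d) S (v(d := 0))" by (intro pos) (auto intro: less_SucI)
    also have "\<dots> = quad_form d S v" unfolding qf by (simp add: quad_form_def)
    finally show "0 < (\<Sum>j<d. \<Sum>k<d. v j * S j k * v k)" by (simp add: quad_form_def)
  qed (simp add: sym)
  then obtain B where B: "is_cholesky d S B" using Suc.IH by blast
  obtain A where A: "is_lower_inverse d B A" using cholesky_inverse_exists[OF B] by blast
  define r where "r = mat_vec d A (\<lambda>j. S j d)"
  have Br: "(\<Sum>k<d. B j k * r k) = S j d" if "j < d" for j
    using mat_vec_inverse(2)[OF A that, of "\<lambda>j. S j d"] by (simp add: r_def mat_vec_def)
  define w where "w i = (\<Sum>k<d. A k i * r k)" for i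
  have BTw: "(\<Sum>i<d. B i k * w i) = r k" if "k < d" for k
  proof -
    have "(\<Sum>i<d. B i k * w i) = (\<Sum>i<d. \<Sum>l<d. A l i * B i k * r l)"
      by (simp add: w_def sum_distrib_left mult_ac)
    also have "\<dots> = (\<Sum>l<d. (\<Sum>i<d. A l i * B i k) * r l)"
      by (subst sum.swap) (simp add: sum_distrib_right)
    also have "\<dots> = r k" using A that by (simp add: is_lower_inverse_def sum_delta_lessThan)
    finally show ?thesis .
  qed
  have "(\<Sum>j<d. S j d * w j) = (\<Sum>j<d. \<Sum>k<d. B j k * r k * w j)"
    by (intro sum.cong refl) (simp add: Br[symmetric] sum_distrib_right)
  also have "\<dots> = (\<Sum>k<d. r k * (\<Sum>j<d. B j k * w j))"
    by (subst sum.swap) (simp add: sum_distrib_left mult_ac)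
  also have "\<dots> = (\<Sum>k<d. (r k)\<^sup>2)" by (simp add: BTw power2_eq_square)
  finally have Sw: "(\<Sum>j<d. S j d * w j) = (\<Sum>k<d. (r k)\<^sup>2)" .
  \<comment> \<open>With B^T w = r, the vector (-w, 1) minimises the quadratic form among vectors
    with last entry 1. The minimum is the Schur complement, which positive definiteness makes
    positive.\<close>
  define v where "v = (\<lambda>i. if i = d then 1 else - w i)"
  have "quad_form d S v = quad_form d S w" by (simp add: quad_form_def v_def)
  also have "\<dots> = (\<Sum>k<d. (r k)\<^sup>2)" by (simp add: quad_form_cholesky[OF B] BTw)
  finally have "quad_form (Suc d) S v = S d d - (\<Sum>k<d. (r k)\<^sup>2)"
    unfolding qf using Sw by (simp add: v_def sum_negf)
  moreover have "0 < quad_form (Suc d) S v" by (rule pos) (auto simp: v_def)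
  ultimately have p: "0 < S d d - (\<Sum>k<d. (r k)\<^sup>2)" by simp
  define B' where "B' i j = (if i = d then (if j < d then r j else if j = d then sqrt (S d d - (\<Sum>k<d. (r k)\<^sup>2)) else 0)
     else if i < d \<and> j < d then B i j else 0)" for i j
  have "is_cholesky (Suc d) S B'"
    unfolding is_cholesky_def
  proof (intro conjI allI impI)
    fix i j assume ij: "i < Suc d" "j < Suc d"
    have "(\<Sum>k<Suc d. B' i k * B' j k) = (\<Sum>k<d. B' i k * B' j k) + B' i d * B' j d" by simp
    also have "\<dots> = S i j"
    proof -
      consider "i < d" "j < d" | "i = d" "j < d" | "i < d" "j = d" | "i = d" "j = d" using ij by linarith
      then show ?thesis
      proof cases
        case 1 then show ?thesis using B by (simp add: B'_def is_cholesky_def)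
      next
        case 2 then show ?thesis using Br[of j] sym[of j d] by (simp add: B'_def mult.commute)
      next
        case 3 then show ?thesis using Br[of i] by (simp add: B'_def)
      next
        case 4 then show ?thesis using p by (simp add: B'_def power2_eq_square)
      qed
    qed
    finally show "(\<Sum>k<Suc d. B' i k * B' j k) = S i j" .
  next
    fix i j :: nat assume "i < j" then show "B' i j = 0" using B by (auto simp: B'_def is_cholesky_def)
  next
    fix i assume "i < Suc d" then show "0 < B' i i" using B p by (auto simp: B'_def is_cholesky_def)
  qed
  then show ?case by blast
qed

lemma mat_det_cholesky:
  assumes "is_cholesky d S B"
  shows "mat_det d S = (\<Prod>i<d. B i i)\<^sup>2"
proof -
  define B' where "B' = mat d d (\<lambda>(i, j). B i j)"
  define S' where "S' = mat d d (\<lambda>(i, j). S i j)"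
  have c: "B' \<in> carrier_mat d d" by (simp add: B'_def)
  have "S' = B' * transpose_mat B'"
    by (rule eq_matI) (use assms in \<open>auto simp: S'_def B'_def scalar_prod_def atLeast0LessThan is_cholesky_def\<close>)
  then have "det S' = det B' * det B'"
    using c by (simp add: det_mult[of _ d] det_transpose)
  also have "det B' = prod_list (diag_mat B')"
    by (rule det_lower_triangular[OF _ c]) (use assms in \<open>auto simp: B'_def is_cholesky_def\<close>)
  also have "\<dots> = (\<Prod>i<d. B i i)"
    by (simp add: prod_list_diag_prod B'_def atLeast0LessThan)
  also have "det S' = mat_det d S"
    unfolding mat_det_def det_def'[of S' d, unfolded S'_def, OF mat_carrier] S'_def
    by (intro sum.cong) (auto simp: atLeast0LessThan permutes_in_image intro!: prod.cong)
  finally show ?thesis by (simp add: power2_eq_square)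
qed

text \<open>S^(-1) = A^T A. Because \<open>mat_inv\<close> is a definite description, uniqueness
  must be shown too: any right inverse equals \<open>T\<close>, since \<open>T\<close> is also a
  left inverse.\<close>

lemma mat_inv_cholesky:
  assumes B: "is_cholesky d S B" and A: "is_lower_inverse d B A" and "i < d" "j < d"
  shows "mat_inv d S i j = (\<Sum>k<d. A k i * A k j)"
proof -
  define T where "T i j = (if i < d \<and> j < d then (\<Sum>k<d. A k i * A k j) else 0)" for i j
  have BA: "(\<Sum>k<d. B i k * A k j) = (if i = j then 1 else 0)" if "i < d" "j < d" for i j
    using A that by (simp add: is_lower_inverse_def)
  have AB: "(\<Sum>k<d. A i k * B k j) = (if i = j then 1 else 0)" if "i < d" "j < d" for i j
    using A that by (simp add: is_lower_inverse_def)
  have "(\<Sum>k<d. S i k * T k j) = (if i = j then 1 else 0)" if ij: "i < d" "j < d" for i j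
  proof -
    have "(\<Sum>k<d. S i k * T k j) = (\<Sum>k<d. \<Sum>l<d. \<Sum>n<d. B i l * A n j * (A n k * B k l))"
    proof (intro sum.cong refl)
      fix k assume k: "k \<in> {..<d}"
      have "S i k = (\<Sum>l<d. B i l * B k l)" using B ij k by (simp add: is_cholesky_def)
      moreover have "T k j = (\<Sum>n<d. A n k * A n j)" using k ij by (simp add: T_def)
      ultimately show "S i k * T k j = (\<Sum>l<d. \<Sum>n<d. B i l * A n j * (A n k * B k l))"
        by (simp only: sum_product) (simp add: mult_ac)
    qed
    also have "\<dots> = (\<Sum>l<d. \<Sum>n<d. \<Sum>k<d. B i l * A n j * (A n k * B k l))"
      by (subst sum.swap) (intro sum.cong refl sum.swap)
    also have "\<dots> = (\<Sum>l<d. \<Sum>n<d. B i l * A n j * (if n = l then 1 else 0))"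
      by (intro sum.cong refl) (simp add: sum_distrib_left[symmetric] AB)
    also have "\<dots> = (\<Sum>l<d. B i l * A l j)"
      by (intro sum.cong refl) (simp add: sum_delta_lessThan)
    also have "\<dots> = (if i = j then 1 else 0)" using ij by (rule BA)
    finally show ?thesis .
  qed
  then have T: "\<forall>i<d. \<forall>j<d. (\<Sum>k<d. S i k * T k j) = (if i = j then 1 else 0)" by blast
  have TS: "\<forall>i<d. \<forall>j<d. (\<Sum>k<d. T i k * S k j) = (if i = j then 1 else 0)"
    by (rule left_inverse_right_inverse[OF T])
  have "mat_inv d S = T"
    unfolding mat_inv_def
  proof (rule the_equality)
    show "(\<forall>i j. d \<le> i \<or> d \<le> j \<longrightarrow> T i j = 0) \<and> (\<forall>i<d. \<forall>j<d. (\<Sum>k<d. S i k * T k j) = (if i = j then 1 else 0))"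
      using T by (auto simp: T_def)
    fix U assume U: "(\<forall>i j. d \<le> i \<or> d \<le> j \<longrightarrow> U i j = 0) \<and> (\<forall>i<d. \<forall>j<d. (\<Sum>k<d. S i k * U k j) = (if i = j then 1 else 0))"
    have "U i j = T i j" if ij: "i < d" "j < d" for i j
    proof -
      have "U i j = (\<Sum>l<d. (\<Sum>k<d. T i k * S k l) * U l j)"
        using TS ij by (simp add: sum_delta_lessThan)
      also have "\<dots> = (\<Sum>k<d. T i k * (\<Sum>l<d. S k l * U l j))"
        unfolding sum_distrib_left sum_distrib_right by (subst sum.swap) (simp add: mult.assoc)
      also have "\<dots> = T i j" using U ij by (simp add: sum_delta_lessThan)
      finally show ?thesis .
    qed
    then show "U = T"
      using U by (intro ext) (metis T_def not_le)
  qed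
  then show ?thesis using assms(3,4) by (simp add: T_def)
qed

section \<open>The smallest eigenvalue as a coercivity constant\<close>

lemma finite_eigenvalues: "finite {l. is_eigenvalue d M l}"
proof -
  define M' where "M' = mat d d (\<lambda>(i, j). M i j)"
  have c: "M' \<in> carrier_mat d d" by (simp add: M'_def)
  \<comment> \<open>Cut to length \<open>d\<close>, the vector of \<open>is_eigenvalue\<close> is an
    eigenvector of an honest matrix, whose spectrum is finite. Finiteness is what gives the
    \<open>Min\<close> in \<open>lambda_min\<close> its meaning.\<close>
  have "{l. is_eigenvalue d M l} \<subseteq> spectrum M'"
  proof
    fix l assume "l \<in> {l. is_eigenvalue d M l}"
    then obtain v where v: "\<exists>k<d. v k \<noteq> 0" "\<forall>i<d. (\<Sum>j<d. M i j * v j) = l * v i"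
      unfolding is_eigenvalue_def by blast
    have "eigenvector M' (vec d v) l"
      unfolding eigenvector_def
    proof (intro conjI)
      show "vec d v \<noteq> 0\<^sub>v (dim_row M')"
      proof
        assume "vec d v = 0\<^sub>v (dim_row M')"
        then have "vec d v $ k = 0" if "k < d" for k using that by (simp add: M'_def)
        then show False using v(1) by auto
      qed
      show "M' *\<^sub>v vec d v = l \<cdot>\<^sub>v vec d v"
        by (rule eq_vecI) (use v(2) in \<open>auto simp: M'_def scalar_prod_def atLeast0LessThan\<close>)
    qed (simp add: M'_def)
    then show "l \<in> spectrum M'" unfolding spectrum_def eigenvalue_def by blast
  qed
  then show ?thesis using card_finite_spectrum(1)[OF c] finite_subset by blast
qed

lemma quad_form_scale: "quad_form d S (\<lambda>i. c * v i) = c\<^sup>2 * quad_form d S v"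
  by (simp add: quad_form_def sum_distrib_left power2_eq_square mult_ac)

lemma sum_squares_pos:
  fixes v :: "nat \<Rightarrow> real"
  assumes "\<exists>k<d. v k \<noteq> 0"
  shows "0 < (\<Sum>k<d. (v k)\<^sup>2)"
proof -
  obtain k where "k < d" "v k \<noteq> 0" using assms by blast
  then show ?thesis by (intro sum_pos2[of _ k]) auto
qed

text \<open>Compactness of the sphere is replaced by the factorisation: v = A^T (B^T v) and |B^T
  v|^2 is the quadratic form, so the squared Frobenius norm of A bounds |v|^2. The extra 1 in
  \<open>K\<close> keeps it positive in every case.\<close>

lemma pos_def_coercive:
  assumes "pos_def d S"
  shows "\<exists>\<kappa>>0. \<forall>v. \<kappa> * (\<Sum>k<d. (v k)\<^sup>2) \<le> quad_form d S v"
proof -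
  obtain B where B: "is_cholesky d S B" using cholesky_exists[OF assms] by blast
  obtain A where A: "is_lower_inverse d B A" using cholesky_inverse_exists[OF B] by blast
  define K where "K = 1 + (\<Sum>i<d. \<Sum>k<d. (A k i)\<^sup>2)"
  have K: "0 < K" unfolding K_def by (intro add_pos_nonneg sum_nonneg) auto
  have "(\<Sum>k<d. (v k)\<^sup>2) \<le> K * quad_form d S v" for v
  proof -
    let ?u = "\<lambda>k. \<Sum>i<d. B i k * v i"
    have vi: "v j = (\<Sum>k<d. A k j * ?u k)" if "j < d" for j
    proof -
      have "(\<Sum>k<d. A k j * ?u k) = (\<Sum>i<d. (\<Sum>k<d. B i k * A k j) * v i)"
        unfolding sum_distrib_left sum_distrib_right by (subst sum.swap) (simp add: mult_ac)
      also have "\<dots> = v j" using A that by (simp add: is_lower_inverse_def sum_delta_lessThan)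
      finally show ?thesis by simp
    qed
    have "(v j)\<^sup>2 \<le> (\<Sum>k<d. (A k j)\<^sup>2) * quad_form d S v" if "j < d" for j
      unfolding vi[OF that] quad_form_cholesky[OF B] by (rule Cauchy_Schwarz_ineq_sum)
    then have "(\<Sum>j<d. (v j)\<^sup>2) \<le> (\<Sum>j<d. (\<Sum>k<d. (A k j)\<^sup>2) * quad_form d S v)" by (intro sum_mono) auto
    also have "\<dots> \<le> K * quad_form d S v"
      by (simp add: K_def sum_distrib_right[symmetric] distrib_right quad_form_cholesky[OF B] sum_nonneg)
    finally show ?thesis .
  qed
  then show ?thesis using K by (intro exI[of _ "1 / K"]) (auto simp: field_simps)
qed

text \<open>The infimum \<open>\<rho>\<close> of the Rayleigh quotient is an eigenvalue: \<open>S - \<rho>\<close> is positive semidefinite,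
  and if it were positive definite then it would be coercive, contradicting the choice of \<open>\<rho>\<close>.\<close>

lemma quad_form_ge_lambda_min:
  assumes sym: "\<forall>j<d. \<forall>k<d. S j k = S k j" and psd: "\<And>v. 0 \<le> quad_form d S v" and d: "0 < d"
  shows "lambda_min d S * (\<Sum>k<d. (x k)\<^sup>2) \<le> quad_form d S x" "is_eigenvalue d S (lambda_min d S)"
proof -
  define N :: "(nat \<Rightarrow> real) \<Rightarrow> real" where "N v = (\<Sum>k<d. (v k)\<^sup>2)" for v
  define R where "R = {quad_form d S v | v. N v = 1}"
  have bdd: "bdd_below R" unfolding R_def using psd by (intro bdd_belowI[of _ 0]) auto
  have "N (\<lambda>k. if k = 0 then 1 else 0) = 1"
    using d by (simp add: N_def if_distrib[of "\<lambda>x. x\<^sup>2"] cong: if_cong)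
  then have ne: "R \<noteq> {}" unfolding R_def by blast
  define \<rho> where "\<rho> = Inf R"
  have ray: "\<rho> * N v \<le> quad_form d S v" for v
  proof (cases "\<exists>k<d. v k \<noteq> 0")
    case True
    then have n: "0 < N v" unfolding N_def by (rule sum_squares_pos)
    let ?w = "\<lambda>i. (1 / sqrt (N v)) * v i"
    have "N ?w = (1 / sqrt (N v))\<^sup>2 * N v" unfolding N_def power_mult_distrib sum_distrib_left ..
    then have "N ?w = 1" using n by (simp add: power_divide)
    then have "quad_form d S ?w \<in> R" unfolding R_def by blast
    then have "\<rho> \<le> quad_form d S ?w" unfolding \<rho>_def by (rule cInf_lower[OF _ bdd])
    then show ?thesis using n unfolding quad_form_scale by (simp add: power_divide field_simps)
  next
    case False
    then show ?thesis by (auto simp: N_def quad_form_def)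
  qed
  define S' where "S' j k = S j k - (if j = k then \<rho> else 0)" for j k
  have S'q: "quad_form d S' v = quad_form d S v - \<rho> * N v" for v
  proof -
    have "quad_form d S' v = (\<Sum>j<d. (\<Sum>k<d. v j * S j k * v k) - v j * \<rho> * v j)"
      unfolding quad_form_def
    proof (intro sum.cong refl)
      fix j assume j: "j \<in> {..<d}"
      have "(\<Sum>k<d. v j * S' j k * v k) = (\<Sum>k<d. v j * S j k * v k - (if k = j then v j * \<rho> * v j else 0))"
        by (intro sum.cong refl) (auto simp: S'_def algebra_simps)
      then show "(\<Sum>k<d. v j * S' j k * v k) = (\<Sum>k<d. v j * S j k * v k) - v j * \<rho> * v j"
        using j by (simp add: sum_subtractf)
    qed
    then show ?thesis by (simp add: sum_subtractf quad_form_def N_def sum_distrib_left power2_eq_square mult_ac)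
  qed
  have S'0: "0 \<le> quad_form d S' v" for v using ray[of v] by (simp add: S'q)
  have npd: "\<not> pos_def d S'"
  proof
    assume "pos_def d S'"
    then obtain \<kappa> where \<kappa>: "0 < \<kappa>" "\<And>v. \<kappa> * N v \<le> quad_form d S' v"
      using pos_def_coercive unfolding N_def by blast
    have "\<rho> + \<kappa> \<le> Inf R"
    proof (rule cInf_greatest[OF ne])
      fix x assume "x \<in> R"
      then obtain v where v: "x = quad_form d S v" "N v = 1" unfolding R_def by blast
      show "\<rho> + \<kappa> \<le> x" using \<kappa>(2)[of v] v by (simp add: S'q)
    qed
    then show False using \<kappa>(1) by (simp add: \<rho>_def)
  qed
  have S'sym: "S' j k = S' k j" if "j < d" "k < d" for j k using sym that by (simp add: S'_def)
  obtain v where v: "\<exists>k<d. v k \<noteq> 0" "quad_form d S' v \<le> 0"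
    using npd S'sym unfolding pos_def_def quad_form_def[symmetric] by (auto simp: not_less)
  have v0: "quad_form d S' v = 0" using v(2) S'0[of v] by simp
  \<comment> \<open>\<open>v\<close> attains the minimum 0 of the semidefinite form
    \<open>S'\<close>, so the first variation in every coordinate direction vanishes. This is the
    eigenvector equation for \<rho>.\<close>
  have "(\<Sum>j<d. S' i j * v j) = 0" if i: "i < d" for i
  proof -
    let ?g = "\<Sum>j<d. S' i j * v j"
    have exp: "quad_form d S' (\<lambda>k. v k + t * (if k = i then 1 else 0)) = 2 * t * ?g + t\<^sup>2 * S' i i" for t
    proof -
      let ?e = "\<lambda>k. if k = i then 1 else 0 :: real"
      have "quad_form d S' (\<lambda>k. v k + t * ?e k) = quad_form d S' v + t * (\<Sum>j<d. \<Sum>k<d. v j * S' j k * ?e k)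
          + t * (\<Sum>j<d. \<Sum>k<d. ?e j * S' j k * v k) + t\<^sup>2 * (\<Sum>j<d. \<Sum>k<d. ?e j * S' j k * ?e k)"
        unfolding quad_form_def sum_distrib_left sum.distrib[symmetric]
        by (intro sum.cong refl) (simp add: power2_eq_square algebra_simps)
      also have "(\<Sum>j<d. \<Sum>k<d. v j * S' j k * ?e k) = (\<Sum>j<d. v j * S' j i)"
        by (intro sum.cong refl sum_delta_lessThan(3) i)
      also have "\<dots> = ?g" using i by (intro sum.cong refl) (simp add: S'sym[of i] mult.commute)
      also have "(\<Sum>j<d. \<Sum>k<d. ?e j * S' j k * v k) = (\<Sum>j<d. ?e j * (\<Sum>k<d. S' j k * v k))"
        by (simp add: sum_distrib_left mult.assoc)
      also have "\<dots> = ?g" by (rule sum_delta_lessThan(1)[OF i])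
      also have "(\<Sum>j<d. \<Sum>k<d. ?e j * S' j k * ?e k) = (\<Sum>j<d. ?e j * (\<Sum>k<d. S' j k * ?e k))"
        by (simp add: sum_distrib_left mult.assoc)
      also have "\<dots> = S' i i" using i by (simp only: sum_delta_lessThan)
      finally show ?thesis by (simp add: v0)
    qed
    have q: "0 \<le> 2 * t * ?g + t\<^sup>2 * S' i i" for t using S'0 unfolding exp[symmetric] .
    show "?g = 0"
    proof (rule ccontr)
      assume g: "?g \<noteq> 0"
      \<comment> \<open>If the gradient component g were nonzero, the step t = -g/a against it would
        make the form at most -g^2/a < 0.\<close>
      define a where "a = 1 + \<bar>S' i i\<bar>"
      have a: "0 < a" "S' i i \<le> a" by (auto simp: a_def)
      have "0 \<le> 2 * (- ?g / a) * ?g + (- ?g / a)\<^sup>2 * S' i i" by (rule q)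
      also have "\<dots> \<le> 2 * (- ?g / a) * ?g + (- ?g / a)\<^sup>2 * a" by (intro add_left_mono mult_left_mono a) auto
      also have "\<dots> = - (?g\<^sup>2 / a)" using a by (simp add: power2_eq_square field_simps)
      also have "\<dots> < 0" using a g by simp
      finally show False by simp
    qed
  qed
  note grad = this
  have "(\<Sum>j<d. S' i j * v j) = (\<Sum>j<d. S i j * v j) - \<rho> * v i" if "i < d" for i
  proof -
    have "(\<Sum>j<d. S' i j * v j) = (\<Sum>j<d. S i j * v j - (if i = j then 1 else 0) * (\<rho> * v j))"
      by (intro sum.cong refl) (auto simp: S'_def algebra_simps)
    then show ?thesis by (simp only: sum_subtractf sum_delta_lessThan(2)[OF that])
  qed
  with grad have "\<forall>i<d. (\<Sum>j<d. S i j * v j) = \<rho> * v i" by simp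
  then have ev: "is_eigenvalue d S \<rho>" using v(1) unfolding is_eigenvalue_def by blast
  then have "lambda_min d S \<le> \<rho>"
    unfolding lambda_min_def by (intro Min_le finite_eigenvalues) auto
  then have "lambda_min d S * N v \<le> \<rho> * N v" for v
    by (rule mult_right_mono) (simp add: N_def sum_nonneg)
  then show "lambda_min d S * (\<Sum>k<d. (x k)\<^sup>2) \<le> quad_form d S x"
    using ray unfolding N_def by (meson order_trans)
  show "is_eigenvalue d S (lambda_min d S)"
    using Min_in[OF finite_eigenvalues, of d S] ev unfolding lambda_min_def by auto
qed

lemma eigenvalue_pos:
  assumes "pos_def d S" "is_eigenvalue d S l"
  shows "0 < l"
proof -
  obtain v where v: "\<exists>k<d. v k \<noteq> 0" "\<forall>i<d. (\<Sum>j<d. S i j * v j) = l * v i"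
    using assms(2) unfolding is_eigenvalue_def by blast
  have "0 < quad_form d S v" using assms(1) v(1) unfolding pos_def_def quad_form_def by blast
  also have "\<dots> = (\<Sum>i<d. v i * (\<Sum>j<d. S i j * v j))" by (simp add: quad_form_def sum_distrib_left mult.assoc)
  also have "\<dots> = l * (\<Sum>k<d. (v k)\<^sup>2)" using v(2) by (simp add: sum_distrib_left power2_eq_square mult_ac)
  finally show ?thesis using sum_squares_pos[OF v(1)] by (simp add: zero_less_mult_iff)
qed

text \<open>With \<open>S = B B\<^sup>T\<close> and \<open>A = B\<^sup>-\<^sup>1\<close>, the vector \<open>x = A\<^sup>T A y\<close> satisfies \<open>x \<bullet> S x = x \<bullet> y = |A y|\<^sup>2\<close>.\<close>

lemma cholesky_inverse_norm_le:
  assumes B: "is_cholesky d S B" and A: "is_lower_inverse d B A"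
    and l: "0 < l" "\<And>v. l * (\<Sum>k<d. (v k)\<^sup>2) \<le> quad_form d S v"
  shows "(\<Sum>k<d. (mat_vec d A y k)\<^sup>2) \<le> (\<Sum>k<d. (y k)\<^sup>2) / l"
proof -
  let ?n = "\<Sum>k<d. (mat_vec d A y k)\<^sup>2"
  define x where "x i = (\<Sum>k<d. A k i * mat_vec d A y k)" for i
  have Bx: "(\<Sum>i<d. B i k * x i) = mat_vec d A y k" if "k < d" for k
  proof -
    have "(\<Sum>i<d. B i k * x i) = (\<Sum>i<d. \<Sum>l<d. A l i * B i k * mat_vec d A y l)"
      by (simp add: x_def sum_distrib_left mult_ac)
    also have "\<dots> = (\<Sum>l<d. (\<Sum>i<d. A l i * B i k) * mat_vec d A y l)"
      by (subst sum.swap) (simp add: sum_distrib_right)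
    also have "\<dots> = mat_vec d A y k" using A that by (simp add: is_lower_inverse_def sum_delta_lessThan)
    finally show ?thesis .
  qed
  have 1: "quad_form d S x = ?n" by (simp add: quad_form_cholesky[OF B] Bx)
  have "?n = (\<Sum>k<d. \<Sum>i<d. mat_vec d A y k * (A k i * y i))"
    by (simp add: power2_eq_square mat_vec_def sum_distrib_left)
  also have "\<dots> = (\<Sum>i<d. x i * y i)"
    unfolding x_def sum_distrib_right by (subst sum.swap) (simp add: mult_ac)
  finally have 2: "?n = (\<Sum>i<d. x i * y i)" .
  have n0: "0 \<le> ?n" by (simp add: sum_nonneg)
  \<comment> \<open>As |x|^2 is at most n/l by coercivity, Cauchy-Schwarz bounds n^2 by n |y|^2 / l,
    and one factor n cancels.\<close>
  have "?n\<^sup>2 \<le> (\<Sum>i<d. (x i)\<^sup>2) * (\<Sum>i<d. (y i)\<^sup>2)" unfolding 2 by (rule Cauchy_Schwarz_ineq_sum)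
  also have "\<dots> \<le> (?n / l) * (\<Sum>i<d. (y i)\<^sup>2)"
    using l(2)[of x] l(1) unfolding 1 by (intro mult_right_mono) (auto simp: field_simps sum_nonneg)
  finally have le: "?n * ?n \<le> ?n * ((\<Sum>i<d. (y i)\<^sup>2) / l)" by (simp add: power2_eq_square field_simps)
  show ?thesis
  proof (cases "?n = 0")
    case True
    then show ?thesis using l(1) by (simp add: sum_nonneg)
  next
    case False
    then have "0 < ?n" using n0 by linarith
    then show ?thesis using le by (simp only: mult_le_cancel_left_pos)
  qed
qed

section \<open>Gaussian kernels and interpolation\<close>

text \<open>Points of this space are extensional functions, equal to \<open>undefined\<close> off
  the first \<open>d\<close> indices; hence the restricted lambdas in every vector that has to lie
  in it.\<close>

abbreviation vecs :: "nat \<Rightarrow> (nat \<Rightarrow> real) measure" where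
  "vecs d \<equiv> PiM {..<d} (\<lambda>_. borel)"

abbreviation lebesgue_vecs :: "nat \<Rightarrow> (nat \<Rightarrow> real) measure" where
  "lebesgue_vecs d \<equiv> PiM {..<d} (\<lambda>_. lborel)"

definition std_gauss :: "nat \<Rightarrow> (nat \<Rightarrow> real) measure" where
  "std_gauss d = PiM {..<d} (\<lambda>_. density lborel std_normal_density)"

interpretation lborel_product: product_sigma_finite "\<lambda>_::nat. lborel :: real measure"
  by standard

interpretation std_normal: prob_space "density lborel std_normal_density"
  by (rule prob_space_normal_density) simp

interpretation std_gauss_product: product_sigma_finite "\<lambda>_::nat. density lborel std_normal_density"
  by standard

lemma sets_lebesgue_vecs [simp, measurable_cong]: "sets (lebesgue_vecs d) = sets (vecs d)"
  by (intro sets_PiM_cong) auto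

lemma sets_std_gauss [simp, measurable_cong]: "sets (std_gauss d) = sets (vecs d)"
  unfolding std_gauss_def by (intro sets_PiM_cong) auto

lemma space_std_gauss [simp]: "space (std_gauss d) = space (vecs d)"
  by (rule sets_eq_imp_space_eq) simp

lemma space_lebesgue_vecs [simp]: "space (lebesgue_vecs d) = space (vecs d)"
  by (rule sets_eq_imp_space_eq) simp

lemma prob_space_std_gauss: "prob_space (std_gauss d)"
  unfolding std_gauss_def by (intro prob_space_PiM std_normal.prob_space_axioms)

lemma sigma_finite_lebesgue_vecs: "sigma_finite_measure (lebesgue_vecs d)"
  by (rule lborel_product.sigma_finite) simp

lemma std_gauss_eq_density:
  "std_gauss d = density (lebesgue_vecs d) (\<lambda>z. ennreal (\<Prod>i<d. std_normal_density (z i)))"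
  unfolding std_gauss_def
proof (rule std_gauss_product.PiM_eqI[symmetric])
  fix A assume A: "\<And>i. i \<in> {..<d} \<Longrightarrow> A i \<in> sets (density lborel (\<lambda>x. ennreal (std_normal_density x)))"
  then have [measurable]: "A i \<in> sets borel" if "i < d" for i using that by auto
  have "Pi\<^sub>E {..<d} A \<in> sets (lebesgue_vecs d)" using A by (intro sets_PiM_I_finite) auto
  then have "emeasure (density (lebesgue_vecs d) (\<lambda>z. ennreal (\<Prod>i<d. std_normal_density (z i)))) (Pi\<^sub>E {..<d} A) =
      (\<integral>\<^sup>+z. ennreal (\<Prod>i<d. std_normal_density (z i)) * indicator (Pi\<^sub>E {..<d} A) z \<partial>lebesgue_vecs d)"
    by (subst emeasure_density) measurable
  also have "\<dots> = (\<integral>\<^sup>+z. (\<Prod>i<d. ennreal (std_normal_density (z i)) * indicator (A i) (z i)) \<partial>lebesgue_vecs d)"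
  proof (intro nn_integral_cong)
    fix z assume "z \<in> space (lebesgue_vecs d)"
    then have "indicator (Pi\<^sub>E {..<d} A) z = (\<Prod>i<d. indicator (A i) (z i) :: ennreal)"
      by (auto simp: indicator_def space_PiM PiE_iff intro!: prod.neutral[symmetric])
    then show "ennreal (\<Prod>i<d. std_normal_density (z i)) * indicator (Pi\<^sub>E {..<d} A) z =
        (\<Prod>i<d. ennreal (std_normal_density (z i)) * indicator (A i) (z i))"
      by (simp add: prod.distrib prod_ennreal[symmetric])
  qed
  also have "\<dots> = (\<Prod>i<d. \<integral>\<^sup>+x. ennreal (std_normal_density x) * indicator (A i) x \<partial>lborel)"
    by (rule lborel_product.product_nn_integral_prod) auto
  also have "\<dots> = (\<Prod>i<d. emeasure (density lborel (\<lambda>x. ennreal (std_normal_density x))) (A i))"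
    by (intro prod.cong refl) (simp add: emeasure_density)
  finally show "emeasure (density (lebesgue_vecs d) (\<lambda>z. ennreal (\<Prod>i<d. std_normal_density (z i)))) (Pi\<^sub>E {..<d} A) =
      (\<Prod>i<d. emeasure (density lborel (\<lambda>x. ennreal (std_normal_density x))) (A i))" .
qed (auto intro!: sets_PiM_cong)

text \<open>Induction on the dimension: once the first \<open>d\<close> coordinates are fixed,
  triangularity makes the last one an affine function of its own variable with slope
  \<open>B d d\<close>, and the earlier ones do not see that variable.\<close>

lemma nn_integral_lower_triangular:
  assumes "f \<in> borel_measurable (vecs d)" "\<And>i j. i < j \<Longrightarrow> B i j = 0" "\<And>i. i < d \<Longrightarrow> 0 < B i i"
  shows "(\<integral>\<^sup>+z. f z \<partial>lebesgue_vecs d) =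
    ennreal (\<Prod>i<d. B i i) * (\<integral>\<^sup>+x. f (\<lambda>i\<in>{..<d}. p i + (\<Sum>j<d. B i j * x j)) \<partial>lebesgue_vecs d)"
  using assms(1,3)
proof (induction d arbitrary: f)
  case 0
  show ?case by (simp add: PiM_empty nn_integral_count_space_finite restrict_def)
next
  case (Suc d)
  define T where "T d x = (\<lambda>i\<in>{..<d}. p i + (\<Sum>j<d. B i j * x j))" for d and x :: "nat \<Rightarrow> real"
  note [measurable] = Suc.prems(1)
  have f'[measurable]: "f \<in> borel_measurable (PiM (insert d {..<d}) (\<lambda>_. lborel))"
    using Suc.prems(1) measurable_cong_sets[OF sets_lebesgue_vecs refl] by (simp add: lessThan_Suc[symmetric])
  have T[measurable]: "T n \<in> measurable (vecs n) (vecs n)" for n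
    unfolding T_def by measurable
  have upd[measurable]: "(\<lambda>(x, y). x(d := y)) \<in> measurable (vecs d \<Otimes>\<^sub>M borel) (vecs (Suc d))"
    using measurable_add_dim[of d "{..<d}" "\<lambda>_. borel"] by (simp add: lessThan_Suc)
  have B0: "B i d = 0" if "i < d" for i using assms(2) that .
  have Tupd: "T (Suc d) (x(d := y)) = (T d x)(d := (p d + (\<Sum>j<d. B d j * x j)) + B d d * y)" for x y
    by (auto simp: T_def fun_eq_iff restrict_def less_Suc_eq B0 intro!: sum.cong)
  have meas: "(\<lambda>x. \<integral>\<^sup>+y. f (x(d := y)) \<partial>lborel) \<in> borel_measurable (vecs d)"
    by measurable
  have "(\<integral>\<^sup>+z. f z \<partial>lebesgue_vecs (Suc d)) = (\<integral>\<^sup>+x. (\<integral>\<^sup>+y. f (x(d := y)) \<partial>lborel) \<partial>lebesgue_vecs d)"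
    unfolding lessThan_Suc by (rule lborel_product.product_nn_integral_insert[OF _ _ f']) auto
  also have "\<dots> = ennreal (\<Prod>i<d. B i i) * (\<integral>\<^sup>+x. (\<integral>\<^sup>+y. f ((T d x)(d := y)) \<partial>lborel) \<partial>lebesgue_vecs d)"
    unfolding T_def using Suc.prems(2) by (intro Suc.IH meas) auto
  also have "(\<integral>\<^sup>+x. (\<integral>\<^sup>+y. f ((T d x)(d := y)) \<partial>lborel) \<partial>lebesgue_vecs d) =
      (\<integral>\<^sup>+x. ennreal (B d d) * (\<integral>\<^sup>+y. f (T (Suc d) (x(d := y))) \<partial>lborel) \<partial>lebesgue_vecs d)"
  proof (intro nn_integral_cong)
    fix x assume "x \<in> space (lebesgue_vecs d)"
    then have [measurable]: "T d x \<in> space (vecs d)" using measurable_space[OF T] by simp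
    have "(\<lambda>y. f ((T d x)(d := y))) \<in> borel_measurable borel"
      by measurable
    then show "(\<integral>\<^sup>+y. f ((T d x)(d := y)) \<partial>lborel) = ennreal (B d d) * (\<integral>\<^sup>+y. f (T (Suc d) (x(d := y))) \<partial>lborel)"
      unfolding Tupd using Suc.prems(2)[of d] by (subst nn_integral_real_affine[of _ "B d d"]) auto
  qed
  also have "\<dots> = ennreal (B d d) * (\<integral>\<^sup>+x. (\<integral>\<^sup>+y. f (T (Suc d) (x(d := y))) \<partial>lborel) \<partial>lebesgue_vecs d)"
    by (rule nn_integral_cmult) measurable
  also have "(\<integral>\<^sup>+x. (\<integral>\<^sup>+y. f (T (Suc d) (x(d := y))) \<partial>lborel) \<partial>lebesgue_vecs d) =
      (\<integral>\<^sup>+x. f (T (Suc d) x) \<partial>lebesgue_vecs (Suc d))"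
  proof -
    have "(\<lambda>x. f (T (Suc d) x)) \<in> borel_measurable (PiM (insert d {..<d}) (\<lambda>_. lborel))"
      using measurable_compose[OF T Suc.prems(1)] measurable_cong_sets[OF sets_lebesgue_vecs[of "Suc d"] refl]
      by (simp add: lessThan_Suc[symmetric])
    then show ?thesis unfolding lessThan_Suc
      by (subst lborel_product.product_nn_integral_insert) (auto simp: lessThan_Suc[symmetric])
  qed
  also have "ennreal (\<Prod>i<d. B i i) * (ennreal (B d d) * (\<integral>\<^sup>+x. f (T (Suc d) x) \<partial>lebesgue_vecs (Suc d))) =
      ennreal (\<Prod>i<Suc d. B i i) * (\<integral>\<^sup>+x. f (T (Suc d) x) \<partial>lebesgue_vecs (Suc d))"
  proof -
    have "0 \<le> B i i" if "i < Suc d" for i using Suc.prems(2)[OF that] by simp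
    then have "ennreal (\<Prod>i<Suc d. B i i) = ennreal (\<Prod>i<d. B i i) * ennreal (B d d)"
      unfolding prod.lessThan_Suc by (intro ennreal_mult prod_nonneg) auto
    then show ?thesis by (simp only: mult.assoc)
  qed
  finally show ?case unfolding T_def .
qed

text \<open>For b > 0 the density of the normal law with mean \<open>p\<close> and covariance b^2
  times the identity. The factor b^(-d) is kept in the exponent, so that differentiating in
  \<open>b\<close> acts on a single exponential.\<close>

definition gauss_kernel :: "nat \<Rightarrow> (nat \<Rightarrow> real) \<Rightarrow> real \<Rightarrow> (nat \<Rightarrow> real) \<Rightarrow> real" where
  "gauss_kernel d p b z = (1 / sqrt (2 * pi)) ^ d * exp (- (real d * ln b) - (\<Sum>i<d. ((z i - p i) / b)\<^sup>2) / 2)"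

lemma prod_std_normal_density:
  "(\<Prod>i<d. std_normal_density (z i)) = (1 / sqrt (2 * pi)) ^ d * exp (- (\<Sum>i<d. (z i)\<^sup>2) / 2)"
  by (simp add: std_normal_density_def prod_dividef exp_sum[symmetric] sum_negf sum_divide_distrib power_one_over)

lemma gauss_kernel_pos: "0 < gauss_kernel d p b z"
  by (simp add: gauss_kernel_def)

lemma measurable_gauss_kernel [measurable]: "gauss_kernel d p b \<in> borel_measurable (vecs d)"
  unfolding gauss_kernel_def by measurable

text \<open>Change of variables with the product of the diagonal as Jacobian; \<open>eq\<close> is
  the pointwise identity between the densities. It serves both the scalar matrix b I and the
  Cholesky factor of the covariance.\<close>

lemma distr_std_gauss_lower_triangular:
  assumes B: "\<And>i j. i < j \<Longrightarrow> B i j = 0" "\<And>i. i < d \<Longrightarrow> 0 < B i i"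
    and k[measurable]: "k \<in> borel_measurable (vecs d)"
    and eq: "\<And>x. (\<Prod>i<d. B i i) * k (\<lambda>i\<in>{..<d}. p i + (\<Sum>j<d. B i j * x j)) = (\<Prod>i<d. std_normal_density (x i))"
  shows "distr (std_gauss d) (vecs d) (\<lambda>x. \<lambda>i\<in>{..<d}. p i + (\<Sum>j<d. B i j * x j)) = density (lebesgue_vecs d) (\<lambda>z. ennreal (k z))"
    (is "distr _ _ ?T = _")
proof (rule measure_eqI)
  have T[measurable]: "?T \<in> measurable (vecs d) (vecs d)" by measurable
  have D: "0 < (\<Prod>i<d. B i i)" by (intro prod_pos) (use B in auto)
  fix A assume "A \<in> sets (distr (std_gauss d) (vecs d) ?T)"
  then have A[measurable]: "A \<in> sets (vecs d)" by simp
  have "emeasure (density (lebesgue_vecs d) (\<lambda>z. ennreal (k z))) A = (\<integral>\<^sup>+z. ennreal (k z) * indicator A z \<partial>lebesgue_vecs d)"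
    by (subst emeasure_density) auto
  also have "\<dots> = ennreal (\<Prod>i<d. B i i) * (\<integral>\<^sup>+x. ennreal (k (?T x)) * indicator A (?T x) \<partial>lebesgue_vecs d)"
    by (rule nn_integral_lower_triangular) (use B in auto)
  also have "\<dots> = (\<integral>\<^sup>+x. ennreal (\<Prod>i<d. B i i) * (ennreal (k (?T x)) * indicator A (?T x)) \<partial>lebesgue_vecs d)"
    by (rule nn_integral_cmult[symmetric]) measurable
  also have "\<dots> = (\<integral>\<^sup>+x. ennreal (\<Prod>i<d. std_normal_density (x i)) * indicator A (?T x) \<partial>lebesgue_vecs d)"
    using D by (simp add: eq[symmetric] ennreal_mult' mult.assoc)
  also have "\<dots> = (\<integral>\<^sup>+x. indicator A (?T x) \<partial>std_gauss d)"
    unfolding std_gauss_eq_density by (subst nn_integral_density) auto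
  also have "\<dots> = emeasure (distr (std_gauss d) (vecs d) ?T) A"
    by (simp add: nn_integral_indicator[symmetric] nn_integral_distr del: nn_integral_indicator)
  finally show "emeasure (distr (std_gauss d) (vecs d) ?T) A = emeasure (density (lebesgue_vecs d) (\<lambda>z. ennreal (k z))) A" ..
qed simp

lemma distr_std_gauss_affine:
  assumes b: "0 < b"
  shows "distr (std_gauss d) (vecs d) (\<lambda>g. \<lambda>i\<in>{..<d}. p i + b * g i) = density (lebesgue_vecs d) (\<lambda>z. ennreal (gauss_kernel d p b z))"
proof -
  let ?B = "\<lambda>i j :: nat. if i = j then b else 0"
  have s: "(\<Sum>j<d. ?B i j * x j) = b * x i" if "i < d" for i x
    using that by (subst sum.remove[of _ i]) (auto intro!: sum.neutral)
  have "(\<lambda>i\<in>{..<d}. p i + (\<Sum>j<d. ?B i j * x j)) = (\<lambda>i\<in>{..<d}. p i + b * x i)" for x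
    by (intro restrict_ext) (use s in auto)
  note T = this
  have "b ^ d * gauss_kernel d p b (\<lambda>i\<in>{..<d}. p i + b * x i) = (\<Prod>i<d. std_normal_density (x i))" for x
  proof -
    have "exp (- (real d * ln b)) = 1 / b ^ d"
      using b by (simp add: exp_minus exp_of_nat_mult inverse_eq_divide)
    then show ?thesis using b by (simp add: gauss_kernel_def prod_std_normal_density exp_diff exp_minus inverse_eq_divide)
  qed
  then show ?thesis
    using distr_std_gauss_lower_triangular[of ?B d "gauss_kernel d p b" p] b by (simp add: T)
qed

text \<open>\<open>F\<close> sees both the point z and its standardisation (z - p) / b. In this way
  polynomial weights produced by differentiating the kernel become polynomial weights in a standard
  Gaussian variable.\<close>

lemma
  fixes F :: "(nat \<Rightarrow> real) \<Rightarrow> (nat \<Rightarrow> real) \<Rightarrow> real"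
  assumes b: "0 < b" and F[measurable]: "(\<lambda>z. F z (\<lambda>i\<in>{..<d}. (z i - p i) / b)) \<in> borel_measurable (vecs d)"
  shows integral_gauss_kernel: "(\<integral>z. F z (\<lambda>i\<in>{..<d}. (z i - p i) / b) * gauss_kernel d p b z \<partial>lebesgue_vecs d) =
      (\<integral>g. F (\<lambda>i\<in>{..<d}. p i + b * g i) g \<partial>std_gauss d)" (is ?eq)
    and integrable_gauss_kernel: "integrable (lebesgue_vecs d) (\<lambda>z. F z (\<lambda>i\<in>{..<d}. (z i - p i) / b) * gauss_kernel d p b z) \<longleftrightarrow>
      integrable (std_gauss d) (\<lambda>g. F (\<lambda>i\<in>{..<d}. p i + b * g i) g)" (is ?int)
proof -
  let ?T = "\<lambda>g. \<lambda>i\<in>{..<d}. p i + b * g i"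
  let ?H = "\<lambda>z. F z (\<lambda>i\<in>{..<d}. (z i - p i) / b)"
  have T[measurable]: "?T \<in> measurable (vecs d) (vecs d)" by measurable
  have H: "?H (?T g) = F (?T g) g" if "g \<in> space (vecs d)" for g
  proof -
    have "(\<lambda>i\<in>{..<d}. (?T g i - p i) / b) = g"
      using that b by (auto simp: space_PiM PiE_iff extensional_def restrict_def fun_eq_iff)
    then show ?thesis by simp
  qed
  have k0: "AE z in lebesgue_vecs d. 0 \<le> gauss_kernel d p b z" using gauss_kernel_pos less_imp_le by (intro AE_I2) blast
  have "(\<integral>z. ?H z * gauss_kernel d p b z \<partial>lebesgue_vecs d) = (\<integral>z. ?H z \<partial>density (lebesgue_vecs d) (\<lambda>z. ennreal (gauss_kernel d p b z)))"
    using k0 by (subst integral_density) (auto simp: mult.commute)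
  also have "\<dots> = (\<integral>g. ?H (?T g) \<partial>std_gauss d)"
    unfolding distr_std_gauss_affine[OF b, symmetric] by (rule integral_distr) auto
  also have "\<dots> = (\<integral>g. F (?T g) g \<partial>std_gauss d)"
    by (rule Bochner_Integration.integral_cong[OF refl]) (use H in simp)
  finally show ?eq .
  have "integrable (lebesgue_vecs d) (\<lambda>z. ?H z * gauss_kernel d p b z) \<longleftrightarrow> integrable (density (lebesgue_vecs d) (\<lambda>z. ennreal (gauss_kernel d p b z))) ?H"
    using k0 by (subst integrable_density) (auto simp: mult.commute)
  also have "\<dots> \<longleftrightarrow> integrable (std_gauss d) (\<lambda>g. ?H (?T g))"
    unfolding distr_std_gauss_affine[OF b, symmetric] by (rule integrable_distr_eq) auto
  also have "\<dots> \<longleftrightarrow> integrable (std_gauss d) (\<lambda>g. F (?T g) g)"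
    by (rule Bochner_Integration.integrable_cong[OF refl]) (use H in simp)
  finally show ?int .
qed

lemma
  assumes "i < d" "j < d"
  shows std_gauss_integrable_coord: "integrable (std_gauss d) (\<lambda>g. g i)"
    and std_gauss_integrable_mult: "integrable (std_gauss d) (\<lambda>g. g i * g j)"
    and std_gauss_cov: "(\<integral>g. g i * g j \<partial>std_gauss d) = (if i = j then 1 else 0)"
proof -
  let ?N = "density lborel (\<lambda>x. ennreal (std_normal_density x))"
  have m: "integrable ?N (\<lambda>x. x ^ k)" for k
    using integrable_std_normal_moment[of k] by (subst integrable_density) auto
  have m1: "(\<integral>x. x \<partial>?N) = 0"
    using integral_std_normal_moment_odd[of 0] by (subst integral_density) auto
  have m2: "(\<integral>x. x\<^sup>2 \<partial>?N) = 1"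
    using integral_std_normal_moment_even[of 1] by (subst integral_density) auto
  have c: "(\<lambda>g. g k) \<in> measurable (std_gauss d) ?N" if "k < d" for k
    unfolding std_gauss_def by (rule measurable_component_singleton) (use that in simp)
  have D: "distr (std_gauss d) ?N (\<lambda>g. g k) = ?N" if "k < d" for k
    unfolding std_gauss_def by (rule distr_PiM_component) (use that std_normal.prob_space_axioms in auto)
  have marg: "integrable (std_gauss d) (\<lambda>g. (g k) ^ n)" "(\<integral>g. (g k) ^ n \<partial>std_gauss d) = (\<integral>x. x ^ n \<partial>?N)" if k: "k < d" for k n
  proof -
    have "integrable (distr (std_gauss d) ?N (\<lambda>g. g k)) (\<lambda>x. x ^ n)" unfolding D[OF k] by (rule m)
    then show "integrable (std_gauss d) (\<lambda>g. (g k) ^ n)"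
      by (rule integrable_distr[OF c[OF k]])
    have "(\<integral>g. (g k) ^ n \<partial>std_gauss d) = (\<integral>x. x ^ n \<partial>distr (std_gauss d) ?N (\<lambda>g. g k))"
      by (rule integral_distr[OF c[OF k], symmetric]) simp
    then show "(\<integral>g. (g k) ^ n \<partial>std_gauss d) = (\<integral>x. x ^ n \<partial>?N)" unfolding D[OF k] .
  qed
  show i: "integrable (std_gauss d) (\<lambda>g. g i)"
    using marg(1)[OF assms(1), of 1] by simp
  have sq: "integrable (std_gauss d) (\<lambda>g. (g k)\<^sup>2)" "(\<integral>g. (g k)\<^sup>2 \<partial>std_gauss d) = 1" if "k < d" for k
    using marg[OF that, of 2] m2 by auto
  show ij: "integrable (std_gauss d) (\<lambda>g. g i * g j)"
  proof (rule Bochner_Integration.integrable_bound[where f="\<lambda>g. (g i)\<^sup>2 + (g j)\<^sup>2"])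
    show "AE g in std_gauss d. norm (g i * g j) \<le> norm ((g i)\<^sup>2 + (g j)\<^sup>2)"
    proof (rule AE_I2)
      fix g :: "nat \<Rightarrow> real"
      have "2 * (\<bar>g i\<bar> * \<bar>g j\<bar>) \<le> \<bar>g i\<bar>\<^sup>2 + \<bar>g j\<bar>\<^sup>2"
        using sum_squares_bound[of "\<bar>g i\<bar>" "\<bar>g j\<bar>"] by (simp add: mult.assoc)
      moreover have "0 \<le> \<bar>g i\<bar> * \<bar>g j\<bar>" by simp
      ultimately have "\<bar>g i\<bar> * \<bar>g j\<bar> \<le> \<bar>g i\<bar>\<^sup>2 + \<bar>g j\<bar>\<^sup>2" by linarith
      then show "norm (g i * g j) \<le> norm ((g i)\<^sup>2 + (g j)\<^sup>2)" by (simp add: abs_mult)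
    qed
  qed (use sq assms in \<open>auto intro: borel_measurable_times borel_measurable_integrable\<close>)
  show "(\<integral>g. g i * g j \<partial>std_gauss d) = (if i = j then 1 else 0)"
  proof (cases "i = j")
    case True
    then show ?thesis using sq(2)[OF assms(1)] by (simp add: power2_eq_square)
  next
    case False
    let ?f = "\<lambda>k x. if k = i \<or> k = j then x else 1 :: real"
    have p: "(\<Prod>k<d. h k) = h i * h j" if "\<And>k. k \<noteq> i \<Longrightarrow> k \<noteq> j \<Longrightarrow> h k = 1" for h :: "nat \<Rightarrow> real"
    proof -
      have "(\<Prod>k<d. h k) = (\<Prod>k\<in>{i, j}. h k)"
        by (rule prod.mono_neutral_right) (use assms that in auto)
      then show ?thesis using False by simp
    qed
    have "(\<integral>g. g i * g j \<partial>std_gauss d) = (\<integral>g. (\<Prod>k<d. ?f k (g k)) \<partial>std_gauss d)"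
      by (subst p) auto
    also have "\<dots> = (\<Prod>k<d. \<integral>x. ?f k x \<partial>?N)"
      unfolding std_gauss_def 
    proof (rule std_gauss_product.product_integral_prod)
      show "integrable ?N (?f k)" for k
        using m[of 1] std_normal.integrable_const by (cases "k = i \<or> k = j") auto
    qed simp
    also have "\<dots> = (\<integral>x. x \<partial>?N) * (\<integral>x. x \<partial>?N)"
      using std_normal.prob_space by (subst p) auto
    finally show ?thesis using False m1 by simp
  qed
qed

text \<open>\<open>f\<close> is merely bounded and measurable, so the parameter is differentiated in
  the kernel. The uniform bound \<open>C\<close> on the L1 norm of \<open>K'\<close> allows the
  integrals over t and z to be exchanged.\<close>

lemma kernel_FTC:
  fixes K K' :: "real \<Rightarrow> 'a \<Rightarrow> real" and f :: "'a \<Rightarrow> real"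
  assumes "sigma_finite_measure M" and ab: "a \<le> b"
    and der: "\<And>t z. t \<in> {a..b} \<Longrightarrow> z \<in> space M \<Longrightarrow> ((\<lambda>t. K t z) has_real_derivative K' t z) (at t)"
    and cont: "\<And>t z. t \<in> {a..b} \<Longrightarrow> z \<in> space M \<Longrightarrow> isCont (\<lambda>t. K' t z) t"
    and K'[measurable]: "(\<lambda>(t, z). K' t z) \<in> borel_measurable (borel \<Otimes>\<^sub>M M)"
    and f[measurable]: "f \<in> borel_measurable M" and f1: "\<And>z. \<bar>f z\<bar> \<le> 1"
    and K: "integrable M (K a)" "integrable M (K b)"
    and I: "\<And>t. t \<in> {a..b} \<Longrightarrow> integrable M (K' t)"
    and C: "\<And>t. t \<in> {a..b} \<Longrightarrow> (\<integral>z. \<bar>K' t z\<bar> \<partial>M) \<le> C"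
  shows "(\<integral>z. f z * K b z \<partial>M) - (\<integral>z. f z * K a z \<partial>M) =
      (\<integral>t. (\<integral>z. f z * K' t z \<partial>M) * indicator {a..b} t \<partial>lborel)"
proof -
  interpret M: sigma_finite_measure M by fact
  interpret P: pair_sigma_finite lborel M ..
  let ?g = "\<lambda>t z. f z * K' t z * indicator {a..b} t"
  have int_mult: "integrable M (\<lambda>z. f z * h z)" if h: "integrable M h" for h
  proof (rule Bochner_Integration.integrable_bound[OF h])
    show "AE z in M. norm (f z * h z) \<le> norm (h z)"
      by (rule AE_I2) (use f1 in \<open>auto simp: abs_mult intro!: mult_left_le_one_le\<close>)
  qed (use h in measurable)
  have [measurable]: "(\<lambda>(t, z). K' t z) \<in> borel_measurable (lborel \<Otimes>\<^sub>M M)"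
    using K' by (simp cong: measurable_cong_sets)
  have gm: "(\<lambda>(t, z). ?g t z) \<in> borel_measurable (lborel \<Otimes>\<^sub>M M)" by measurable
  have gi: "integrable (lborel \<Otimes>\<^sub>M M) (\<lambda>(t, z). ?g t z)"
  proof (rule P.Fubini_integrable[OF gm])
    show "AE t in lborel. integrable M (\<lambda>z. case (t, z) of (t, z) \<Rightarrow> ?g t z)"
      by (rule AE_I2) (auto simp: indicator_def intro!: int_mult I)
    show "integrable lborel (\<lambda>t. \<integral>z. norm (case (t, z) of (t, z) \<Rightarrow> ?g t z) \<partial>M)"
    proof (rule Bochner_Integration.integrable_bound[where f="\<lambda>t. C * indicator {a..b} t"])
      show "AE t in lborel. norm (\<integral>z. norm (case (t, z) of (t, z) \<Rightarrow> ?g t z) \<partial>M) \<le> norm (C * indicator {a..b} t)"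
      proof (rule AE_I2)
        fix t
        show "norm (\<integral>z. norm (case (t, z) of (t, z) \<Rightarrow> ?g t z) \<partial>M) \<le> norm (C * indicator {a..b} t)"
        proof (cases "t \<in> {a..b}")
          case True
          have "(\<integral>z. \<bar>f z * K' t z\<bar> \<partial>M) \<le> (\<integral>z. \<bar>K' t z\<bar> \<partial>M)"
            by (intro integral_mono integrable_abs int_mult I True) (use f1 in \<open>auto simp: abs_mult intro!: mult_left_le_one_le\<close>)
          also note C[OF True]
          finally show ?thesis using True by (simp add: abs_mult)
        qed simp
      qed
    qed (use ab in \<open>auto intro!: integrable_mult_right integrable_real_indicator\<close>)
  qed
  have "(\<integral>z. f z * K b z \<partial>M) - (\<integral>z. f z * K a z \<partial>M) = (\<integral>z. f z * K b z - f z * K a z \<partial>M)"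
    using K by (intro Bochner_Integration.integral_diff[symmetric] int_mult)
  also have "\<dots> = (\<integral>z. (\<integral>t. ?g t z \<partial>lborel) \<partial>M)"
  proof (rule Bochner_Integration.integral_cong[OF refl])
    fix z assume z: "z \<in> space M"
    have "(\<integral>t. K' t z * indicator {a..b} t \<partial>lborel) = K b z - K a z"
      by (rule integral_FTC_Icc_real[OF ab]) (use der cont z in auto)
    then show "f z * K b z - f z * K a z = (\<integral>t. ?g t z \<partial>lborel)"
      by (simp add: mult.assoc right_diff_distrib)
  qed
  also have "\<dots> = (\<integral>t. (\<integral>z. ?g t z \<partial>M) \<partial>lborel)"
    by (rule P.Fubini_integral[OF gi])
  finally show ?thesis by simp
qed

section \<open>Gaussian smoothings and their Hermite weights\<close>

definition affine_vec :: "nat \<Rightarrow> real \<Rightarrow> (nat \<Rightarrow> real) \<Rightarrow> real \<Rightarrow> (nat \<Rightarrow> real) \<Rightarrow> nat \<Rightarrow> real" where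
  "affine_vec d a x b g = (\<lambda>i\<in>{..<d}. a * x i + b * g i)"

definition smooth0 :: "nat \<Rightarrow> ((nat \<Rightarrow> real) \<Rightarrow> real) \<Rightarrow> real \<Rightarrow> real \<Rightarrow> (nat \<Rightarrow> real) \<Rightarrow> real" where
  "smooth0 d f a b x = (\<integral>g. f (affine_vec d a x b g) \<partial>std_gauss d)"

text \<open>For b > 0, \<open>a / b\<close> times this vector is the gradient of
  \<open>smooth0\<close> in \<open>x\<close>, by Gaussian integration by parts: the weight g_k
  stands in for a derivative that \<open>f\<close> itself does not have.\<close>

definition smooth1 :: "nat \<Rightarrow> ((nat \<Rightarrow> real) \<Rightarrow> real) \<Rightarrow> real \<Rightarrow> real \<Rightarrow> (nat \<Rightarrow> real) \<Rightarrow> nat \<Rightarrow> real" where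
  "smooth1 d f a b x k = (\<integral>g. f (affine_vec d a x b g) * g k \<partial>std_gauss d)"

text \<open>The second Hermite weight. For b > 0, \<open>a / b\<close> times this matrix is the
  derivative of \<open>smooth1\<close> in \<open>x\<close>.\<close>

definition smooth2 :: "nat \<Rightarrow> ((nat \<Rightarrow> real) \<Rightarrow> real) \<Rightarrow> real \<Rightarrow> real \<Rightarrow> (nat \<Rightarrow> real) \<Rightarrow> nat \<Rightarrow> nat \<Rightarrow> real" where
  "smooth2 d f a b x k l = (\<integral>g. f (affine_vec d a x b g) * (g k * g l - (if k = l then 1 else 0)) \<partial>std_gauss d)"

definition smooth_hess :: "nat \<Rightarrow> ((nat \<Rightarrow> real) \<Rightarrow> real) \<Rightarrow> real \<Rightarrow> real \<Rightarrow> (nat \<Rightarrow> real) \<Rightarrow> (nat \<Rightarrow> real) \<Rightarrow> real" where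
  "smooth_hess d f a b x y = (\<Sum>k<d. \<Sum>l<d. y k * y l * smooth2 d f a b x k l)"

lemma measurable_affine_vec [measurable (raw)]:
  assumes [measurable]: "A \<in> borel_measurable N" "B \<in> borel_measurable N" "X \<in> measurable N (vecs d)" "G \<in> measurable N (vecs d)"
  shows "(\<lambda>w. affine_vec d (A w) (X w) (B w) (G w)) \<in> measurable N (vecs d)"
  unfolding affine_vec_def by measurable

lemma measurable_affine_vec_raw:
  "(\<lambda>g. affine_vec d a x b g) \<in> measurable (vecs d) (vecs d)"
  unfolding affine_vec_def by measurable

lemma measure_std_gauss_space [simp]: "measure (std_gauss d) (space (vecs d)) = 1"
  using prob_space.prob_space[OF prob_space_std_gauss[of d]] by simp

lemma DERIV_exp_diff_half:
  assumes "(A has_real_derivative A') (at t)" "(s has_real_derivative s') (at t)"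
  shows "((\<lambda>t. c * exp (A t - s t / 2)) has_real_derivative c * exp (A t - s t / 2) * (A' - s' / 2)) (at t)"
  using assms by (auto intro!: derivative_eq_intros)

locale bounded_test =
  fixes d :: nat and f :: "(nat \<Rightarrow> real) \<Rightarrow> real"
  assumes f_meas [measurable]: "f \<in> borel_measurable (vecs d)" and f_bound: "\<And>z. \<bar>f z\<bar> \<le> 1"
begin

lemma meas_affine [measurable]: "(\<lambda>g. f (affine_vec d a x b g)) \<in> borel_measurable (vecs d)"
  by (rule measurable_compose[OF measurable_affine_vec_raw f_meas])

lemma integrable_test_mult:
  assumes h: "integrable (std_gauss d) h"
  shows "integrable (std_gauss d) (\<lambda>g. f (affine_vec d a x b g) * h g)"
proof (rule Bochner_Integration.integrable_bound[OF h])
  show "AE g in std_gauss d. norm (f (affine_vec d a x b g) * h g) \<le> norm (h g)"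
    by (rule AE_I2) (use f_bound in \<open>auto simp: abs_mult intro!: mult_left_le_one_le\<close>)
qed (use h in measurable)

lemma abs_integral_test_mult_le:
  assumes h: "integrable (std_gauss d) h" and h': "integrable (std_gauss d) h'" and le: "\<And>g. \<bar>h g\<bar> \<le> h' g"
  shows "\<bar>\<integral>g. f (affine_vec d a x b g) * h g \<partial>std_gauss d\<bar> \<le> (\<integral>g. h' g \<partial>std_gauss d)"
proof -
  have "\<bar>\<integral>g. f (affine_vec d a x b g) * h g \<partial>std_gauss d\<bar> \<le> (\<integral>g. \<bar>f (affine_vec d a x b g) * h g\<bar> \<partial>std_gauss d)"
    by (rule integral_abs_bound)
  also have "\<dots> \<le> (\<integral>g. h' g \<partial>std_gauss d)"
  proof (intro integral_mono integrable_abs integrable_test_mult h h')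
    fix g
    have "\<bar>f (affine_vec d a x b g) * h g\<bar> \<le> \<bar>h g\<bar>"
      using f_bound by (auto simp: abs_mult intro!: mult_left_le_one_le)
    also note le
    finally show "\<bar>f (affine_vec d a x b g) * h g\<bar> \<le> h' g" .
  qed
  finally show ?thesis .
qed

text \<open>The inequality |t| <= (1 + t^2) / 2 replaces an absolute Gaussian moment by the
  variance.\<close>

lemma smooth1_bound: "k < d \<Longrightarrow> \<bar>smooth1 d f a b x k\<bar> \<le> 1"
proof -
  assume k: "k < d"
  interpret prob_space "std_gauss d" by (rule prob_space_std_gauss)
  have "\<bar>smooth1 d f a b x k\<bar> \<le> (\<integral>g. (1 + g k * g k) / 2 \<partial>std_gauss d)"
    unfolding smooth1_def
  proof (rule abs_integral_test_mult_le)
    show "\<bar>g k\<bar> \<le> (1 + g k * g k) / 2" for g :: "nat \<Rightarrow> real"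
      using zero_le_power2[of "\<bar>g k\<bar> - 1"] by (simp add: power2_eq_square algebra_simps)
  qed (use std_gauss_integrable_coord std_gauss_integrable_mult k in auto)
  also have "\<dots> = 1" using k by (simp add: std_gauss_integrable_mult std_gauss_cov prob_space)
  finally show ?thesis .
qed

lemma std_gauss_integrable_linear_square:
  "integrable (std_gauss d) (\<lambda>g. (\<Sum>k<d. y k * g k)\<^sup>2)" "(\<integral>g. (\<Sum>k<d. y k * g k)\<^sup>2 \<partial>std_gauss d) = (\<Sum>k<d. (y k)\<^sup>2)"
proof -
  have eq: "(\<Sum>k<d. y k * g k)\<^sup>2 = (\<Sum>k<d. \<Sum>l<d. y k * y l * (g k * g l))" for g
    by (simp add: power2_eq_square sum_product mult_ac)
  show "integrable (std_gauss d) (\<lambda>g. (\<Sum>k<d. y k * g k)\<^sup>2)"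
    unfolding eq by (intro Bochner_Integration.integrable_sum integrable_mult_right std_gauss_integrable_mult) auto
  have "(\<integral>g. (\<Sum>k<d. y k * g k)\<^sup>2 \<partial>std_gauss d) = (\<Sum>k<d. \<Sum>l<d. y k * y l * (if k = l then 1 else 0))"
    unfolding eq
  proof (subst Bochner_Integration.integral_sum)
    show "(\<Sum>k<d. \<integral>g. (\<Sum>l<d. y k * y l * (g k * g l)) \<partial>std_gauss d) = (\<Sum>k<d. \<Sum>l<d. y k * y l * (if k = l then 1 else 0))"
      by (intro sum.cong refl, subst Bochner_Integration.integral_sum)
         (auto simp: std_gauss_integrable_mult std_gauss_cov intro!: sum.cong)
  qed (auto intro!: Bochner_Integration.integrable_sum integrable_mult_right std_gauss_integrable_mult)
  also have "\<dots> = (\<Sum>k<d. (y k)\<^sup>2)"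
  proof (intro sum.cong refl)
    fix k assume k: "k \<in> {..<d}"
    have "(\<Sum>l<d. y k * y l * (if k = l then 1 else 0)) = (\<Sum>l<d. if k = l then y k * y l else 0)"
      by (intro sum.cong) auto
    then show "(\<Sum>l<d. y k * y l * (if k = l then 1 else 0)) = (y k)\<^sup>2"
      using k by (simp add: power2_eq_square)
  qed
  finally show "(\<integral>g. (\<Sum>k<d. y k * g k)\<^sup>2 \<partial>std_gauss d) = (\<Sum>k<d. (y k)\<^sup>2)" .
qed

lemma smooth_hess_eq:
  "smooth_hess d f a b x y = (\<integral>g. f (affine_vec d a x b g) * ((\<Sum>k<d. y k * g k)\<^sup>2 - (\<Sum>k<d. (y k)\<^sup>2)) \<partial>std_gauss d)"
proof -
  interpret prob_space "std_gauss d" by (rule prob_space_std_gauss)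
  have int: "integrable (std_gauss d) (\<lambda>g. f (affine_vec d a x b g) * (g k * g l - (if k = l then 1 else 0)))" if "k < d" "l < d" for k l
    by (intro integrable_test_mult Bochner_Integration.integrable_diff std_gauss_integrable_mult that) auto
  have "smooth_hess d f a b x y = (\<integral>g. (\<Sum>k<d. \<Sum>l<d. y k * y l * (f (affine_vec d a x b g) * (g k * g l - (if k = l then 1 else 0)))) \<partial>std_gauss d)"
    unfolding smooth_hess_def smooth2_def
  proof (subst Bochner_Integration.integral_sum)
    show "(\<Sum>k<d. \<Sum>l<d. y k * y l * (\<integral>g. f (affine_vec d a x b g) * (g k * g l - (if k = l then 1 else 0)) \<partial>std_gauss d)) =
      (\<Sum>k<d. \<integral>g. (\<Sum>l<d. y k * y l * (f (affine_vec d a x b g) * (g k * g l - (if k = l then 1 else 0)))) \<partial>std_gauss d)"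
      by (intro sum.cong refl, subst Bochner_Integration.integral_sum) (auto simp: int simp del: if_split intro!: sum.cong integrable_mult_right)
  qed (auto intro!: Bochner_Integration.integrable_sum integrable_mult_right int)
  also have "\<dots> = (\<integral>g. f (affine_vec d a x b g) * ((\<Sum>k<d. y k * g k)\<^sup>2 - (\<Sum>k<d. (y k)\<^sup>2)) \<partial>std_gauss d)"
  proof (intro Bochner_Integration.integral_cong refl)
    fix g :: "nat \<Rightarrow> real"
    have "(\<Sum>k<d. \<Sum>l<d. y k * y l * (g k * g l - (if k = l then 1 else 0))) = (\<Sum>k<d. (\<Sum>l<d. y k * y l * (g k * g l)) - (y k)\<^sup>2)"
    proof (intro sum.cong refl)
      fix k assume k: "k \<in> {..<d}"
      have "(\<Sum>l<d. y k * y l * (g k * g l - (if k = l then 1 else 0))) = (\<Sum>l<d. y k * y l * (g k * g l) - (if k = l then y k * y l else 0))"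
        by (intro sum.cong) (auto simp: algebra_simps)
      then show "(\<Sum>l<d. y k * y l * (g k * g l - (if k = l then 1 else 0))) = (\<Sum>l<d. y k * y l * (g k * g l)) - (y k)\<^sup>2"
        using k by (simp add: sum_subtractf power2_eq_square)
    qed
    also have "\<dots> = (\<Sum>k<d. y k * g k)\<^sup>2 - (\<Sum>k<d. (y k)\<^sup>2)"
      by (simp add: sum_subtractf power2_eq_square sum_product mult_ac)
    finally show "(\<Sum>k<d. \<Sum>l<d. y k * y l * (f (affine_vec d a x b g) * (g k * g l - (if k = l then 1 else 0)))) =
        f (affine_vec d a x b g) * ((\<Sum>k<d. y k * g k)\<^sup>2 - (\<Sum>k<d. (y k)\<^sup>2))"
      by (simp add: sum_distrib_left[symmetric] mult.left_commute[of _ "f _"])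
  qed
  finally show ?thesis .
qed

lemma std_gauss_hess_integrable:
  "integrable (std_gauss d) (\<lambda>g. (\<Sum>k<d. y k * g k)\<^sup>2 - (\<Sum>k<d. (y k)\<^sup>2))"
  "integrable (std_gauss d) (\<lambda>g. (\<Sum>k<d. y k * g k)\<^sup>2 + (\<Sum>k<d. (y k)\<^sup>2))"
  "(\<integral>g. (\<Sum>k<d. y k * g k)\<^sup>2 + (\<Sum>k<d. (y k)\<^sup>2) \<partial>std_gauss d) = 2 * (\<Sum>k<d. (y k)\<^sup>2)"
proof -
  interpret prob_space "std_gauss d" by (rule prob_space_std_gauss)
  note * = std_gauss_integrable_linear_square
  show "integrable (std_gauss d) (\<lambda>g. (\<Sum>k<d. y k * g k)\<^sup>2 - (\<Sum>k<d. (y k)\<^sup>2))"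
    "integrable (std_gauss d) (\<lambda>g. (\<Sum>k<d. y k * g k)\<^sup>2 + (\<Sum>k<d. (y k)\<^sup>2))"
    using * by auto
  show "(\<integral>g. (\<Sum>k<d. y k * g k)\<^sup>2 + (\<Sum>k<d. (y k)\<^sup>2) \<partial>std_gauss d) = 2 * (\<Sum>k<d. (y k)\<^sup>2)"
    using * by (simp add: prob_space)
qed

text \<open>Triangle inequality under the integral, with E (y . G)^2 = |y|^2. Apart from |y| the
  bound does not involve the dimension, nor does it involve \<open>a\<close> and
  \<open>b\<close>.\<close>

lemma smooth_hess_bound: "\<bar>smooth_hess d f a b x y\<bar> \<le> 2 * (\<Sum>k<d. (y k)\<^sup>2)"
  unfolding smooth_hess_eq std_gauss_hess_integrable(3)[symmetric]
  by (rule abs_integral_test_mult_le[OF std_gauss_hess_integrable(1,2)]) (auto simp: abs_le_iff sum_nonneg)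

text \<open>Along the segment only the centre of the kernel moves, with velocity a y.
  Differentiating the first Hermite weight times the kernel yields the second Hermite weight times
  the kernel, with a factor a / b.\<close>

lemma smooth1_increment:
  assumes b: "0 < b"
  shows "(\<Sum>k<d. y k * (smooth1 d f a b (\<lambda>i. x i + y i) k - smooth1 d f a b x k)) =
    (\<integral>t. a / b * smooth_hess d f a b (\<lambda>i. x i + t * y i) y * indicator {0..1} t \<partial>lborel)"
proof -
  define u where "u t z i = (z i - a * (x i + t * y i)) / b" for t z i
  define ker where "ker t z = gauss_kernel d (\<lambda>i. a * (x i + t * y i)) b z" for t z
  define K where "K t z = (\<Sum>k<d. y k * u t z k) * ker t z" for t z
  define K' where "K' t z = a / b * ((\<Sum>k<d. y k * u t z k)\<^sup>2 - (\<Sum>k<d. (y k)\<^sup>2)) * ker t z" for t z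
  have ker_def': "ker t z = (1 / sqrt (2 * pi)) ^ d * exp (- (real d * ln b) - (\<Sum>i<d. (u t z i)\<^sup>2) / 2)" for t z
    by (simp add: ker_def gauss_kernel_def u_def)
  let ?r = "\<lambda>t z. \<lambda>i\<in>{..<d}. (z i - a * (x i + t * y i)) / b"
  have r: "(\<Sum>k<d. y k * ?r t z k) = (\<Sum>k<d. y k * u t z k)" for t z by (simp add: u_def)
  have du: "((\<lambda>t. u t z i) has_real_derivative - (a * y i / b)) (at t)" for t z i
    unfolding u_def using b by (auto intro!: derivative_eq_intros simp: field_simps)
  have ds: "((\<lambda>t. \<Sum>k<d. y k * u t z k) has_real_derivative - (a / b * (\<Sum>k<d. (y k)\<^sup>2))) (at t)" for t z
  proof -
    have "((\<lambda>t. \<Sum>k<d. y k * u t z k) has_real_derivative (\<Sum>k<d. y k * - (a * y k / b))) (at t)"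
      by (intro DERIV_sum DERIV_cmult du)
    also have "(\<Sum>k<d. y k * - (a * y k / b)) = - (a / b * (\<Sum>k<d. (y k)\<^sup>2))"
      by (simp add: sum_distrib_left sum_negf power2_eq_square mult_ac)
    finally show ?thesis .
  qed
  have dk: "((\<lambda>t. ker t z) has_real_derivative ker t z * (a / b * (\<Sum>k<d. y k * u t z k))) (at t)" for t z
  proof -
    have "((\<lambda>t. \<Sum>i<d. (u t z i)\<^sup>2) has_real_derivative (\<Sum>i<d. 2 * u t z i * - (a * y i / b))) (at t)"
      by (intro DERIV_sum) (auto intro!: derivative_eq_intros du)
    from DERIV_exp_diff_half[OF DERIV_const this]
    have "((\<lambda>t. ker t z) has_real_derivative ker t z * (- (\<Sum>i<d. 2 * u t z i * - (a * y i / b)) / 2)) (at t)"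
      unfolding ker_def' by simp
    also have "- (\<Sum>i<d. 2 * u t z i * - (a * y i / b)) / 2 = a / b * (\<Sum>k<d. y k * u t z k)"
      by (simp add: sum_distrib_left sum_negf sum_divide_distrib mult_ac)
    finally show ?thesis .
  qed
  have [measurable]: "(\<lambda>(t, z). u t z i) \<in> borel_measurable (borel \<Otimes>\<^sub>M lebesgue_vecs d)" if "i < d" for i
  proof -
    have "(\<lambda>z. z i) \<in> measurable (lebesgue_vecs d) lborel" by (rule measurable_component_singleton) (use that in simp)
    then have "(\<lambda>z. z i) \<in> borel_measurable (lebesgue_vecs d)" by simp
    then have [measurable]: "(\<lambda>w :: real \<times> (nat \<Rightarrow> real). snd w i) \<in> borel_measurable (borel \<Otimes>\<^sub>M lebesgue_vecs d)"
      by (rule measurable_compose[OF measurable_snd])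
    show ?thesis unfolding u_def case_prod_beta by measurable
  qed
  have [measurable]: "(\<lambda>(t, z). ker t z) \<in> borel_measurable (borel \<Otimes>\<^sub>M lebesgue_vecs d)"
    unfolding ker_def' by measurable
  have K'm: "(\<lambda>(t, z). K' t z) \<in> borel_measurable (borel \<Otimes>\<^sub>M lebesgue_vecs d)"
    unfolding K'_def by measurable
  have I1: "integrable (lebesgue_vecs d) (\<lambda>z. \<bar>h (?r t z)\<bar> * ker t z) \<longleftrightarrow> integrable (std_gauss d) (\<lambda>g. \<bar>h g\<bar>)"
    "(\<integral>z. \<bar>h (?r t z)\<bar> * ker t z \<partial>lebesgue_vecs d) = (\<integral>g. \<bar>h g\<bar> \<partial>std_gauss d)"
    "integrable (lebesgue_vecs d) (\<lambda>z. h (?r t z) * ker t z) \<longleftrightarrow> integrable (std_gauss d) h"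
    if [measurable]: "h \<in> borel_measurable (vecs d)" for h t
    unfolding ker_def
    using integrable_gauss_kernel[OF b, where F="\<lambda>z g. \<bar>h g\<bar>" and d=d and p="\<lambda>i. a * (x i + t * y i)"]
      integral_gauss_kernel[OF b, where F="\<lambda>z g. \<bar>h g\<bar>" and d=d and p="\<lambda>i. a * (x i + t * y i)"]
      integrable_gauss_kernel[OF b, where F="\<lambda>z. h" and d=d and p="\<lambda>i. a * (x i + t * y i)"] by auto
  have I2: "(\<integral>z. f z * (h (?r t z) * ker t z) \<partial>lebesgue_vecs d) = (\<integral>g. f (affine_vec d a (\<lambda>i. x i + t * y i) b g) * h g \<partial>std_gauss d)"
    if [measurable]: "h \<in> borel_measurable (vecs d)" for h t
    unfolding ker_def affine_vec_def
    using integral_gauss_kernel[OF b, where F="\<lambda>z g. f z * h g" and d=d and p="\<lambda>i. a * (x i + t * y i)"] by (simp add: mult.assoc)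
  have Kr: "K t z = (\<lambda>g. \<Sum>k<d. y k * g k) (?r t z) * ker t z" for t z unfolding K_def by (simp only: r)
  have K'r: "K' t z = (\<lambda>g. a / b * ((\<Sum>k<d. y k * g k)\<^sup>2 - (\<Sum>k<d. (y k)\<^sup>2))) (?r t z) * ker t z" for t z
    unfolding K'_def by (simp only: r)
  have il: "integrable (std_gauss d) (\<lambda>g. \<Sum>k<d. y k * g k)"
    by (intro Bochner_Integration.integrable_sum integrable_mult_right std_gauss_integrable_coord) auto
  have lm: "(\<lambda>g. \<Sum>k<d. y k * g k) \<in> borel_measurable (vecs d)" by measurable
  have hm: "(\<lambda>g. a / b * ((\<Sum>k<d. y k * g k)\<^sup>2 - (\<Sum>k<d. (y k)\<^sup>2))) \<in> borel_measurable (vecs d)" by measurable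
  have hi: "integrable (std_gauss d) (\<lambda>g. a / b * ((\<Sum>k<d. y k * g k)\<^sup>2 - (\<Sum>k<d. (y k)\<^sup>2)))"
    by (intro integrable_mult_right std_gauss_hess_integrable)
  have "(\<integral>z. f z * K 1 z \<partial>lebesgue_vecs d) - (\<integral>z. f z * K 0 z \<partial>lebesgue_vecs d) =
      (\<integral>t. (\<integral>z. f z * K' t z \<partial>lebesgue_vecs d) * indicator {0..1} t \<partial>lborel)"
  proof (rule kernel_FTC[OF sigma_finite_lebesgue_vecs])
    show "((\<lambda>t. K t z) has_real_derivative K' t z) (at t)" for t z
      unfolding K_def by (rule DERIV_cong[OF DERIV_mult[OF ds dk]]) (simp add: K'_def power2_eq_square algebra_simps)
    have "isCont (\<lambda>t. \<Sum>k<d. y k * u t z k) t" "isCont (\<lambda>t. ker t z) t" for t z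
      using ds dk DERIV_isCont by blast+
    then show "isCont (\<lambda>t. K' t z) t" for t z
      unfolding K'_def by (intro isCont_mult isCont_diff isCont_power continuous_const)
    show "(\<integral>z. \<bar>K' t z\<bar> \<partial>lebesgue_vecs d) \<le> (\<integral>g. \<bar>a / b * ((\<Sum>k<d. y k * g k)\<^sup>2 - (\<Sum>k<d. (y k)\<^sup>2))\<bar> \<partial>std_gauss d)" for t
    proof -
      have "\<bar>K' t z\<bar> = \<bar>(\<lambda>g. a / b * ((\<Sum>k<d. y k * g k)\<^sup>2 - (\<Sum>k<d. (y k)\<^sup>2))) (?r t z)\<bar> * ker t z" for z
        unfolding K'r abs_mult[of _ "ker t z"] using gauss_kernel_pos by (simp add: ker_def less_imp_le)
      then show ?thesis using I1(2)[OF hm] by (simp only:)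
    qed
    show "integrable (lebesgue_vecs d) (K 0)" "integrable (lebesgue_vecs d) (K 1)" unfolding Kr I1(3)[OF lm] by (rule il)+
    show "integrable (lebesgue_vecs d) (K' t)" for t unfolding K'r I1(3)[OF hm] by (rule hi)
  qed (use K'm f_bound in auto)
  moreover have "(\<integral>z. f z * K t z \<partial>lebesgue_vecs d) = (\<Sum>k<d. y k * smooth1 d f a b (\<lambda>i. x i + t * y i) k)" for t
  proof -
    have "(\<integral>z. f z * K t z \<partial>lebesgue_vecs d) = (\<integral>g. f (affine_vec d a (\<lambda>i. x i + t * y i) b g) * (\<Sum>k<d. y k * g k) \<partial>std_gauss d)"
      unfolding Kr by (rule I2[OF lm])
    also have "\<dots> = (\<integral>g. (\<Sum>k<d. y k * (f (affine_vec d a (\<lambda>i. x i + t * y i) b g) * g k)) \<partial>std_gauss d)"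
      unfolding sum_distrib_left by (simp only: mult.left_commute)
    also have "\<dots> = (\<Sum>k<d. y k * smooth1 d f a b (\<lambda>i. x i + t * y i) k)"
      unfolding smooth1_def by (subst Bochner_Integration.integral_sum) (auto intro!: integrable_mult_right integrable_test_mult std_gauss_integrable_coord)
    finally show ?thesis .
  qed
  moreover have "(\<integral>z. f z * K' t z \<partial>lebesgue_vecs d) = a / b * smooth_hess d f a b (\<lambda>i. x i + t * y i) y" for t
    unfolding K'r I2[OF hm] smooth_hess_eq
    by (subst integral_mult_right_zero[symmetric]) (intro Bochner_Integration.integral_cong refl, simp)
  ultimately show ?thesis by (simp add: right_diff_distrib sum_subtractf)
qed

text \<open>The derivative of \<open>smooth0 d f (cos \<phi>) (sin \<phi>) v\<close> with respect to \<open>\<phi>\<close>.\<close>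

definition angle_deriv :: "real \<Rightarrow> (nat \<Rightarrow> real) \<Rightarrow> real" where
  "angle_deriv \<phi> v = - (\<Sum>k<d. v k * smooth1 d f (cos \<phi>) (sin \<phi>) v k) + cos \<phi> / sin \<phi> * (\<Sum>k<d. smooth2 d f (cos \<phi>) (sin \<phi>) v k k)"

text \<open>The kernel has centre cos \<phi> v and width sin \<phi>, so both move. With u the
  standardised variable, its logarithmic derivative in \<phi> is the sum over i of -v_i u_i + cot
  \<phi> (u_i^2 - 1): the first part comes from the centre, the second from the width.\<close>

lemma smooth0_increment:
  assumes "0 < \<alpha>" "\<alpha> \<le> \<beta>" "\<beta> \<le> pi / 2"
  shows "smooth0 d f (cos \<beta>) (sin \<beta>) v - smooth0 d f (cos \<alpha>) (sin \<alpha>) v = (\<integral>\<phi>. angle_deriv \<phi> v * indicator {\<alpha>..\<beta>} \<phi> \<partial>lborel)"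
proof -
  interpret G: prob_space "std_gauss d" by (rule prob_space_std_gauss)
  have sin: "0 < sin \<phi>" "sin \<phi> \<noteq> 0" if "\<phi> \<in> {\<alpha>..\<beta>}" for \<phi>
    using sin_gt_zero[of \<phi>] that assms pi_gt_zero by auto
  define u where "u \<phi> z i = (z i - cos \<phi> * v i) / sin \<phi>" for \<phi> z i
  define K where "K \<phi> z = gauss_kernel d (\<lambda>i. cos \<phi> * v i) (sin \<phi>) z" for \<phi> z
  define q where "q \<phi> g = (\<Sum>i<d. - (v i * g i) + cos \<phi> / sin \<phi> * (g i * g i - 1))" for \<phi> and g :: "nat \<Rightarrow> real"
  define K' where "K' \<phi> z = q \<phi> (u \<phi> z) * K \<phi> z" for \<phi> z
  have K_def': "K t z = (1 / sqrt (2 * pi)) ^ d * exp (- (real d * ln (sin t)) - (\<Sum>i<d. (u t z i)\<^sup>2) / 2)" for t z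
    by (simp add: K_def gauss_kernel_def u_def)
  let ?r = "\<lambda>t z. \<lambda>i\<in>{..<d}. (z i - cos t * v i) / sin t"
  have r: "q s (?r t z) = q s (u t z)" for s t z by (simp add: u_def q_def)
  have du: "((\<lambda>t. u t z i) has_real_derivative v i - cos t / sin t * u t z i) (at t)" if "t \<in> {\<alpha>..\<beta>}" for t z i
    unfolding u_def using sin[OF that] by (auto intro!: derivative_eq_intros simp: field_simps power2_eq_square)
  have dk: "((\<lambda>t. K t z) has_real_derivative K' t z) (at t)" if t: "t \<in> {\<alpha>..\<beta>}" for t z
  proof -
    have "((\<lambda>t. \<Sum>i<d. (u t z i)\<^sup>2) has_real_derivative (\<Sum>i<d. 2 * u t z i * (v i - cos t / sin t * u t z i))) (at t)"
      by (intro DERIV_sum) (auto intro!: derivative_eq_intros du[OF t])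
    moreover have "((\<lambda>t. - (real d * ln (sin t))) has_real_derivative - (real d * (cos t / sin t))) (at t)"
      using sin[OF t] by (auto intro!: derivative_eq_intros)
    ultimately have "((\<lambda>t. K t z) has_real_derivative K t z * (- (real d * (cos t / sin t)) - (\<Sum>i<d. 2 * u t z i * (v i - cos t / sin t * u t z i)) / 2)) (at t)"
      unfolding K_def' by (intro DERIV_exp_diff_half)
    also have "- (real d * (cos t / sin t)) - (\<Sum>i<d. 2 * u t z i * (v i - cos t / sin t * u t z i)) / 2 = q t (u t z)"
    proof -
      have "q t (u t z) = (\<Sum>i<d. - (2 * u t z i * (v i - cos t / sin t * u t z i) / 2) - cos t / sin t)"
        unfolding q_def
      proof (intro sum.cong refl)
        show "- (v i * w) + c * (w * w - 1) = - (2 * w * (v i - c * w) / 2) - c" for i c w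
          by (simp add: field_simps)
      qed
      then show ?thesis by (simp add: sum_subtractf sum_negf sum_divide_distrib)
    qed
    finally show ?thesis by (simp add: K'_def mult.commute)
  qed
  have [measurable]: "(\<lambda>(t, z). u t z i) \<in> borel_measurable (borel \<Otimes>\<^sub>M lebesgue_vecs d)" if "i < d" for i
  proof -
    have "(\<lambda>z. z i) \<in> measurable (lebesgue_vecs d) lborel" by (rule measurable_component_singleton) (use that in simp)
    then have "(\<lambda>z. z i) \<in> borel_measurable (lebesgue_vecs d)" by simp
    then have [measurable]: "(\<lambda>w :: real \<times> (nat \<Rightarrow> real). snd w i) \<in> borel_measurable (borel \<Otimes>\<^sub>M lebesgue_vecs d)"
      by (rule measurable_compose[OF measurable_snd])
    show ?thesis unfolding u_def case_prod_beta by measurable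
  qed
  have [measurable]: "(\<lambda>(t, z). K t z) \<in> borel_measurable (borel \<Otimes>\<^sub>M lebesgue_vecs d)"
    unfolding K_def' by measurable
  have K'm: "(\<lambda>(t, z). K' t z) \<in> borel_measurable (borel \<Otimes>\<^sub>M lebesgue_vecs d)"
    unfolding K'_def q_def by measurable
  have qm: "q t \<in> borel_measurable (vecs d)" for t unfolding q_def by measurable
  have qi: "integrable (std_gauss d) (q t)" for t
    unfolding q_def by (intro Bochner_Integration.integrable_sum Bochner_Integration.integrable_add integrable_minus integrable_mult_right
        Bochner_Integration.integrable_diff std_gauss_integrable_coord std_gauss_integrable_mult) auto
  have I: "integrable (lebesgue_vecs d) (K' t)"
    "(\<integral>z. \<bar>K' t z\<bar> \<partial>lebesgue_vecs d) = (\<integral>g. \<bar>q t g\<bar> \<partial>std_gauss d)"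
    "(\<integral>z. f z * K' t z \<partial>lebesgue_vecs d) = (\<integral>g. f (affine_vec d (cos t) v (sin t) g) * q t g \<partial>std_gauss d)"
    if t: "t \<in> {\<alpha>..\<beta>}" for t
  proof -
    note m[measurable] = qm
    have [measurable]: "(\<lambda>z. q t (u t z)) \<in> borel_measurable (vecs d)"
      unfolding r[symmetric] by (rule measurable_compose[OF _ qm]) measurable
    have a: "\<bar>q t (u t z) * K t z\<bar> = \<bar>q t (u t z)\<bar> * K t z" for z
      using gauss_kernel_pos by (simp add: K_def abs_mult less_imp_le)
    show "integrable (lebesgue_vecs d) (K' t)"
      using integrable_gauss_kernel[OF sin(1)[OF t], where F="\<lambda>z. q t" and d=d and p="\<lambda>i. cos t * v i"] qi
      by (simp add: K'_def K_def[symmetric] r cong: Bochner_Integration.integrable_cong)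
    show "(\<integral>z. \<bar>K' t z\<bar> \<partial>lebesgue_vecs d) = (\<integral>g. \<bar>q t g\<bar> \<partial>std_gauss d)"
      using integral_gauss_kernel[OF sin(1)[OF t], where F="\<lambda>z g. \<bar>q t g\<bar>" and d=d and p="\<lambda>i. cos t * v i"]
      by (simp add: K'_def K_def[symmetric] r a)
    show "(\<integral>z. f z * K' t z \<partial>lebesgue_vecs d) = (\<integral>g. f (affine_vec d (cos t) v (sin t) g) * q t g \<partial>std_gauss d)"
      using integral_gauss_kernel[OF sin(1)[OF t], where F="\<lambda>z g. f z * q t g" and d=d and p="\<lambda>i. cos t * v i"]
      by (simp add: K'_def K_def[symmetric] r affine_vec_def mult.assoc)
  qed
  have I0: "integrable (lebesgue_vecs d) (K t)"
    "(\<integral>z. f z * K t z \<partial>lebesgue_vecs d) = smooth0 d f (cos t) (sin t) v" if t: "t \<in> {\<alpha>..\<beta>}" for t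
    using integrable_gauss_kernel[OF sin(1)[OF t], where F="\<lambda>z g. 1" and d=d and p="\<lambda>i. cos t * v i"]
      integral_gauss_kernel[OF sin(1)[OF t], where F="\<lambda>z g. f z" and d=d and p="\<lambda>i. cos t * v i"]
    by (simp_all add: K_def[abs_def] smooth0_def affine_vec_def)
  \<comment> \<open>The bound has to be uniform in \<open>t\<close>; the cotangent decreases on the
    interval, so its value at \<alpha> serves.\<close>
  have C: "(\<integral>g. \<bar>q t g\<bar> \<partial>std_gauss d) \<le> (\<Sum>i<d. \<bar>v i\<bar> + cos \<alpha> / sin \<alpha> * 2)" if t: "t \<in> {\<alpha>..\<beta>}" for t
  proof -
    have ct: "0 \<le> cos t / sin t" using sin[OF t] cos_ge_zero[of t] t assms by auto
    have "(\<integral>g. \<bar>q t g\<bar> \<partial>std_gauss d) \<le> (\<integral>g. (\<Sum>i<d. \<bar>v i\<bar> * ((1 + g i * g i) / 2) + cos t / sin t * (g i * g i + 1)) \<partial>std_gauss d)"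
    proof (rule integral_mono)
      fix g :: "nat \<Rightarrow> real"
      have "\<bar>g i\<bar> \<le> (1 + g i * g i) / 2" for i
        using zero_le_power2[of "\<bar>g i\<bar> - 1"] by (simp add: power2_eq_square algebra_simps)
      moreover have "\<bar>g i * g i - 1\<bar> \<le> g i * g i + 1" for i
        using zero_le_square[of "g i"] by (simp add: abs_le_iff)
      ultimately have e: "\<bar>- (v i * g i)\<bar> \<le> \<bar>v i\<bar> * ((1 + g i * g i) / 2)"
        "\<bar>cos t / sin t * (g i * g i - 1)\<bar> \<le> cos t / sin t * (g i * g i + 1)" for i
        unfolding abs_minus_cancel abs_mult[of "v i"] abs_mult[of "cos t / sin t"] abs_of_nonneg[OF ct]
        by (intro mult_left_mono ct abs_ge_zero; blast)+
      show "\<bar>q t g\<bar> \<le> (\<Sum>i<d. \<bar>v i\<bar> * ((1 + g i * g i) / 2) + cos t / sin t * (g i * g i + 1))"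
        unfolding q_def by (intro order_trans[OF sum_abs] sum_mono order_trans[OF abs_triangle_ineq] add_mono e)
    qed (use qi in \<open>auto intro!: Bochner_Integration.integrable_sum Bochner_Integration.integrable_add integrable_mult_right std_gauss_integrable_mult\<close>)
    also have "\<dots> = (\<Sum>i<d. \<bar>v i\<bar> + cos t / sin t * 2)"
    proof (subst Bochner_Integration.integral_sum)
      have "(\<integral>g. w * ((1 + g i * g i) / 2) + c * (g i * g i + 1) \<partial>std_gauss d) = w + c * 2" if "i < d" for i w c
        using that by (simp add: std_gauss_integrable_mult std_gauss_cov G.prob_space)
      then show "(\<Sum>i<d. \<integral>g. \<bar>v i\<bar> * ((1 + g i * g i) / 2) + cos t / sin t * (g i * g i + 1) \<partial>std_gauss d) =
          (\<Sum>i<d. \<bar>v i\<bar> + cos t / sin t * 2)"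
        by (intro sum.cong refl) blast
    qed (auto intro!: Bochner_Integration.integrable_add integrable_mult_right std_gauss_integrable_mult)
    also have "\<dots> \<le> (\<Sum>i<d. \<bar>v i\<bar> + cos \<alpha> / sin \<alpha> * 2)"
    proof -
      have "cos t \<le> cos \<alpha>" using t assms pi_gt_zero by (intro cos_monotone_0_pi_le) auto
      moreover have "sin \<alpha> \<le> sin t" using t assms by (intro sin_monotone_2pi_le) auto
      ultimately have "cos t / sin t \<le> cos \<alpha> / sin \<alpha>"
        using sin[of \<alpha>] sin[OF t] assms cos_ge_zero[of \<alpha>] by (intro frac_le) auto
      then show ?thesis by (intro sum_mono add_left_mono mult_right_mono) auto
    qed
    finally show ?thesis .
  qed
  have "(\<integral>z. f z * K \<beta> z \<partial>lebesgue_vecs d) - (\<integral>z. f z * K \<alpha> z \<partial>lebesgue_vecs d) =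
      (\<integral>t. (\<integral>z. f z * K' t z \<partial>lebesgue_vecs d) * indicator {\<alpha>..\<beta>} t \<partial>lborel)"
  proof (rule kernel_FTC[where C = "\<Sum>i<d. \<bar>v i\<bar> + cos \<alpha> / sin \<alpha> * 2", OF sigma_finite_lebesgue_vecs])
    fix t z assume t: "t \<in> {\<alpha>..\<beta>}"
    have "isCont (\<lambda>t. u t z k) t" "isCont (\<lambda>t. K t z) t" for k
      using du dk t DERIV_isCont by blast+
    then show "isCont (\<lambda>t. K' t z) t" unfolding K'_def q_def using sin[OF t] by (intro continuous_intros)
  qed (use K'm f_bound I I0 C dk assms in auto)
  moreover have "(\<integral>g. f (affine_vec d (cos t) v (sin t) g) * q t g \<partial>std_gauss d) = angle_deriv t v" for t
  proof -
    have "(\<integral>g. f (affine_vec d (cos t) v (sin t) g) * q t g \<partial>std_gauss d) =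
        (\<integral>g. (\<Sum>i<d. - (v i * (f (affine_vec d (cos t) v (sin t) g) * g i)) +
           cos t / sin t * (f (affine_vec d (cos t) v (sin t) g) * (g i * g i - (if i = i then 1 else 0)))) \<partial>std_gauss d)"
      unfolding q_def sum_distrib_left by (intro Bochner_Integration.integral_cong sum.cong refl) (simp add: algebra_simps)
    also have "\<dots> = (\<Sum>i<d. - (v i * smooth1 d f (cos t) (sin t) v i) + cos t / sin t * smooth2 d f (cos t) (sin t) v i i)"
    proof -
      have "integrable (std_gauss d) (\<lambda>g. f (affine_vec d (cos t) v (sin t) g) * g i)"
        "integrable (std_gauss d) (\<lambda>g. f (affine_vec d (cos t) v (sin t) g) * (g i * g i - (if i = i then 1 else 0)))" if "i < d" for i
        by (rule integrable_test_mult, use that in \<open>simp add: std_gauss_integrable_coord std_gauss_integrable_mult\<close>)+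
      then show ?thesis unfolding smooth1_def smooth2_def
        by (subst Bochner_Integration.integral_sum) (auto simp del: if_cancel simp: if_True intro!: sum.cong)
    qed
    also have "\<dots> = angle_deriv t v"
      by (simp add: angle_deriv_def sum.distrib sum_negf sum_distrib_left sum_subtractf)
    finally show ?thesis .
  qed
  moreover have "(\<integral>t. (\<integral>z. f z * K' t z \<partial>lebesgue_vecs d) * indicator {\<alpha>..\<beta>} t \<partial>lborel) =
      (\<integral>t. (\<integral>g. f (affine_vec d (cos t) v (sin t) g) * q t g \<partial>std_gauss d) * indicator {\<alpha>..\<beta>} t \<partial>lborel)"
    by (intro Bochner_Integration.integral_cong refl) (auto simp: indicator_def I)
  ultimately show ?thesis using I0 assms by auto
qed

end

text \<open>Joint measurability in scale, width and point, as required for applying Fubini to an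
  angle and a random vector at the same time.\<close>

lemma measurable_smooth [measurable (raw)]:
  assumes [measurable]: "f \<in> borel_measurable (vecs d)" "A \<in> borel_measurable N" "B \<in> borel_measurable N" "X \<in> measurable N (vecs d)"
  shows "(\<lambda>w. smooth0 d f (A w) (B w) (X w)) \<in> borel_measurable N"
    and "k < d \<Longrightarrow> (\<lambda>w. smooth1 d f (A w) (B w) (X w) k) \<in> borel_measurable N"
    and "k < d \<Longrightarrow> l < d \<Longrightarrow> (\<lambda>w. smooth2 d f (A w) (B w) (X w) k l) \<in> borel_measurable N"
proof -
  interpret prob_space "std_gauss d" by (rule prob_space_std_gauss)
  have G: "snd \<in> measurable (N \<Otimes>\<^sub>M std_gauss d) (vecs d)"
    using measurable_snd[of N "std_gauss d"] by simp
  have [measurable]: "(\<lambda>w. f (affine_vec d (A (fst w)) (X (fst w)) (B (fst w)) (snd w))) \<in> borel_measurable (N \<Otimes>\<^sub>M std_gauss d)"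
    by (rule measurable_compose[OF _ assms(1)], rule measurable_affine_vec[OF _ _ _ G]) measurable
  have [measurable]: "(\<lambda>w. snd w k) \<in> borel_measurable (N \<Otimes>\<^sub>M std_gauss d)" if "k < d" for k
    by (rule measurable_compose[OF G]) (use that in simp)
  show "(\<lambda>w. smooth0 d f (A w) (B w) (X w)) \<in> borel_measurable N"
    unfolding smooth0_def by (rule borel_measurable_lebesgue_integral) (simp add: case_prod_beta)
  show "(\<lambda>w. smooth1 d f (A w) (B w) (X w) k) \<in> borel_measurable N" if [simp]: "k < d"
    unfolding smooth1_def by (rule borel_measurable_lebesgue_integral) (simp add: case_prod_beta)
  show "(\<lambda>w. smooth2 d f (A w) (B w) (X w) k l) \<in> borel_measurable N" if [simp]: "k < d" "l < d"
    unfolding smooth2_def by (rule borel_measurable_lebesgue_integral) (simp add: case_prod_beta)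
qed

lemma (in bounded_test) smooth2_diag_bound: "k < d \<Longrightarrow> \<bar>smooth2 d f a b x k k\<bar> \<le> 2"
proof -
  assume k: "k < d"
  have "\<bar>smooth2 d f a b x k k\<bar> \<le> (\<integral>g. g k * g k + 1 \<partial>std_gauss d)"
    unfolding smooth2_def
  proof (rule abs_integral_test_mult_le)
    interpret prob_space "std_gauss d" by (rule prob_space_std_gauss)
    show "integrable (std_gauss d) (\<lambda>g. g k * g k - (if k = k then 1 else 0))" "integrable (std_gauss d) (\<lambda>g. g k * g k + 1)"
      using std_gauss_integrable_mult[OF k k] by auto
  qed (auto simp: abs_le_iff)
  also have "\<dots> = 2"
  proof -
    interpret prob_space "std_gauss d" by (rule prob_space_std_gauss)
    show ?thesis using k by (simp add: std_gauss_integrable_mult std_gauss_cov)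
  qed
  finally show ?thesis .
qed

text \<open>At \<pi>/2 the vector v has weight cos = 0 and only the Gaussian is left. Fubini passes
  the bound on the mean derivative under the integral over the angle, and K ln(sin \<phi>) is an
  antiderivative of K cot \<phi>.\<close>

lemma (in bounded_test) smooth0_interpolation:
  assumes Q: "prob_space Q" "sets Q = sets (vecs d)" and Qi: "\<And>k. k < d \<Longrightarrow> integrable Q (\<lambda>v. v k)"
    and \<phi>0: "0 < \<phi>0" "\<phi>0 \<le> pi / 2"
    and le: "\<And>\<phi>. \<phi>0 \<le> \<phi> \<Longrightarrow> \<phi> \<le> pi / 2 \<Longrightarrow> \<bar>\<integral>v. angle_deriv \<phi> v \<partial>Q\<bar> \<le> K * (cos \<phi> / sin \<phi>)"
  shows "\<bar>(\<integral>v. smooth0 d f (cos \<phi>0) (sin \<phi>0) v \<partial>Q) - (\<integral>g. f g \<partial>std_gauss d)\<bar> \<le> K * ln (1 / sin \<phi>0)"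
proof -
  interpret Q: prob_space Q by fact
  interpret P: pair_sigma_finite lborel Q ..
  note [measurable_cong] = Q(2)
  let ?I = "{\<phi>0..pi / 2}"
  have sin: "0 < sin \<phi>" if "\<phi> \<in> ?I" for \<phi> using sin_gt_zero[of \<phi>] that \<phi>0 pi_gt_zero by auto
  define J where "J \<phi> v = angle_deriv \<phi> v * indicator ?I \<phi>" for \<phi> v
  have snd_meas[measurable]: "(\<lambda>w. snd w) \<in> measurable (lborel \<Otimes>\<^sub>M Q) (vecs d)"
    using measurable_snd[of lborel Q] Q(2) by (simp cong: measurable_cong_sets)
  have [measurable]: "(\<lambda>w. snd w k) \<in> borel_measurable (lborel \<Otimes>\<^sub>M Q)" if "k < d" for k
    by (rule measurable_compose[OF snd_meas]) (use that in simp)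
  have Jm: "(\<lambda>(\<phi>, v). J \<phi> v) \<in> borel_measurable (lborel \<Otimes>\<^sub>M Q)"
    unfolding J_def angle_deriv_def case_prod_beta by measurable
  \<comment> \<open>An integrable majorant of the derivative, uniform over angles from
    \<open>\<phi>0\<close> on; this is where stopping short of angle 0 matters.\<close>
  define h where "h v = (\<Sum>k<d. \<bar>v k\<bar>) + cos \<phi>0 / sin \<phi>0 * (2 * real d)" for v
  have Jh: "\<bar>J \<phi> v\<bar> \<le> h v * indicator ?I \<phi>" for \<phi> v
  proof (cases "\<phi> \<in> ?I")
    case True
    have "cos \<phi> \<le> cos \<phi>0" using True \<phi>0 pi_gt_zero by (intro cos_monotone_0_pi_le) auto
    moreover have "sin \<phi>0 \<le> sin \<phi>" using True \<phi>0 by (intro sin_monotone_2pi_le) auto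
    moreover have c0: "0 \<le> cos \<phi>" using cos_ge_zero[of \<phi>] True \<phi>0 by auto
    ultimately have c: "cos \<phi> / sin \<phi> \<le> cos \<phi>0 / sin \<phi>0" "0 \<le> cos \<phi> / sin \<phi>"
      using sin[of \<phi>0] sin[OF True] \<phi>0 by (auto intro!: frac_le)
    have "\<bar>angle_deriv \<phi> v\<bar> \<le> \<bar>\<Sum>k<d. v k * smooth1 d f (cos \<phi>) (sin \<phi>) v k\<bar> + \<bar>cos \<phi> / sin \<phi> * (\<Sum>k<d. smooth2 d f (cos \<phi>) (sin \<phi>) v k k)\<bar>"
      unfolding angle_deriv_def by linarith
    also have "\<dots> \<le> (\<Sum>k<d. \<bar>v k\<bar>) + cos \<phi>0 / sin \<phi>0 * (2 * real d)"
    proof (rule add_mono)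
      show "\<bar>\<Sum>k<d. v k * smooth1 d f (cos \<phi>) (sin \<phi>) v k\<bar> \<le> (\<Sum>k<d. \<bar>v k\<bar>)"
        by (intro order_trans[OF sum_abs] sum_mono) (use smooth1_bound in \<open>auto simp: abs_mult intro!: mult_left_le\<close>)
      have "\<bar>\<Sum>k<d. smooth2 d f (cos \<phi>) (sin \<phi>) v k k\<bar> \<le> (\<Sum>k<d. 2)"
        by (intro order_trans[OF sum_abs] sum_mono) (use smooth2_diag_bound in auto)
      then show "\<bar>cos \<phi> / sin \<phi> * (\<Sum>k<d. smooth2 d f (cos \<phi>) (sin \<phi>) v k k)\<bar> \<le> cos \<phi>0 / sin \<phi>0 * (2 * real d)"
        unfolding abs_mult using c by (intro mult_mono) auto
    qed
    finally show ?thesis using True by (simp add: J_def h_def)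
  qed (simp add: J_def)
  have hi: "integrable Q h"
    unfolding h_def using Qi by (intro Bochner_Integration.integrable_add Bochner_Integration.integrable_sum integrable_abs) auto
  have h0: "0 \<le> h v" for v
    unfolding h_def using sin[of \<phi>0] \<phi>0 cos_ge_zero[of \<phi>0] by (intro add_nonneg_nonneg sum_nonneg mult_nonneg_nonneg divide_nonneg_nonneg) auto
  have Jint: "integrable Q (J \<phi>)" for \<phi>
  proof (rule Bochner_Integration.integrable_bound[OF hi])
    show "AE v in Q. norm (J \<phi> v) \<le> norm (h v)"
    proof (rule AE_I2)
      fix v
      have "\<bar>J \<phi> v\<bar> \<le> h v" using Jh[of \<phi> v] h0[of v] by (cases "\<phi> \<in> ?I") simp_all
      then show "norm (J \<phi> v) \<le> norm (h v)" using h0[of v] by simp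
    qed
    show "J \<phi> \<in> borel_measurable Q" unfolding J_def angle_deriv_def by measurable
  qed
  have Ji: "integrable (lborel \<Otimes>\<^sub>M Q) (\<lambda>(\<phi>, v). J \<phi> v)"
  proof (rule P.Fubini_integrable[OF Jm])
    show "integrable lborel (\<lambda>\<phi>. \<integral>v. norm (case (\<phi>, v) of (\<phi>, v) \<Rightarrow> J \<phi> v) \<partial>Q)"
    proof (rule Bochner_Integration.integrable_bound[where f="\<lambda>\<phi>. (\<integral>v. h v \<partial>Q) * indicator ?I \<phi>"])
      show "integrable lborel (\<lambda>\<phi>. (\<integral>v. h v \<partial>Q) * indicator ?I \<phi>)"
        using \<phi>0 by (auto intro!: integrable_mult_right integrable_real_indicator)
      show "AE \<phi> in lborel. norm (\<integral>v. norm (case (\<phi>, v) of (\<phi>, v) \<Rightarrow> J \<phi> v) \<partial>Q) \<le> norm ((\<integral>v. h v \<partial>Q) * indicator ?I \<phi>)"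
      proof (rule AE_I2)
        fix \<phi>
        have "(\<integral>v. \<bar>J \<phi> v\<bar> \<partial>Q) \<le> (\<integral>v. h v * indicator ?I \<phi> \<partial>Q)"
          by (intro integral_mono integrable_abs Jint integrable_mult_left hi Jh)
        then show "norm (\<integral>v. norm (case (\<phi>, v) of (\<phi>, v) \<Rightarrow> J \<phi> v) \<partial>Q) \<le> norm ((\<integral>v. h v \<partial>Q) * indicator ?I \<phi>)"
          by (simp add: abs_mult h0 integral_nonneg)
      qed
    qed (use Jm in measurable)
  qed (use Jint in auto)
  have s0: "\<bar>smooth0 d f a b v\<bar> \<le> 1" for a b v
    unfolding smooth0_def by (rule abs_expectation_le[OF prob_space_std_gauss f_bound])
  have s0i: "integrable Q (\<lambda>v. smooth0 d f a b v)" for a b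
    by (rule Q.integrable_const_bound[where B=1]) (use s0 in auto)
  have end_eq: "smooth0 d f (cos (pi / 2)) (sin (pi / 2)) v = (\<integral>g. f g \<partial>std_gauss d)" for v
    unfolding smooth0_def
  proof (rule Bochner_Integration.integral_cong[OF refl])
    fix g assume "g \<in> space (std_gauss d)"
    then have "affine_vec d (cos (pi / 2)) v (sin (pi / 2)) g = g"
      by (auto simp: affine_vec_def space_PiM PiE_iff extensional_def fun_eq_iff restrict_def)
    then show "f (affine_vec d (cos (pi / 2)) v (sin (pi / 2)) g) = f g" by simp
  qed
  have "(\<integral>g. f g \<partial>std_gauss d) - (\<integral>v. smooth0 d f (cos \<phi>0) (sin \<phi>0) v \<partial>Q) =
      (\<integral>v. smooth0 d f (cos (pi / 2)) (sin (pi / 2)) v - smooth0 d f (cos \<phi>0) (sin \<phi>0) v \<partial>Q)"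
    unfolding end_eq using s0i by (simp add: Q.prob_space)
  also have "\<dots> = (\<integral>v. (\<integral>\<phi>. J \<phi> v \<partial>lborel) \<partial>Q)"
    unfolding J_def using \<phi>0 by (subst smooth0_increment) auto
  also have "\<dots> = (\<integral>\<phi>. (\<integral>v. J \<phi> v \<partial>Q) \<partial>lborel)"
    by (rule P.Fubini_integral[OF Ji])
  finally have eq: "(\<integral>g. f g \<partial>std_gauss d) - (\<integral>v. smooth0 d f (cos \<phi>0) (sin \<phi>0) v \<partial>Q) = (\<integral>\<phi>. (\<integral>v. J \<phi> v \<partial>Q) \<partial>lborel)" .
  have "isCont (\<lambda>\<phi>. K * (cos \<phi> / sin \<phi>)) \<phi>" if "\<phi> \<in> ?I" for \<phi>
    using sin[OF that] by (intro continuous_intros) auto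
  moreover have "((\<lambda>\<phi>. K * ln (sin \<phi>)) has_real_derivative K * (cos \<phi> / sin \<phi>)) (at \<phi>)" if "\<phi> \<in> ?I" for \<phi>
    using sin[OF that] by (auto intro!: derivative_eq_intros)
  ultimately have FTC: "has_bochner_integral lborel (\<lambda>\<phi>. K * (cos \<phi> / sin \<phi>) * indicator ?I \<phi>) (K * ln (sin (pi / 2)) - K * ln (sin \<phi>0))"
    using \<phi>0 by (intro has_bochner_integral_FTC_Icc_real) auto
  have "\<bar>\<integral>\<phi>. (\<integral>v. J \<phi> v \<partial>Q) \<partial>lborel\<bar> \<le> (\<integral>\<phi>. \<bar>\<integral>v. J \<phi> v \<partial>Q\<bar> \<partial>lborel)"
    by (rule integral_abs_bound)
  also have "\<dots> \<le> (\<integral>\<phi>. K * (cos \<phi> / sin \<phi>) * indicator ?I \<phi> \<partial>lborel)"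
  proof (rule integral_mono)
    show "integrable lborel (\<lambda>\<phi>. \<bar>\<integral>v. J \<phi> v \<partial>Q\<bar>)" by (intro integrable_abs P.integrable_fst Ji)
    show "integrable lborel (\<lambda>\<phi>. K * (cos \<phi> / sin \<phi>) * indicator ?I \<phi>)" using FTC by (simp add: has_bochner_integral_iff)
    show "\<bar>\<integral>v. J \<phi> v \<partial>Q\<bar> \<le> K * (cos \<phi> / sin \<phi>) * indicator ?I \<phi>" for \<phi>
      using le[of \<phi>] by (cases "\<phi> \<in> ?I") (auto simp: J_def)
  qed
  also have "\<dots> = - K * ln (sin \<phi>0)" using FTC by (simp add: has_bochner_integral_iff)
  also have "\<dots> = K * ln (1 / sin \<phi>0)" using sin[of \<phi>0] \<phi>0 by (simp add: ln_div)
  finally show ?thesis unfolding eq[symmetric] by linarith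
qed

section \<open>Spreading lattice points over unit cubes\<close>

text \<open>Half-open like the cells of \<open>round_box\<close>, so that a lattice point plus a
  cube variable rounds back to the lattice point.\<close>

definition unif_half :: "real measure" where
  "unif_half = density lborel (\<lambda>x. ennreal (indicator {-1/2..<1/2} x))"

definition cube_law :: "nat \<Rightarrow> (nat \<Rightarrow> real) measure" where
  "cube_law d = PiM {..<d} (\<lambda>_. unif_half)"

lemma sets_unif_half [simp, measurable_cong]: "sets unif_half = sets borel"
  by (simp add: unif_half_def)

lemma space_unif_half [simp]: "space unif_half = UNIV"
  by (simp add: unif_half_def)

lemma sets_cube_law [simp, measurable_cong]: "sets (cube_law d) = sets (vecs d)"
  unfolding cube_law_def by (intro sets_PiM_cong) auto

lemma space_cube_law [simp]: "space (cube_law d) = space (vecs d)"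
  by (rule sets_eq_imp_space_eq) simp

lemma prob_space_unif_half: "prob_space unif_half"
proof
  have "emeasure unif_half UNIV = (\<integral>\<^sup>+x. indicator {-1/2..<1/2 :: real} x \<partial>lborel)"
    unfolding unif_half_def by (subst emeasure_density) (auto simp: ennreal_indicator intro!: nn_integral_cong)
  then show "emeasure unif_half (space unif_half) = 1" by simp
qed

interpretation unif_half: prob_space unif_half
  by (rule prob_space_unif_half)

interpretation unif_half_product: product_sigma_finite "\<lambda>_::nat. unif_half"
  by standard

lemma prob_space_cube_law: "prob_space (cube_law d)"
  unfolding cube_law_def by (intro prob_space_PiM prob_space_unif_half)

lemma nn_integral_unif_half:
  "f \<in> borel_measurable borel \<Longrightarrow> (\<integral>\<^sup>+x. f x \<partial>unif_half) = (\<integral>\<^sup>+x. f x * indicator {-1/2..<1/2} x \<partial>lborel)"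
  unfolding unif_half_def by (subst nn_integral_density) (auto simp: ennreal_indicator mult.commute)

lemma distr_cube_law_component: "k < d \<Longrightarrow> distr (cube_law d) unif_half (\<lambda>u. u k) = unif_half"
  unfolding cube_law_def by (rule distr_PiM_component) (use prob_space_unif_half in auto)

lemma measurable_cube_law_component: "k < d \<Longrightarrow> (\<lambda>u. u k) \<in> measurable (cube_law d) unif_half"
  unfolding cube_law_def by (rule measurable_component_singleton) simp

lemma AE_unif_half: "AE x in unif_half. x \<in> {-1/2..<1/2}"
  unfolding unif_half_def by (subst AE_density) (auto simp: indicator_def)

lemma AE_cube_law:
  assumes "k < d"
  shows "AE u in cube_law d. u k \<in> {-1/2..<1/2}"
proof -
  have "AE x in distr (cube_law d) unif_half (\<lambda>u. u k). x \<in> {-1/2..<1/2}"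
    unfolding distr_cube_law_component[OF assms] by (rule AE_unif_half)
  then show ?thesis by (rule AE_distrD[OF measurable_cube_law_component[OF assms]])
qed

lemma AE_cube_law_abs: "AE u in cube_law d. \<forall>k<d. \<bar>u k\<bar> \<le> 1 / 2"
proof -
  have "AE u in cube_law d. \<forall>k\<in>{..<d}. u k \<in> {-1/2..<1/2}"
    by (rule AE_finite_allI, simp, rule AE_cube_law, simp)
  then show ?thesis by eventually_elim (force simp: abs_le_iff)
qed

lemma
  assumes k: "k < d"
  shows integrable_cube_law_coord: "integrable (cube_law d) (\<lambda>u. u k)"
    and integral_cube_law_coord: "(\<integral>u. u k \<partial>cube_law d) = 0"
proof -
  have i: "integrable unif_half (\<lambda>x. x)"
    by (rule unif_half.integrable_const_bound[where B="1/2"], use AE_unif_half in eventually_elim) auto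
  then show "integrable (cube_law d) (\<lambda>u. u k)"
    using integrable_distr[OF measurable_cube_law_component[OF k], of "\<lambda>x. x"] by (simp add: distr_cube_law_component[OF k])
  have "(\<integral>u. u k \<partial>cube_law d) = (\<integral>x. x \<partial>unif_half)"
    using integral_distr[OF measurable_cube_law_component[OF k], of "\<lambda>x. x"] by (simp add: distr_cube_law_component[OF k])
  also have "\<dots> = (\<integral>x. x * indicator {-1/2..<1/2} x \<partial>lborel)"
    unfolding unif_half_def by (subst integral_density) (auto simp: mult.commute)
  also have "\<dots> = (\<integral>x. x * indicator {-1/2..1/2} x \<partial>lborel)"
  proof (rule integral_cong_AE)
    have "AE x in lborel. x \<noteq> (1/2 :: real)" by (rule AE_lborel_singleton)
    then show "AE x in lborel. x * indicator {-1/2..<1/2} x = x * indicator {-1/2..1/2 :: real} x"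
      by eventually_elim (auto simp: indicator_def)
  qed auto
  also have "\<dots> = (1/2)\<^sup>2 / 2 - (-1/2)\<^sup>2 / (2::real)"
    by (rule integral_FTC_Icc_real) (auto intro!: derivative_eq_intros)
  finally show "(\<integral>u. u k \<partial>cube_law d) = 0" by simp
qed

text \<open>For uniform \<open>u\<close>, the variables \<open>\<rho> + u\<close> and \<open>round_shift \<rho> u + u\<close> have the same law: translating the
  unit interval by \<open>\<rho>\<close> amounts to moving its two pieces by integers.\<close>

definition round_shift :: "real \<Rightarrow> real \<Rightarrow> int" where
  "round_shift \<rho> u = \<lfloor>\<rho>\<rfloor> + (if u \<in> {-1/2..<frac \<rho> - 1/2} then 1 else 0)"

lemma round_shift_0 [simp]: "round_shift 0 u = 0"
  by (simp add: round_shift_def)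

lemma abs_round_shift_le: "\<bar>real_of_int (round_shift \<rho> u)\<bar> \<le> \<bar>\<rho>\<bar> + 1"
  unfolding round_shift_def by (simp add: frac_def) linarith

lemma measurable_round_shift [measurable]: "(\<lambda>u. real_of_int (round_shift \<rho> u)) \<in> borel_measurable borel"
  unfolding round_shift_def by measurable

lemma distr_unif_half_shift:
  "distr unif_half borel (\<lambda>u. \<rho> + u) = distr unif_half borel (\<lambda>u. real_of_int (round_shift \<rho> u) + u)"
proof (rule measure_eqI)
  fix A assume "A \<in> sets (distr unif_half borel (\<lambda>u. \<rho> + u))"
  then have A[measurable]: "A \<in> sets borel" by simp
  define r n where "r = frac \<rho>" and "n = real_of_int \<lfloor>\<rho>\<rfloor>"
  have \<rho>: "\<rho> = n + r" by (simp add: r_def n_def frac_def)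
  have r: "0 \<le> r" "r < 1" by (simp_all add: r_def frac_ge_0 frac_lt_1)
  have "emeasure (distr unif_half borel (\<lambda>u. \<rho> + u)) A = (\<integral>\<^sup>+u. indicator A (\<rho> + u) \<partial>unif_half)"
    by (simp add: nn_integral_indicator[symmetric] nn_integral_distr del: nn_integral_indicator)
  also have "\<dots> = (\<integral>\<^sup>+u. indicator A (\<rho> + u) * indicator {-1/2..<1/2} u \<partial>lborel)"
    by (rule nn_integral_unif_half) measurable
  \<comment> \<open>The interval is cut at 1/2 - r. To the left of the cut \<rho> + u is n plus the
    uniform variable u + r, to the right it is n + 1 plus u + r - 1; the two images fill the
    interval again.\<close>
  also have "\<dots> = (\<integral>\<^sup>+u. indicator A (\<rho> + u) * indicator {-1/2..<1/2-r} u + indicator A (\<rho> + u) * indicator {1/2-r..<1/2} u \<partial>lborel)"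
    by (intro nn_integral_cong) (use r in \<open>auto simp: indicator_def\<close>)
  also have "\<dots> = (\<integral>\<^sup>+u. indicator A (\<rho> + u) * indicator {-1/2..<1/2-r} u \<partial>lborel) + (\<integral>\<^sup>+u. indicator A (\<rho> + u) * indicator {1/2-r..<1/2} u \<partial>lborel)"
    by (rule nn_integral_add) auto
  also have "(\<integral>\<^sup>+u. indicator A (\<rho> + u) * indicator {-1/2..<1/2-r} u \<partial>lborel) = (\<integral>\<^sup>+u. indicator A (n + u) * indicator {r-1/2..<1/2} u \<partial>lborel)"
    by (subst nn_integral_real_affine[where c=1 and t="-r"]) (auto simp: \<rho> indicator_def algebra_simps intro!: nn_integral_cong)
  also have "(\<integral>\<^sup>+u. indicator A (\<rho> + u) * indicator {1/2-r..<1/2} u \<partial>lborel) = (\<integral>\<^sup>+u. indicator A (n + 1 + u) * indicator {-1/2..<r-1/2} u \<partial>lborel)"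
    by (subst nn_integral_real_affine[where c=1 and t="1-r"]) (auto simp: \<rho> indicator_def algebra_simps intro!: nn_integral_cong)
  also have "(\<integral>\<^sup>+u. indicator A (n + u) * indicator {r-1/2..<1/2} u \<partial>lborel) + (\<integral>\<^sup>+u. indicator A (n + 1 + u) * indicator {-1/2..<r-1/2} u \<partial>lborel) =
      (\<integral>\<^sup>+u. indicator A (n + u) * indicator {r-1/2..<1/2} u + indicator A (n + 1 + u) * indicator {-1/2..<r-1/2} u \<partial>lborel)"
    by (rule nn_integral_add[symmetric]) auto
  also have "\<dots> = (\<integral>\<^sup>+u. indicator A (real_of_int (round_shift \<rho> u) + u) * indicator {-1/2..<1/2} u \<partial>lborel)"
    by (intro nn_integral_cong) (use r in \<open>auto simp: indicator_def round_shift_def r_def[symmetric] n_def[symmetric]\<close>)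
  also have "\<dots> = (\<integral>\<^sup>+u. indicator A (real_of_int (round_shift \<rho> u) + u) \<partial>unif_half)"
    by (rule nn_integral_unif_half[symmetric]) measurable
  also have "\<dots> = emeasure (distr unif_half borel (\<lambda>u. real_of_int (round_shift \<rho> u) + u)) A"
    by (simp add: nn_integral_indicator[symmetric] nn_integral_distr del: nn_integral_indicator)
  finally show "emeasure (distr unif_half borel (\<lambda>u. \<rho> + u)) A = emeasure (distr unif_half borel (\<lambda>u. real_of_int (round_shift \<rho> u) + u)) A" .
qed simp

lemma distr_cube_law_coordinatewise:
  assumes h: "\<And>i. i < d \<Longrightarrow> h i \<in> borel_measurable borel" and h': "\<And>i. i < d \<Longrightarrow> h' i \<in> borel_measurable borel"
    and eq: "\<And>i. i < d \<Longrightarrow> distr unif_half borel (h i) = distr unif_half borel (h' i)"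
  shows "distr (cube_law d) (vecs d) (\<lambda>u. \<lambda>i\<in>{..<d}. h i (u i)) = distr (cube_law d) (vecs d) (\<lambda>u. \<lambda>i\<in>{..<d}. h' i (u i))"
proof -
  have main: "distr (cube_law d) (vecs d) (\<lambda>u. \<lambda>i\<in>{..<d}. h i (u i)) = PiM {..<d} (\<lambda>i. if i < d then distr unif_half borel (h i) else unif_half)"
    if h[measurable]: "\<And>i. i < d \<Longrightarrow> h i \<in> borel_measurable borel" for h
  proof -
    \<comment> \<open>\<open>h i\<close> is known to be measurable only below \<open>d\<close>; the
      default \<open>unif_half\<close> makes the family consist of probability measures at every
      index.\<close>
    let ?N = "\<lambda>i. if i < d then distr unif_half borel (h i) else unif_half"
    have pN: "prob_space (?N i)" for i
      using h[of i] prob_space_unif_half by (auto intro!: unif_half.prob_space_distr)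
    interpret N: product_sigma_finite ?N
      by (rule product_sigma_finite.intro) (use pN prob_space_imp_sigma_finite in blast)
    have T: "(\<lambda>u. \<lambda>i\<in>{..<d}. h i (u i)) \<in> measurable (cube_law d) (vecs d)"
    proof (rule measurable_restrict)
      fix i assume i: "i \<in> {..<d}"
      then have "(\<lambda>u. u i) \<in> measurable (cube_law d) borel" using measurable_cube_law_component[of i d] by (simp cong: measurable_cong_sets)
      then show "(\<lambda>u. h i (u i)) \<in> borel_measurable (cube_law d)" by (rule measurable_compose) (use i h in simp)
    qed
    show ?thesis
    proof (rule N.PiM_eqI)
      show "sets (distr (cube_law d) (vecs d) (\<lambda>u. \<lambda>i\<in>{..<d}. h i (u i))) = sets (PiM {..<d} ?N)"
        by (simp, intro sets_PiM_cong) auto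
      fix A assume A: "\<And>i. i \<in> {..<d} \<Longrightarrow> A i \<in> sets (?N i)"
      then have A': "A i \<in> sets borel" if "i < d" for i using that by force
      have "emeasure (distr (cube_law d) (vecs d) (\<lambda>u. \<lambda>i\<in>{..<d}. h i (u i))) (Pi\<^sub>E {..<d} A) =
          emeasure (cube_law d) ((\<lambda>u. \<lambda>i\<in>{..<d}. h i (u i)) -` (Pi\<^sub>E {..<d} A) \<inter> space (cube_law d))"
        by (rule emeasure_distr[OF T]) (use A' in \<open>auto intro!: sets_PiM_I_finite\<close>)
      also have "(\<lambda>u. \<lambda>i\<in>{..<d}. h i (u i)) -` (Pi\<^sub>E {..<d} A) \<inter> space (cube_law d) = Pi\<^sub>E {..<d} (\<lambda>i. h i -` A i)"
        by (auto simp: space_PiM PiE_iff)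
      also have "emeasure (cube_law d) (Pi\<^sub>E {..<d} (\<lambda>i. h i -` A i)) = (\<Prod>i<d. emeasure unif_half (h i -` A i))"
        unfolding cube_law_def
        by (rule unif_half_product.emeasure_PiM) (use A' h measurable_sets[of "h _" borel borel] in \<open>auto\<close>)
      also have "\<dots> = (\<Prod>i<d. emeasure (?N i) (A i))"
        by (intro prod.cong refl) (use A' h in \<open>simp add: emeasure_distr\<close>)
      finally show "emeasure (distr (cube_law d) (vecs d) (\<lambda>u. \<lambda>i\<in>{..<d}. h i (u i))) (Pi\<^sub>E {..<d} A) = (\<Prod>i<d. emeasure (?N i) (A i))" .
    qed simp
  qed
  have "PiM {..<d} (\<lambda>i. if i < d then distr unif_half borel (h i) else unif_half) =
      PiM {..<d} (\<lambda>i. if i < d then distr unif_half borel (h' i) else unif_half)"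
    using eq by (intro PiM_cong) auto
  then show ?thesis using main[of h] main[of h'] h h' by simp
qed

lemma integral_cube_law_shift:
  fixes k :: "(nat \<Rightarrow> real) \<Rightarrow> real"
  assumes k[measurable]: "k \<in> borel_measurable (vecs d)"
  shows "(\<integral>u. k (\<lambda>i\<in>{..<d}. x i + \<rho> i + u i) \<partial>cube_law d) =
    (\<integral>u. k (\<lambda>i\<in>{..<d}. x i + real_of_int (round_shift (\<rho> i) (u i)) + u i) \<partial>cube_law d)"
proof -
  have [measurable]: "(\<lambda>u. u i) \<in> borel_measurable (cube_law d)" if "i < d" for i
    using measurable_cube_law_component[OF that] by (simp cong: measurable_cong_sets)
  have T[measurable]: "(\<lambda>u. \<lambda>i\<in>{..<d}. \<rho> i + u i) \<in> measurable (cube_law d) (vecs d)"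
    "(\<lambda>u. \<lambda>i\<in>{..<d}. real_of_int (round_shift (\<rho> i) (u i)) + u i) \<in> measurable (cube_law d) (vecs d)"
    by measurable
  have km[measurable]: "(\<lambda>v. k (\<lambda>i\<in>{..<d}. x i + v i)) \<in> borel_measurable (vecs d)"
    by (rule measurable_compose[OF _ k]) measurable
  have "(\<integral>u. k (\<lambda>i\<in>{..<d}. x i + \<rho> i + u i) \<partial>cube_law d) = (\<integral>u. k (\<lambda>i\<in>{..<d}. x i + (\<lambda>i\<in>{..<d}. \<rho> i + u i) i) \<partial>cube_law d)"
    by (intro Bochner_Integration.integral_cong refl arg_cong[where f=k] restrict_ext) (simp add: add.assoc)
  also have "\<dots> = (\<integral>v. k (\<lambda>i\<in>{..<d}. x i + v i) \<partial>distr (cube_law d) (vecs d) (\<lambda>u. \<lambda>i\<in>{..<d}. \<rho> i + u i))"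
    by (rule integral_distr[symmetric]) measurable
  also have "distr (cube_law d) (vecs d) (\<lambda>u. \<lambda>i\<in>{..<d}. \<rho> i + u i) =
      distr (cube_law d) (vecs d) (\<lambda>u. \<lambda>i\<in>{..<d}. real_of_int (round_shift (\<rho> i) (u i)) + u i)"
    by (rule distr_cube_law_coordinatewise[of d "\<lambda>i u. \<rho> i + u" "\<lambda>i u. real_of_int (round_shift (\<rho> i) u) + u"])
       (use distr_unif_half_shift in auto)
  also have "(\<integral>v. k (\<lambda>i\<in>{..<d}. x i + v i) \<partial>\<dots>) =
      (\<integral>u. k (\<lambda>i\<in>{..<d}. x i + (\<lambda>i\<in>{..<d}. real_of_int (round_shift (\<rho> i) (u i)) + u i) i) \<partial>cube_law d)"
    by (rule integral_distr) measurable
  also have "\<dots> = (\<integral>u. k (\<lambda>i\<in>{..<d}. x i + real_of_int (round_shift (\<rho> i) (u i)) + u i) \<partial>cube_law d)"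
    by (intro Bochner_Integration.integral_cong refl arg_cong[where f=k] restrict_ext) (simp add: add.assoc)
  finally show ?thesis .
qed

section \<open>Insensitivity of a lattice law to translations\<close>

definition int_unit :: "nat \<Rightarrow> nat \<Rightarrow> int" where
  "int_unit j = (\<lambda>k. if k = j then 1 else 0)"

text \<open>A total variation bound \<open>T\<close> between \<open>p\<close> and its unit
  translates, in dual form; a function bounded by \<open>M\<close> oscillates by at most 2 M, whence
  the factor.\<close>

definition shift_smooth :: "nat \<Rightarrow> real \<Rightarrow> (nat \<Rightarrow> int) pmf \<Rightarrow> bool" where
  "shift_smooth d T p \<longleftrightarrow> (\<forall>j<d. \<forall>M f. (\<forall>x. \<bar>f x\<bar> \<le> M) \<longrightarrow>
     \<bar>(\<integral>w. f (w + int_unit j) \<partial>measure_pmf p) - (\<integral>w. f w \<partial>measure_pmf p)\<bar> \<le> 2 * M * T)"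

text \<open>Unit steps telescope, and a negative multiple is a positive one applied to the
  translated function.\<close>

lemma shift_smooth_multiple:
  assumes p: "shift_smooth d T p" and j: "j < d" and M: "\<And>x. \<bar>f x\<bar> \<le> M"
  shows "\<bar>(\<integral>w. f (w + (\<lambda>k. if k = j then c else 0)) \<partial>measure_pmf p) - (\<integral>w. f w \<partial>measure_pmf p)\<bar> \<le> 2 * M * T * \<bar>real_of_int c\<bar>"
proof -
  let ?e = "\<lambda>c k. if k = j then c else (0::int)"
  have nat: "\<bar>(\<integral>w. f (w + ?e (int n)) \<partial>measure_pmf p) - (\<integral>w. f w \<partial>measure_pmf p)\<bar> \<le> 2 * M * T * real n" if M: "\<And>x. \<bar>f x\<bar> \<le> M" for n f
  proof (induction n)
    case 0
    have "w + ?e (int 0) = w" for w by (simp add: fun_eq_iff)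
    then show ?case by simp
  next
    case (Suc n)
    have "w + ?e (int (Suc n)) = w + int_unit j + ?e (int n)" for w by (simp add: fun_eq_iff int_unit_def)
    then have "\<bar>(\<integral>w. f (w + ?e (int (Suc n))) \<partial>measure_pmf p) - (\<integral>w. f (w + ?e (int n)) \<partial>measure_pmf p)\<bar> \<le> 2 * M * T"
      using p[unfolded shift_smooth_def, rule_format, OF j, of "\<lambda>w. f (w + ?e (int n))" M] M by (simp add: add.assoc)
    moreover have "2 * M * T * real (Suc n) = 2 * M * T + 2 * M * T * real n" by (simp add: algebra_simps)
    ultimately show ?case using Suc.IH by linarith
  qed
  show ?thesis
  proof (cases "0 \<le> c")
    case True
    then have "int (nat c) = c" by simp
    then show ?thesis using nat[where f=f and n="nat c", OF M] True by (simp only: of_nat_nat abs_of_nonneg of_int_0_le_iff)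
  next
    case False
    then obtain n where n: "c = - int n" by (metis int_cases2 int_nat_eq minus_minus nat_le_iff nle_le of_nat_0_le_iff)
    have "w + ?e (int n) + ?e c = w" for w by (simp add: fun_eq_iff n)
    then have "\<bar>(\<integral>w. f w \<partial>measure_pmf p) - (\<integral>w. f (w + ?e c) \<partial>measure_pmf p)\<bar> \<le> 2 * M * T * real n"
      using nat[where f="\<lambda>w. f (w + ?e c)" and n=n, OF M] by (simp only:)
    moreover have "\<bar>real_of_int c\<bar> = real n" by (simp add: n)
    ultimately show ?thesis by (simp only: abs_minus_commute)
  qed
qed

text \<open>The coordinates are moved one after the other, so the cost is proportional to the l1
  length of the translation.\<close>

lemma shift_smooth_vec:
  assumes p: "shift_smooth d T p" and M: "\<And>x. \<bar>f x\<bar> \<le> M"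
  shows "d' \<le> d \<Longrightarrow> \<bar>(\<integral>w. f (w + (\<lambda>k. if k < d' then n k else 0)) \<partial>measure_pmf p) - (\<integral>w. f w \<partial>measure_pmf p)\<bar>
    \<le> 2 * M * T * (\<Sum>j<d'. \<bar>real_of_int (n j)\<bar>)"
proof (induction d')
  case 0
  have "w + (\<lambda>k. if k < 0 then n k else 0) = w" for w by (simp add: fun_eq_iff)
  then show ?case by simp
next
  case (Suc d')
  let ?n = "\<lambda>d' k. if k < d' then n k else 0"
  have "w + ?n (Suc d') = w + (\<lambda>k. if k = d' then n d' else 0) + ?n d'" for w
    by (auto simp: fun_eq_iff less_Suc_eq)
  then have "\<bar>(\<integral>w. f (w + ?n (Suc d')) \<partial>measure_pmf p) - (\<integral>w. f (w + ?n d') \<partial>measure_pmf p)\<bar> \<le> 2 * M * T * \<bar>real_of_int (n d')\<bar>"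
    using shift_smooth_multiple[OF p, of d' "\<lambda>w. f (w + ?n d')" M "n d'"] Suc.prems M by (simp add: add.assoc)
  moreover have "2 * M * T * (\<Sum>j<Suc d'. \<bar>real_of_int (n j)\<bar>) =
      2 * M * T * (\<Sum>j<d'. \<bar>real_of_int (n j)\<bar>) + 2 * M * T * \<bar>real_of_int (n d')\<bar>" by (simp add: algebra_simps)
  moreover have "\<bar>(\<integral>w. f (w + ?n d') \<partial>measure_pmf p) - (\<integral>w. f w \<partial>measure_pmf p)\<bar> \<le> 2 * M * T * (\<Sum>j<d'. \<bar>real_of_int (n j)\<bar>)"
    by (rule Suc.IH) (use Suc.prems in simp)
  ultimately show ?case by linarith
qed

definition rvec :: "(nat \<Rightarrow> int) \<Rightarrow> nat \<Rightarrow> real" where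
  "rvec w i = real_of_int (w i)"

lemma measurable_pmf_rvec [measurable]: "(\<lambda>z. rvec (fst z) i) \<in> borel_measurable (measure_pmf p \<Otimes>\<^sub>M N)"
  by (rule measurable_compose[OF measurable_fst]) simp

lemma measurable_cube_snd [measurable]:
  "k < d \<Longrightarrow> (\<lambda>z. snd z k) \<in> borel_measurable (N \<Otimes>\<^sub>M cube_law d)"
  by (rule measurable_compose[OF measurable_snd])
     (use measurable_cube_law_component[of k d] in \<open>simp cong: measurable_cong_sets\<close>)

text \<open>Given the cube variable, the real translation \<rho> acts like an integer translation of
  size at most |\<rho>_j| + 1 in coordinate j. A coordinate with \<rho>_j = 0 must cost nothing, for
  otherwise every coordinate would contribute its rounding.\<close>

lemma shift_smooth_cube:
  fixes k :: "(nat \<Rightarrow> real) \<Rightarrow> real"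
  assumes p: "shift_smooth d T p" "0 \<le> T" and k[measurable]: "k \<in> borel_measurable (vecs d)" and M: "\<And>x. \<bar>k x\<bar> \<le> M"
  shows "\<bar>(\<integral>w. \<integral>u. k (\<lambda>i\<in>{..<d}. rvec w i + y i + rvec n i + \<rho> i + u i) \<partial>cube_law d \<partial>measure_pmf p)
      - (\<integral>w. \<integral>u. k (\<lambda>i\<in>{..<d}. rvec w i + y i + u i) \<partial>cube_law d \<partial>measure_pmf p)\<bar>
    \<le> 2 * M * T * (\<Sum>j<d. \<bar>rvec n j\<bar> + (if \<rho> j = 0 then 0 else \<bar>\<rho> j\<bar> + 1))"
proof -
  interpret U: prob_space "cube_law d" by (rule prob_space_cube_law)
  interpret W: prob_space "measure_pmf p" by (rule prob_space_measure_pmf)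
  interpret P: pair_prob_space "measure_pmf p" "cube_law d" ..
  have M0: "0 \<le> M" using M[of undefined] by linarith
  define g where "g N w u = k (\<lambda>i\<in>{..<d}. rvec w i + y i + rvec (N u) i + u i)" for N :: "(nat \<Rightarrow> real) \<Rightarrow> nat \<Rightarrow> int" and w u
  define N where "N u = (\<lambda>i. n i + round_shift (\<rho> i) (u i))" for u
  have Nm: "(\<lambda>z. rvec (N (snd z)) i) \<in> borel_measurable (measure_pmf p \<Otimes>\<^sub>M cube_law d)" if "i < d" for i
    using that unfolding rvec_def N_def of_int_add by measurable
  have gi: "integrable (measure_pmf p \<Otimes>\<^sub>M cube_law d) (\<lambda>(w, u). g N w u)"
    if "\<And>i. i < d \<Longrightarrow> (\<lambda>z. rvec (N (snd z)) i) \<in> borel_measurable (measure_pmf p \<Otimes>\<^sub>M cube_law d)" for N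
  proof (rule P.integrable_const_bound[where B=M])
    note [measurable] = that
    have "(\<lambda>z. \<lambda>i\<in>{..<d}. rvec (fst z) i + y i + rvec (N (snd z)) i + snd z i) \<in> measurable (measure_pmf p \<Otimes>\<^sub>M cube_law d) (vecs d)"
      by measurable
    from measurable_compose[OF this k] show "(\<lambda>(w, u). g N w u) \<in> borel_measurable (measure_pmf p \<Otimes>\<^sub>M cube_law d)"
      by (simp add: g_def case_prod_beta)
  qed (use M in \<open>auto simp: g_def\<close>)
  have giN: "integrable (measure_pmf p \<Otimes>\<^sub>M cube_law d) (\<lambda>(w, u). g N w u)"
    "integrable (measure_pmf p \<Otimes>\<^sub>M cube_law d) (\<lambda>(w, u). g (\<lambda>_. 0) w u)"
    by (intro gi Nm; simp add: rvec_def)+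
  have e1: "(\<integral>w. \<integral>u. k (\<lambda>i\<in>{..<d}. rvec w i + y i + rvec n i + \<rho> i + u i) \<partial>cube_law d \<partial>measure_pmf p) = (\<integral>w. \<integral>u. g N w u \<partial>cube_law d \<partial>measure_pmf p)"
    by (subst integral_cube_law_shift[OF k]) (simp add: g_def[abs_def] N_def rvec_def add.assoc)
  \<comment> \<open>The rounded translation depends on u, so u goes to the outer integral and the
    lattice estimate is used for each fixed u.\<close>
  also have "\<dots> = (\<integral>u. \<integral>w. g N w u \<partial>measure_pmf p \<partial>cube_law d)"
    by (rule P.Fubini_integral[OF giN(1), symmetric])
  finally have e1: "(\<integral>w. \<integral>u. k (\<lambda>i\<in>{..<d}. rvec w i + y i + rvec n i + \<rho> i + u i) \<partial>cube_law d \<partial>measure_pmf p) = \<dots>" .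
  have "(\<integral>w. \<integral>u. k (\<lambda>i\<in>{..<d}. rvec w i + y i + u i) \<partial>cube_law d \<partial>measure_pmf p) = (\<integral>w. \<integral>u. g (\<lambda>_. 0) w u \<partial>cube_law d \<partial>measure_pmf p)"
    by (simp add: g_def rvec_def)
  also have "\<dots> = (\<integral>u. \<integral>w. g (\<lambda>_. 0) w u \<partial>measure_pmf p \<partial>cube_law d)"
    by (rule P.Fubini_integral[OF giN(2), symmetric])
  finally have e2: "(\<integral>w. \<integral>u. k (\<lambda>i\<in>{..<d}. rvec w i + y i + u i) \<partial>cube_law d \<partial>measure_pmf p) = \<dots>" .
  have "(\<integral>u. \<integral>w. g N w u \<partial>measure_pmf p \<partial>cube_law d) - (\<integral>u. \<integral>w. g (\<lambda>_. 0) w u \<partial>measure_pmf p \<partial>cube_law d) =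
      (\<integral>u. (\<integral>w. g N w u \<partial>measure_pmf p) - (\<integral>w. g (\<lambda>_. 0) w u \<partial>measure_pmf p) \<partial>cube_law d)"
    by (intro Bochner_Integration.integral_diff[symmetric] P.integrable_snd giN)
  also have "\<bar>\<dots>\<bar> \<le> 2 * M * T * (\<Sum>j<d. \<bar>rvec n j\<bar> + (if \<rho> j = 0 then 0 else \<bar>\<rho> j\<bar> + 1))"
  proof (rule abs_expectation_le[OF prob_space_cube_law])
    fix u
    define F where "F w = k (\<lambda>i\<in>{..<d}. rvec w i + y i + u i)" for w
    have "g N w u = F (w + (\<lambda>k. if k < d then N u k else 0))" for w
      unfolding g_def F_def by (intro arg_cong[where f=k] restrict_ext) (simp add: rvec_def)
    moreover have "g (\<lambda>_. 0) w u = F w" for w by (simp add: g_def F_def rvec_def)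
    ultimately have "\<bar>(\<integral>w. g N w u \<partial>measure_pmf p) - (\<integral>w. g (\<lambda>_. 0) w u \<partial>measure_pmf p)\<bar> \<le> 2 * M * T * (\<Sum>j<d. \<bar>real_of_int (N u j)\<bar>)"
      using shift_smooth_vec[OF p(1), of F M d "N u"] M by (simp add: F_def)
    also have "\<dots> \<le> 2 * M * T * (\<Sum>j<d. \<bar>rvec n j\<bar> + (if \<rho> j = 0 then 0 else \<bar>\<rho> j\<bar> + 1))"
    proof (intro mult_left_mono sum_mono)
      fix j
      show "\<bar>real_of_int (N u j)\<bar> \<le> \<bar>rvec n j\<bar> + (if \<rho> j = 0 then 0 else \<bar>\<rho> j\<bar> + 1)"
        using abs_round_shift_le[of "\<rho> j" "u j"] by (auto simp: N_def rvec_def)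
    qed (use M0 p(2) in simp)
    finally show "\<bar>(\<integral>w. g N w u \<partial>measure_pmf p) - (\<integral>w. g (\<lambda>_. 0) w u \<partial>measure_pmf p)\<bar> \<le> 2 * M * T * (\<Sum>j<d. \<bar>rvec n j\<bar> + (if \<rho> j = 0 then 0 else \<bar>\<rho> j\<bar> + 1))" .
  qed
  finally show ?thesis unfolding e1 e2 .
qed

section \<open>Exchangeable pairs\<close>

lemma rvec_add: "rvec (x + y) i = rvec x i + rvec y i" by (simp add: rvec_def)
lemma rvec_diff: "rvec (x - y) i = rvec x i - rvec y i" by (simp add: rvec_def fun_diff_def)

lemma smooth_cong:
  assumes "\<And>i. i < d \<Longrightarrow> x i = x' i"
  shows "smooth0 d f a b x = smooth0 d f a b x'" "smooth1 d f a b x = smooth1 d f a b x'"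
    "smooth2 d f a b x = smooth2 d f a b x'" "smooth_hess d f a b x = smooth_hess d f a b x'"
proof -
  have "affine_vec d a x b g = affine_vec d a x' b g" for g
    unfolding affine_vec_def using assms by (intro restrict_ext) auto
  then show "smooth0 d f a b x = smooth0 d f a b x'" "smooth1 d f a b x = smooth1 d f a b x'"
    "smooth2 d f a b x = smooth2 d f a b x'" "smooth_hess d f a b x = smooth_hess d f a b x'"
    by (simp_all only: smooth0_def smooth1_def[abs_def] smooth2_def[abs_def] smooth_hess_def[abs_def])
qed

definition std_vec :: "nat \<Rightarrow> (nat \<Rightarrow> nat \<Rightarrow> real) \<Rightarrow> (nat \<Rightarrow> real) \<Rightarrow> (nat \<Rightarrow> real) \<Rightarrow> nat \<Rightarrow> real" where
  "std_vec d A mu x = (\<lambda>i\<in>{..<d}. mat_vec d A (\<lambda>j. x j - mu j) i)"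

lemma measurable_std_vec [measurable]: "std_vec d A mu \<in> measurable (vecs d) (vecs d)"
  unfolding std_vec_def mat_vec_def by measurable

lemma std_vec_cong: "(\<And>i. i < d \<Longrightarrow> x i = x' i) \<Longrightarrow> std_vec d A mu x = std_vec d A mu x'"
  unfolding std_vec_def mat_vec_def by (intro restrict_ext sum.cong) auto

lemma std_vec_restrict [simp]: "std_vec d A mu (\<lambda>i\<in>{..<d}. x i) = std_vec d A mu x"
  by (rule std_vec_cong) simp

lemma std_vec_add: "i < d \<Longrightarrow> std_vec d A mu (\<lambda>j. x j + t * y j) i = std_vec d A mu x i + t * mat_vec d A y i"
  by (simp add: std_vec_def mat_vec_def sum.distrib[symmetric] sum_distrib_left algebra_simps)

lemma mat_vec_diff: "mat_vec d A (\<lambda>j. x j - y j) i = mat_vec d A x i - mat_vec d A y i"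
  by (simp add: mat_vec_def right_diff_distrib sum_subtractf)

context bounded_test
begin

lemma smooth_hess_measurable:
  assumes [measurable]: "X \<in> measurable N (vecs d)"
  shows "(\<lambda>w. smooth_hess d f a b (X w) y) \<in> borel_measurable N"
  unfolding smooth_hess_def by measurable

lemma smooth1_increment_bound:
  assumes "0 < b" "0 \<le> a"
  shows "\<bar>\<Sum>k<d. y k * (smooth1 d f a b (\<lambda>i. x i + y i) k - smooth1 d f a b x k)\<bar> \<le> a / b * (2 * (\<Sum>k<d. (y k)\<^sup>2))"
proof -
  let ?B = "a / b * (2 * (\<Sum>k<d. (y k)\<^sup>2))"
  have B: "\<bar>a / b * smooth_hess d f a b (\<lambda>i. x i + t * y i) y\<bar> \<le> ?B" for t
    unfolding abs_mult using assms smooth_hess_bound[of a b "\<lambda>i. x i + t * y i" y] by (intro mult_mono) auto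
  have i: "integrable lborel (\<lambda>t. ?B * indicator {0..1::real} t)"
    by (intro integrable_mult_right integrable_real_indicator) auto
  have "\<bar>\<integral>t. a / b * smooth_hess d f a b (\<lambda>i. x i + t * y i) y * indicator {0..1} t \<partial>lborel\<bar> \<le>
      (\<integral>t. \<bar>a / b * smooth_hess d f a b (\<lambda>i. x i + t * y i) y * indicator {0..1} t\<bar> \<partial>lborel)"
    by (rule integral_abs_bound)
  also have "\<dots> \<le> (\<integral>t. ?B * indicator {0..1::real} t \<partial>lborel)"
  proof (rule integral_mono_AE')
    show "AE t in lborel. \<bar>a / b * smooth_hess d f a b (\<lambda>i. x i + t * y i) y * indicator {0..1} t\<bar> \<le> ?B * indicator {0..1::real} t"
    proof (rule AE_I2)
      fix t :: real
      show "\<bar>a / b * smooth_hess d f a b (\<lambda>i. x i + t * y i) y * indicator {0..1} t\<bar> \<le> ?B * indicator {0..1} t"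
        using B[of t] by (cases "t \<in> {0..1}") simp_all
    qed
    show "AE t in lborel. 0 \<le> ?B * indicator {0..1::real} t"
      using assms by (intro AE_I2 mult_nonneg_nonneg divide_nonneg_nonneg sum_nonneg) auto
    show "integrable lborel (\<lambda>t. ?B * indicator {0..1::real} t)" by (rule i)
  qed
  also have "\<dots> = ?B" by simp
  finally show ?thesis unfolding smooth1_increment[OF assms(1)] .
qed

end

text \<open>In use a = cos \<phi> and b = sin \<phi>, so \<open>a / b\<close> is the cotangent, and
  \<open>A\<close> is the whitening matrix.\<close>

locale cube_test = bounded_test +
  fixes a b :: real and A :: "nat \<Rightarrow> nat \<Rightarrow> real" and mu :: "nat \<Rightarrow> real"
  assumes ab: "0 \<le> a" "0 < b"
begin

definition avg1 :: "(nat \<Rightarrow> int) \<Rightarrow> nat \<Rightarrow> real" where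
  "avg1 w k = (\<integral>u. smooth1 d f a b (std_vec d A mu (\<lambda>i. rvec w i + u i)) k \<partial>cube_law d)"

definition avg2 :: "(nat \<Rightarrow> int) \<Rightarrow> nat \<Rightarrow> nat \<Rightarrow> real" where
  "avg2 w k l = (\<integral>u. smooth2 d f a b (std_vec d A mu (\<lambda>i. rvec w i + u i)) k l \<partial>cube_law d)"

definition avg_hess :: "(nat \<Rightarrow> int) \<Rightarrow> (nat \<Rightarrow> real) \<Rightarrow> real" where
  "avg_hess w y = (\<integral>u. smooth_hess d f a b (std_vec d A mu (\<lambda>i. rvec w i + u i)) y \<partial>cube_law d)"

lemma measurable_std_vec_cube [measurable]:
  "(\<lambda>u. std_vec d A mu (\<lambda>i. x i + u i)) \<in> measurable (cube_law d) (vecs d)"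
proof -
  have "(\<lambda>u. \<lambda>i\<in>{..<d}. x i + u i) \<in> measurable (vecs d) (vecs d)" by measurable
  from measurable_compose[OF this measurable_std_vec] show ?thesis by simp
qed

lemma avg1_bound: "k < d \<Longrightarrow> \<bar>avg1 w k\<bar> \<le> 1"
  unfolding avg1_def by (rule abs_expectation_le[OF prob_space_cube_law]) (rule smooth1_bound)

lemma smooth2_bound: "k < d \<Longrightarrow> l < d \<Longrightarrow> \<bar>smooth2 d f a' b' x k l\<bar> \<le> 2"
proof -
  assume kl: "k < d" "l < d"
  interpret prob_space "std_gauss d" by (rule prob_space_std_gauss)
  have "\<bar>smooth2 d f a' b' x k l\<bar> \<le> (\<integral>g. (g k * g k + g l * g l) / 2 + 1 \<partial>std_gauss d)"
    unfolding smooth2_def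
  proof (rule abs_integral_test_mult_le)
    show "integrable (std_gauss d) (\<lambda>g. g k * g l - (if k = l then 1 else 0))" "integrable (std_gauss d) (\<lambda>g. (g k * g k + g l * g l) / 2 + 1)"
      using std_gauss_integrable_mult kl by auto
    fix g :: "nat \<Rightarrow> real"
    have "\<bar>g k * g l\<bar> \<le> (g k * g k + g l * g l) / 2"
      using zero_le_power2[of "\<bar>g k\<bar> - \<bar>g l\<bar>"] by (simp add: power2_eq_square abs_mult algebra_simps)
    moreover have "\<bar>w - (if k = l then 1 else 0)\<bar> \<le> \<bar>w\<bar> + 1" for w :: real
      by (cases "k = l") auto
    note this[of "g k * g l"]
    ultimately show "\<bar>g k * g l - (if k = l then 1 else 0)\<bar> \<le> (g k * g k + g l * g l) / 2 + 1" by linarith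
  qed
  also have "\<dots> = 2" using kl by (simp add: std_gauss_integrable_mult std_gauss_cov)
  finally show ?thesis .
qed

lemma integrable_cube_bounded:
  assumes "h \<in> borel_measurable (cube_law d)" "\<And>u. \<bar>h u\<bar> \<le> (M :: real)"
  shows "integrable (cube_law d) h"
proof -
  interpret prob_space "cube_law d" by (rule prob_space_cube_law)
  show ?thesis by (rule integrable_const_bound[where B=M]) (use assms in auto)
qed

lemma avg2_bound: "k < d \<Longrightarrow> l < d \<Longrightarrow> \<bar>avg2 w k l\<bar> \<le> 2"
  unfolding avg2_def by (rule abs_expectation_le[OF prob_space_cube_law]) (rule smooth2_bound)

lemma integrable_cube_smooth:
  "k < d \<Longrightarrow> integrable (cube_law d) (\<lambda>u. smooth1 d f a b (std_vec d A mu (\<lambda>i. x i + u i)) k)"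
  "k < d \<Longrightarrow> l < d \<Longrightarrow> integrable (cube_law d) (\<lambda>u. smooth2 d f a b (std_vec d A mu (\<lambda>i. x i + u i)) k l)"
  by (rule integrable_cube_bounded[where M=1], measurable, rule smooth1_bound, simp)
     (rule integrable_cube_bounded[where M=2], measurable, rule smooth2_bound, simp_all)

lemma avg_hess_eq: "avg_hess w y = (\<Sum>k<d. \<Sum>l<d. y k * y l * avg2 w k l)"
  unfolding avg_hess_def smooth_hess_def avg2_def
  by (subst Bochner_Integration.integral_sum, (auto intro!: Bochner_Integration.integrable_sum integrable_mult_right integrable_cube_smooth)[1])
     (intro sum.cong refl, subst Bochner_Integration.integral_sum, auto intro!: integrable_mult_right integrable_cube_smooth)

text \<open>The intermediate points between \<open>y'\<close> and \<open>y\<close> are not integral; the cube average makes the translation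
  by them cost no more than an integer translation of \<open>X\<close>.\<close>

lemma avg1_increment:
  fixes y y' :: "nat \<Rightarrow> int"
  assumes X: "shift_smooth d T X" "0 \<le> T" and Y: "\<And>j. j < d \<Longrightarrow> integrable (measure_pmf q) (\<lambda>z. rvec z j)"
  defines "\<eta> \<equiv> mat_vec d A (rvec (y - y'))"
  shows "\<bar>(\<integral>x. (\<Sum>k<d. \<eta> k * (avg1 (x + y) k - avg1 (x + y') k)) \<partial>measure_pmf X)
      - a / b * (\<integral>z. \<integral>x. avg_hess (x + z) \<eta> \<partial>measure_pmf X \<partial>measure_pmf q)\<bar>
    \<le> a / b * (4 * (\<Sum>k<d. (\<eta> k)\<^sup>2) * T * ((\<integral>z. (\<Sum>j<d. \<bar>rvec y' j - rvec z j\<bar>) \<partial>measure_pmf q) + 2 * (\<Sum>j<d. \<bar>rvec (y - y') j\<bar>)))"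
proof -
  define B where "B = 2 * (\<Sum>k<d. (\<eta> k)\<^sup>2)"
  define c where "c = a / b"
  define e where "e = y - y'"
  have c0: "0 \<le> c" using ab by (simp add: c_def)
  have B0: "0 \<le> B" by (simp add: B_def sum_nonneg)
  interpret U: prob_space "cube_law d" by (rule prob_space_cube_law)
  interpret W: prob_space "measure_pmf X" by (rule prob_space_measure_pmf)
  interpret P: pair_prob_space "measure_pmf X" "cube_law d" ..
  interpret PL: pair_sigma_finite "measure_pmf X \<Otimes>\<^sub>M cube_law d" lborel ..
  define h where "h x = smooth_hess d f a b (std_vec d A mu x) \<eta>" for x
  have hm[measurable]: "h \<in> borel_measurable (vecs d)"
    unfolding h_def by (rule smooth_hess_measurable) measurable
  have hB: "\<bar>h x\<bar> \<le> B" for x unfolding h_def B_def by (rule smooth_hess_bound)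
  have hr: "h (\<lambda>i\<in>{..<d}. x i) = h x" for x by (simp add: h_def)
  define F where "F z t = c * h (\<lambda>i\<in>{..<d}. rvec (fst z) i + rvec y' i + t * rvec e i + snd z i) * indicator {0..1::real} t"
    for z :: "(nat \<Rightarrow> int) \<times> (nat \<Rightarrow> real)" and t
  have incr: "(\<Sum>k<d. \<eta> k * (smooth1 d f a b (std_vec d A mu (\<lambda>i. rvec (x + y) i + u i)) k - smooth1 d f a b (std_vec d A mu (\<lambda>i. rvec (x + y') i + u i)) k))
      = (\<integral>t. F (x, u) t \<partial>lborel)" for x u
  proof -
    let ?v = "std_vec d A mu (\<lambda>i. rvec (x + y') i + u i)"
    have v: "std_vec d A mu (\<lambda>i. rvec x i + rvec y' i + t * rvec e i + u i) i = ?v i + t * \<eta> i" if "i < d" for i t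
    proof -
      have "(\<lambda>i. rvec x i + rvec y' i + t * rvec e i + u i) = (\<lambda>i. (rvec (x + y') i + u i) + t * rvec e i)"
        by (simp add: rvec_add fun_eq_iff)
      then show ?thesis using std_vec_add[OF that, of A mu "\<lambda>i. rvec (x + y') i + u i" t "rvec e"] by (simp add: \<eta>_def e_def)
    qed
    have v1: "std_vec d A mu (\<lambda>i. rvec (x + y) i + u i) i = ?v i + \<eta> i" if "i < d" for i
    proof -
      have "(\<lambda>i. rvec (x + y) i + u i) = (\<lambda>i. rvec x i + rvec y' i + 1 * rvec e i + u i)"
        by (simp add: rvec_add rvec_diff e_def fun_eq_iff)
      then show ?thesis using v[OF that, of 1] by simp
    qed
    have "(\<Sum>k<d. \<eta> k * (smooth1 d f a b (std_vec d A mu (\<lambda>i. rvec (x + y) i + u i)) k - smooth1 d f a b ?v k)) =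
        (\<Sum>k<d. \<eta> k * (smooth1 d f a b (\<lambda>i. ?v i + \<eta> i) k - smooth1 d f a b ?v k))"
      by (subst smooth_cong(2)[OF v1]) auto
    also have "\<dots> = (\<integral>t. a / b * smooth_hess d f a b (\<lambda>i. ?v i + t * \<eta> i) \<eta> * indicator {0..1} t \<partial>lborel)"
      by (rule smooth1_increment[OF ab(2)])
    also have "\<dots> = (\<integral>t. F (x, u) t \<partial>lborel)"
    proof (intro Bochner_Integration.integral_cong refl)
      fix t
      have "smooth_hess d f a b (\<lambda>i. ?v i + t * \<eta> i) \<eta> = h (\<lambda>i. rvec x i + rvec y' i + t * rvec e i + u i)"
        unfolding h_def by (subst smooth_cong(4)[OF v]) auto
      then show "a / b * smooth_hess d f a b (\<lambda>i. ?v i + t * \<eta> i) \<eta> * indicator {0..1} t = F (x, u) t"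
        by (simp add: F_def c_def hr)
    qed
    finally show ?thesis .
  qed
  have Fm: "(\<lambda>(z, t). F z t) \<in> borel_measurable ((measure_pmf X \<Otimes>\<^sub>M cube_law d) \<Otimes>\<^sub>M lborel)"
  proof -
    have [measurable]: "(\<lambda>w :: ((nat \<Rightarrow> int) \<times> (nat \<Rightarrow> real)) \<times> real. rvec (fst (fst w)) i) \<in> borel_measurable ((measure_pmf X \<Otimes>\<^sub>M cube_law d) \<Otimes>\<^sub>M lborel)" for i
      by (rule measurable_compose[OF measurable_fst measurable_pmf_rvec])
    have [measurable]: "(\<lambda>w :: ((nat \<Rightarrow> int) \<times> (nat \<Rightarrow> real)) \<times> real. snd (fst w) i) \<in> borel_measurable ((measure_pmf X \<Otimes>\<^sub>M cube_law d) \<Otimes>\<^sub>M lborel)" if "i < d" for i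
      by (rule measurable_compose[OF measurable_fst measurable_cube_snd[OF that]])
    have "(\<lambda>w. \<lambda>i\<in>{..<d}. rvec (fst (fst w)) i + rvec y' i + snd w * rvec e i + snd (fst w) i) \<in>
        measurable ((measure_pmf X \<Otimes>\<^sub>M cube_law d) \<Otimes>\<^sub>M lborel) (vecs d)"
      by measurable
    from measurable_compose[OF this hm] show ?thesis unfolding F_def case_prod_beta by measurable
  qed
  have FB: "\<bar>F z t\<bar> \<le> c * B * indicator {0..1} t" for z t
    using mult_left_mono[OF hB c0] c0 by (cases "t \<in> {0..1}") (auto simp: F_def abs_mult)
  have Bi: "integrable lborel (\<lambda>t. c * B * indicator {0..1::real} t)"
    by (intro integrable_mult_right integrable_real_indicator) auto
  have Ft: "integrable lborel (F z)" for z
  proof (rule Bochner_Integration.integrable_bound[OF Bi])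
    have "(\<lambda>t. \<lambda>i\<in>{..<d}. rvec (fst z) i + rvec y' i + t * rvec e i + snd z i) \<in> measurable borel (vecs d)" by measurable
    from measurable_compose[OF this hm] show "F z \<in> borel_measurable lborel" unfolding F_def by measurable
    show "AE t in lborel. norm (F z t) \<le> norm (c * B * indicator {0..1} t)"
      using FB c0 B0 by (intro AE_I2) (simp add: abs_mult)
  qed
  have Fi: "integrable ((measure_pmf X \<Otimes>\<^sub>M cube_law d) \<Otimes>\<^sub>M lborel) (\<lambda>(z, t). F z t)"
  proof (rule PL.Fubini_integrable[OF Fm])
    show "integrable (measure_pmf X \<Otimes>\<^sub>M cube_law d) (\<lambda>z. \<integral>t. norm (case (z, t) of (z, t) \<Rightarrow> F z t) \<partial>lborel)"
    proof (rule P.integrable_const_bound[where B="c * B"])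
      have "(\<integral>t. \<bar>F z t\<bar> \<partial>lborel) \<le> (\<integral>t. c * B * indicator {0..1::real} t \<partial>lborel)" for z
        by (intro integral_mono integrable_abs Ft Bi FB)
      then show "AE z in measure_pmf X \<Otimes>\<^sub>M cube_law d. norm (\<integral>t. norm (case (z, t) of (z, t) \<Rightarrow> F z t) \<partial>lborel) \<le> c * B"
        by (intro AE_I2) (simp add: integral_nonneg)
    qed (use Fm in measurable)
  qed (use Ft in auto)
  \<comment> \<open>\<open>E t\<close> is the mean Hessian form at the intermediate point y' + t (y
    - y'), and \<open>H\<close> is its mean at an independent point z with law \<open>q\<close>, no
    longer tied to the exchanged pair.\<close>
  define E where "E t = (\<integral>x. \<integral>u. h (\<lambda>i\<in>{..<d}. rvec x i + rvec y' i + t * rvec e i + u i) \<partial>cube_law d \<partial>measure_pmf X)" for t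
  define H where "H = (\<integral>z. \<integral>x. avg_hess (x + z) \<eta> \<partial>measure_pmf X \<partial>measure_pmf q)"
  define R where "R = 2 * B * T * ((\<integral>z. (\<Sum>j<d. \<bar>rvec y' j - rvec z j\<bar>) \<partial>measure_pmf q) + 2 * (\<Sum>j<d. \<bar>rvec e j\<bar>))"
  have PF: "integrable (measure_pmf X \<Otimes>\<^sub>M cube_law d) (\<lambda>(x, u). h (\<lambda>i\<in>{..<d}. rvec x i + rvec y' i + t * rvec e i + u i))" for t
  proof (rule P.integrable_const_bound[where B=B])
    have "(\<lambda>z. \<lambda>i\<in>{..<d}. rvec (fst z) i + rvec y' i + t * rvec e i + snd z i) \<in> measurable (measure_pmf X \<Otimes>\<^sub>M cube_law d) (vecs d)"
      by measurable
    from measurable_compose[OF this hm] show "(\<lambda>(x, u). h (\<lambda>i\<in>{..<d}. rvec x i + rvec y' i + t * rvec e i + u i)) \<in> borel_measurable (measure_pmf X \<Otimes>\<^sub>M cube_law d)"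
      by (simp add: case_prod_beta)
  qed (use hB in auto)
  have Fz: "(\<integral>z. F z t \<partial>(measure_pmf X \<Otimes>\<^sub>M cube_law d)) = c * E t * indicator {0..1} t" for t
  proof -
    have "(\<integral>z. F z t \<partial>(measure_pmf X \<Otimes>\<^sub>M cube_law d)) = c * (\<integral>z. h (\<lambda>i\<in>{..<d}. rvec (fst z) i + rvec y' i + t * rvec e i + snd z i) \<partial>(measure_pmf X \<Otimes>\<^sub>M cube_law d)) * indicator {0..1} t"
      unfolding F_def by simp
    also have "(\<integral>z. h (\<lambda>i\<in>{..<d}. rvec (fst z) i + rvec y' i + t * rvec e i + snd z i) \<partial>(measure_pmf X \<Otimes>\<^sub>M cube_law d)) = E t"
      unfolding E_def using P.integral_fst[OF PF[of t]] by (simp only: case_prod_unfold)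
    finally show ?thesis .
  qed
  have lhs: "(\<integral>x. (\<Sum>k<d. \<eta> k * (avg1 (x + y) k - avg1 (x + y') k)) \<partial>measure_pmf X) = (\<integral>t. c * E t * indicator {0..1} t \<partial>lborel)"
  proof -
    have "(\<Sum>k<d. \<eta> k * (avg1 (x + y) k - avg1 (x + y') k)) = (\<integral>u. (\<integral>t. F (x, u) t \<partial>lborel) \<partial>cube_law d)" for x
      unfolding avg1_def incr[symmetric]
      by (subst Bochner_Integration.integral_sum)
         (auto intro!: integrable_mult_right Bochner_Integration.integrable_diff integrable_cube_smooth sum.cong
           simp: Bochner_Integration.integral_diff integrable_cube_smooth)
    then have "(\<integral>x. (\<Sum>k<d. \<eta> k * (avg1 (x + y) k - avg1 (x + y') k)) \<partial>measure_pmf X) =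
        (\<integral>x. \<integral>u. (\<integral>t. F (x, u) t \<partial>lborel) \<partial>cube_law d \<partial>measure_pmf X)" by simp
    also have "\<dots> = (\<integral>z. (\<integral>t. F z t \<partial>lborel) \<partial>(measure_pmf X \<Otimes>\<^sub>M cube_law d))"
      by (rule P.integral_fst'[OF PL.integrable_fst[OF Fi]])
    also have "\<dots> = (\<integral>t. (\<integral>z. F z t \<partial>(measure_pmf X \<Otimes>\<^sub>M cube_law d)) \<partial>lborel)"
      by (rule PL.Fubini_integral[OF Fi, symmetric])
    finally show ?thesis unfolding Fz .
  qed
  \<comment> \<open>The two base points differ by the integer vector y' - z and the real vector t (y
    - y'). Translating by both is paid for by \<open>X\<close>, at the rate \<open>T\<close> times
    an l1 length.\<close>
  have EH: "\<bar>E t - H\<bar> \<le> R" if t: "t \<in> {0..1}" for t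
  proof -
    let ?g = "\<lambda>z. \<integral>x. avg_hess (x + z) \<eta> \<partial>measure_pmf X"
    let ?r = "\<lambda>z. 2 * B * T * ((\<Sum>j<d. \<bar>rvec y' j - rvec z j\<bar>) + 2 * (\<Sum>j<d. \<bar>rvec e j\<bar>))"
    have gB: "\<bar>?g z\<bar> \<le> B" for z
      by (intro abs_expectation_le prob_space_measure_pmf, unfold avg_hess_def, intro abs_expectation_le prob_space_cube_law)
         (use hB in \<open>simp add: h_def\<close>)
    have gi: "integrable (measure_pmf q) ?g" by (rule integrable_pmf_bounded[OF gB])
    have ri: "integrable (measure_pmf q) ?r"
      by (intro integrable_mult_right Bochner_Integration.integrable_add Bochner_Integration.integrable_sum integrable_abs Bochner_Integration.integrable_diff Y) auto
    have pt: "\<bar>E t - ?g z\<bar> \<le> ?r z" for z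
    proof -
      have gz: "?g z = (\<integral>x. \<integral>u. h (\<lambda>i\<in>{..<d}. rvec x i + rvec z i + u i) \<partial>cube_law d \<partial>measure_pmf X)"
        unfolding avg_hess_def h_def by (simp add: rvec_add)
      have Ez: "E t = (\<integral>x. \<integral>u. h (\<lambda>i\<in>{..<d}. rvec x i + rvec z i + rvec (y' - z) i + t * rvec e i + u i) \<partial>cube_law d \<partial>measure_pmf X)"
        unfolding E_def by (simp add: rvec_diff)
      have "\<bar>E t - ?g z\<bar> \<le> 2 * B * T * (\<Sum>j<d. \<bar>rvec (y' - z) j\<bar> + (if t * rvec e j = 0 then 0 else \<bar>t * rvec e j\<bar> + 1))"
        unfolding Ez gz by (rule shift_smooth_cube[OF X hm hB, where y="rvec z" and n="y' - z" and \<rho>="\<lambda>i. t * rvec e i"])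
      also have "\<dots> \<le> 2 * B * T * (\<Sum>j<d. \<bar>rvec y' j - rvec z j\<bar> + 2 * \<bar>rvec e j\<bar>)"
      proof (intro mult_left_mono sum_mono add_mono)
        fix j
        \<comment> \<open>The entry e_j is an integer: when it is nonzero, the rounding cost 1 is at
          most |e_j|.\<close>
        show "(if t * rvec e j = 0 then 0 else \<bar>t * rvec e j\<bar> + 1) \<le> 2 * \<bar>rvec e j\<bar>"
        proof (cases "t * rvec e j = 0")
          case False
          then have "1 \<le> \<bar>e j\<bar>" by (auto simp: rvec_def)
          then have "1 \<le> \<bar>rvec e j\<bar>" unfolding rvec_def by linarith
          moreover have "\<bar>t * rvec e j\<bar> \<le> \<bar>rvec e j\<bar>" using t by (simp add: abs_mult mult_left_le_one_le)
          ultimately show ?thesis using False by simp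
        qed simp
      qed (use B0 X in \<open>simp_all add: rvec_diff\<close>)
      also have "\<dots> = ?r z" unfolding sum.distrib sum_distrib_left[symmetric] ..
      finally show ?thesis .
    qed
    have "E t - H = (\<integral>z. E t - ?g z \<partial>measure_pmf q)" unfolding H_def using gi by simp
    also have "\<bar>\<dots>\<bar> \<le> (\<integral>z. \<bar>E t - ?g z\<bar> \<partial>measure_pmf q)" by (rule integral_abs_bound)
    also have "\<dots> \<le> (\<integral>z. ?r z \<partial>measure_pmf q)"
      by (intro integral_mono integrable_abs Bochner_Integration.integrable_diff gi ri pt) auto
    also have "\<dots> = R"
      unfolding R_def by (subst integral_mult_right_zero, subst Bochner_Integration.integral_add)
        (auto intro!: Bochner_Integration.integrable_sum integrable_abs Bochner_Integration.integrable_diff Y)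
    finally show ?thesis .
  qed
  have Ei: "integrable lborel (\<lambda>t. c * E t * indicator {0..1} t)"
    using PL.integrable_snd[OF Fi] unfolding Fz .
  have Hi: "integrable lborel (\<lambda>t. K * indicator {0..1::real} t)" for K :: real
    by (intro integrable_mult_right integrable_real_indicator) auto
  let ?D = "\<lambda>t. c * E t * indicator {0..1} t - c * H * indicator {0..1} t"
  have eq: "(\<integral>t. c * E t * indicator {0..1} t \<partial>lborel) - c * H = (\<integral>t. ?D t \<partial>lborel)"
    by (subst Bochner_Integration.integral_diff[OF Ei Hi]) simp
  have "\<bar>(\<integral>t. c * E t * indicator {0..1} t \<partial>lborel) - c * H\<bar> \<le> (\<integral>t. \<bar>?D t\<bar> \<partial>lborel)"
    unfolding eq by (rule integral_abs_bound)
  also have "\<dots> \<le> (\<integral>t. c * R * indicator {0..1::real} t \<partial>lborel)"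
  proof (rule integral_mono)
    show "integrable lborel (\<lambda>t. \<bar>c * E t * indicator {0..1} t - c * H * indicator {0..1} t\<bar>)"
      by (rule integrable_abs, rule Bochner_Integration.integrable_diff[OF Ei Hi])
    show "integrable lborel (\<lambda>t. c * R * indicator {0..1::real} t)" by (rule Hi)
    fix t :: real
    show "\<bar>c * E t * indicator {0..1} t - c * H * indicator {0..1} t\<bar> \<le> c * R * indicator {0..1} t"
    proof (cases "t \<in> {0..1}")
      case True
      have "\<bar>c * E t - c * H\<bar> = c * \<bar>E t - H\<bar>"
        unfolding right_diff_distrib[symmetric] abs_mult using c0 by simp
      also have "\<dots> \<le> c * R" by (rule mult_left_mono[OF EH[OF True] c0])
      finally show ?thesis using True by simp
    qed simp
  qed
  also have "\<dots> = c * R" by simp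
  finally have fin: "\<bar>(\<integral>t. c * E t * indicator {0..1} t \<partial>lborel) - c * H\<bar> \<le> c * R" .
  have Req: "R = 4 * (\<Sum>k<d. (\<eta> k)\<^sup>2) * T * ((\<integral>z. (\<Sum>j<d. \<bar>rvec y' j - rvec z j\<bar>) \<partial>measure_pmf q) + 2 * (\<Sum>j<d. \<bar>rvec (y - y') j\<bar>))"
    unfolding R_def B_def e_def by (simp only: mult.assoc[symmetric])
  show ?thesis using fin unfolding lhs[symmetric] Req unfolding H_def c_def .
qed

end

section \<open>Symmetrisation and third moments\<close>

lemma integrable_pair_pmfI:
  fixes f :: "'a \<times> 'b \<Rightarrow> real"
  assumes "\<And>x. integrable (measure_pmf q) (\<lambda>y. f (x, y))" "integrable (measure_pmf p) (\<lambda>x. \<integral>y. \<bar>f (x, y)\<bar> \<partial>measure_pmf q)"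
  shows "integrable (measure_pmf (pair_pmf p q)) f"
proof (rule integrableI_bounded)
  have "(\<integral>\<^sup>+z. norm (f z) \<partial>measure_pmf (pair_pmf p q)) = (\<integral>\<^sup>+x. \<integral>\<^sup>+y. ennreal \<bar>f (x, y)\<bar> \<partial>measure_pmf q \<partial>measure_pmf p)"
    by (simp add: nn_integral_pair_pmf')
  also have "\<dots> = (\<integral>\<^sup>+x. ennreal (\<integral>y. \<bar>f (x, y)\<bar> \<partial>measure_pmf q) \<partial>measure_pmf p)"
    by (intro nn_integral_cong nn_integral_eq_integral integrable_abs assms) auto
  also have "\<dots> = ennreal (\<integral>x. \<integral>y. \<bar>f (x, y)\<bar> \<partial>measure_pmf q \<partial>measure_pmf p)"
    by (intro nn_integral_eq_integral assms) (auto intro!: integral_nonneg)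
  also have "\<dots> < \<infinity>" by simp
  finally show "(\<integral>\<^sup>+z. norm (f z) \<partial>measure_pmf (pair_pmf p q)) < \<infinity>" .
qed simp

lemma integrable_pair_pmf_mult:
  fixes f :: "'a \<Rightarrow> real" and g :: "'b \<Rightarrow> real"
  assumes "integrable (measure_pmf p) f" "integrable (measure_pmf q) g"
  shows "integrable (measure_pmf (pair_pmf p q)) (\<lambda>z. f (fst z) * g (snd z))"
    and "(\<integral>z. f (fst z) * g (snd z) \<partial>measure_pmf (pair_pmf p q)) = (\<integral>x. f x \<partial>measure_pmf p) * (\<integral>x. g x \<partial>measure_pmf q)"
proof -
  show i: "integrable (measure_pmf (pair_pmf p q)) (\<lambda>z. f (fst z) * g (snd z))"
    by (rule integrable_pair_pmfI) (use assms in \<open>simp_all add: abs_mult\<close>)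
  show "(\<integral>z. f (fst z) * g (snd z) \<partial>measure_pmf (pair_pmf p q)) = (\<integral>x. f x \<partial>measure_pmf p) * (\<integral>x. g x \<partial>measure_pmf q)"
    by (subst integral_pair_pmf[OF i]) simp
qed

lemma integrable_pair_pmf_fst_snd:
  fixes f :: "'a \<Rightarrow> real" and g :: "'b \<Rightarrow> real"
  shows "integrable (measure_pmf p) f \<Longrightarrow> integrable (measure_pmf (pair_pmf p q)) (\<lambda>z. f (fst z))"
    and "integrable (measure_pmf q) g \<Longrightarrow> integrable (measure_pmf (pair_pmf p q)) (\<lambda>z. g (snd z))"
  using integrable_pair_pmf_mult(1)[of p f q "\<lambda>_. 1"] integrable_pair_pmf_mult(1)[of p "\<lambda>_. 1" q g] by simp_all

text \<open>The covariance of h and G equals E (h - h')(G - G') / 2 for an independent copy. This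
  turns a drift term into increments of the smoothed gradient.\<close>

lemma pmf_symmetrization:
  fixes h G :: "'a \<Rightarrow> real"
  assumes h: "integrable (measure_pmf p) h" and G: "integrable (measure_pmf p) G" and hG: "integrable (measure_pmf p) (\<lambda>y. h y * G y)"
  shows "(\<integral>y. (h y - (\<integral>y. h y \<partial>measure_pmf p)) * G y \<partial>measure_pmf p) =
      (\<integral>z. (h (fst z) - h (snd z)) * (G (fst z) - G (snd z)) \<partial>measure_pmf (pair_pmf p p)) / 2"
    and "integrable (measure_pmf (pair_pmf p p)) (\<lambda>z. (h (fst z) - h (snd z)) * (G (fst z) - G (snd z)))"
proof -
  have eq: "(h (fst z) - h (snd z)) * (G (fst z) - G (snd z)) =
      (h (fst z) * G (fst z) - h (fst z) * G (snd z)) + (h (snd z) * G (snd z) - G (fst z) * h (snd z))" for z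
    by (simp add: algebra_simps)
  note i = integrable_pair_pmf_fst_snd[OF hG] integrable_pair_pmf_mult[OF h G] integrable_pair_pmf_mult[OF G h] integrable_pair_pmf_fst_snd(2)[OF hG]
  show "integrable (measure_pmf (pair_pmf p p)) (\<lambda>z. (h (fst z) - h (snd z)) * (G (fst z) - G (snd z)))"
    unfolding eq by (intro Bochner_Integration.integrable_add Bochner_Integration.integrable_diff integrable_pair_pmf_fst_snd[of p "\<lambda>y. h y * G y"]
      integrable_pair_pmf_fst_snd(2)[of p "\<lambda>y. h y * G y"] i hG)
  have "(\<integral>z. (h (fst z) - h (snd z)) * (G (fst z) - G (snd z)) \<partial>measure_pmf (pair_pmf p p)) =
      ((\<integral>y. h y * G y \<partial>measure_pmf p) - (\<integral>y. h y \<partial>measure_pmf p) * (\<integral>y. G y \<partial>measure_pmf p)) +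
      ((\<integral>y. h y * G y \<partial>measure_pmf p) - (\<integral>y. G y \<partial>measure_pmf p) * (\<integral>y. h y \<partial>measure_pmf p))"
    unfolding eq
    using integrable_pair_pmf_fst_snd(1)[OF hG, of p] integrable_pair_pmf_fst_snd(2)[OF hG, of p] i
      expectation_pair_pmf_fst[of p p "\<lambda>y. h y * G y"] expectation_pair_pmf_snd[of p p "\<lambda>y. h y * G y"]
    by (simp add: Bochner_Integration.integral_add Bochner_Integration.integral_diff)
  moreover have "(\<integral>y. (h y - (\<integral>y. h y \<partial>measure_pmf p)) * G y \<partial>measure_pmf p) =
      (\<integral>y. h y * G y \<partial>measure_pmf p) - (\<integral>y. h y \<partial>measure_pmf p) * (\<integral>y. G y \<partial>measure_pmf p)"
    using hG G by (simp add: left_diff_distrib)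
  ultimately show "(\<integral>y. (h y - (\<integral>y. h y \<partial>measure_pmf p)) * G y \<partial>measure_pmf p) =
      (\<integral>z. (h (fst z) - h (snd z)) * (G (fst z) - G (snd z)) \<partial>measure_pmf (pair_pmf p p)) / 2"
    by (simp add: mult.commute)
qed

lemma enorm_eq: "enorm d x = L2_set (rvec x) {..<d}"
  by (simp add: enorm_def L2_set_def rvec_def)

lemma enorm_nonneg: "0 \<le> enorm d x" by (simp add: enorm_eq L2_set_nonneg)

lemma enorm_triangle: "enorm d (x - y) \<le> enorm d x + enorm d y"
proof -
  have "L2_set (\<lambda>i. rvec x i + - rvec y i) {..<d} \<le> L2_set (rvec x) {..<d} + L2_set (\<lambda>i. - rvec y i) {..<d}"
    by (rule L2_set_triangle_ineq)
  then show ?thesis by (simp add: enorm_eq rvec_diff[abs_def] L2_set_def)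
qed

lemma enorm_square: "(enorm d x)\<^sup>2 = (\<Sum>k<d. (rvec x k)\<^sup>2)"
  by (simp add: enorm_eq L2_set_def sum_nonneg)

lemma abs_le_enorm: "k < d \<Longrightarrow> \<bar>rvec x k\<bar> \<le> enorm d x"
  using member_le_L2_set[of "{..<d}" k "\<lambda>k. \<bar>rvec x k\<bar>"] by (simp add: enorm_eq L2_set_def)

lemma sum_abs_le_enorm: "(\<Sum>k<d. \<bar>rvec x k\<bar>) \<le> sqrt (real d) * enorm d x"
proof -
  have "(\<Sum>k<d. \<bar>1\<bar> * \<bar>rvec x k\<bar>) \<le> L2_set (\<lambda>_. 1) {..<d} * L2_set (rvec x) {..<d}"
    by (rule L2_set_mult_ineq)
  then show ?thesis by (simp add: enorm_eq L2_set_def)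
qed

text \<open>The larger argument dominates. Used to separate |Y - Y'|^2 |Y' - Z| into pure third
  powers of differences of two independent copies.\<close>

lemma cube_le: "0 \<le> x \<Longrightarrow> 0 \<le> y \<Longrightarrow> x\<^sup>2 * y \<le> x ^ 3 + y ^ 3" for x y :: real
proof (cases "x \<le> y")
  case True
  assume "0 \<le> x" "0 \<le> y"
  then have "x\<^sup>2 * y \<le> y\<^sup>2 * y" using True by (intro mult_right_mono power_mono) auto
  then show ?thesis using \<open>0 \<le> x\<close> by (simp add: power2_eq_square power3_eq_cube add_increasing)
next
  case False
  assume "0 \<le> x" "0 \<le> y"
  then have "x\<^sup>2 * y \<le> x\<^sup>2 * x" using False by (intro mult_left_mono) auto
  then show ?thesis using \<open>0 \<le> y\<close> by (simp add: power2_eq_square power3_eq_cube add_increasing2)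
qed

text \<open>Lets the third moment dominate the first and second ones.\<close>

lemma le_one_plus_cube:
  fixes t :: real
  assumes t: "0 \<le> t"
  shows "t \<le> 1 + t ^ 3" "t\<^sup>2 \<le> 1 + t ^ 3"
proof -
  have "t \<le> 1 + t ^ 3 \<and> t\<^sup>2 \<le> 1 + t ^ 3"
  proof (cases "t \<le> 1")
    case True
    then have "t\<^sup>2 \<le> 1" using t by (simp add: power_le_one)
    moreover have "0 \<le> t ^ 3" using t by simp
    ultimately show ?thesis using True by linarith
  next
    case False
    then have "t ^ 1 \<le> t ^ 3" "t\<^sup>2 \<le> t ^ 3" by (intro power_increasing; simp)+
    then show ?thesis by simp
  qed
  then show "t \<le> 1 + t ^ 3" "t\<^sup>2 \<le> 1 + t ^ 3" by auto
qed

lemma enorm_diff_cube_le: "enorm d (x - y) ^ 3 \<le> 8 * enorm d x ^ 3 + 8 * enorm d y ^ 3"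
proof -
  have gen: "(s + t) ^ 3 \<le> 8 * s ^ 3 + 8 * t ^ 3" if st: "0 \<le> s" "0 \<le> t" for s t :: real
  proof -
    have "(s + t) ^ 3 \<le> (2 * max s t) ^ 3" using st by (intro power_mono) auto
    also have "\<dots> = 8 * max s t ^ 3" by (simp add: power_mult_distrib)
    also have "\<dots> \<le> 8 * s ^ 3 + 8 * t ^ 3" using st by (auto simp: max_def)
    finally show ?thesis .
  qed
  have "enorm d (x - y) ^ 3 \<le> (enorm d x + enorm d y) ^ 3" by (intro power_mono enorm_triangle enorm_nonneg)
  with gen[OF enorm_nonneg enorm_nonneg, of d x d y] show ?thesis by linarith
qed

definition third_moment :: "nat \<Rightarrow> (nat \<Rightarrow> int) pmf \<Rightarrow> bool" where
  "third_moment d p \<longleftrightarrow> integrable (measure_pmf p) (\<lambda>x. enorm d x ^ 3)"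

text \<open>The sum of these over all summands is m \<chi>.\<close>

definition sym_third :: "nat \<Rightarrow> (nat \<Rightarrow> int) pmf \<Rightarrow> real" where
  "sym_third d p = (\<integral>z. enorm d (fst z - snd z) ^ 3 \<partial>measure_pmf (pair_pmf p p))"

lemma
  assumes "third_moment d p"
  shows third_moment_coord: "j < d \<Longrightarrow> integrable (measure_pmf p) (\<lambda>x. rvec x j)"
    and third_moment_coord2: "j < d \<Longrightarrow> k < d \<Longrightarrow> integrable (measure_pmf p) (\<lambda>x. rvec x j * rvec x k)"
    and third_moment_sym: "integrable (measure_pmf (pair_pmf p p)) (\<lambda>z. enorm d (fst z - snd z) ^ 3)"
proof -
  have i: "integrable (measure_pmf p) (\<lambda>x. enorm d x ^ 3)" using assms by (simp add: third_moment_def)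
  have b: "integrable (measure_pmf p) g" if "\<And>x. \<bar>g x\<bar> \<le> 1 + enorm d x ^ 3" for g
  proof (rule Bochner_Integration.integrable_bound[where f="\<lambda>x. 1 + enorm d x ^ 3"])
    show "AE x in measure_pmf p. norm (g x) \<le> norm (1 + enorm d x ^ 3)"
      using that by (intro AE_I2) (simp add: enorm_nonneg)
  qed (use i in auto)
  note e = le_one_plus_cube[OF enorm_nonneg]
  show "integrable (measure_pmf p) (\<lambda>x. rvec x j)" if "j < d"
    by (rule b) (rule order_trans[OF abs_le_enorm[OF that] e(1)])
  show "integrable (measure_pmf p) (\<lambda>x. rvec x j * rvec x k)" if jk: "j < d" "k < d"
  proof (rule b)
    fix x
    have "\<bar>rvec x j * rvec x k\<bar> \<le> (enorm d x)\<^sup>2"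
      unfolding abs_mult power2_eq_square by (intro mult_mono abs_le_enorm jk enorm_nonneg) auto
    then show "\<bar>rvec x j * rvec x k\<bar> \<le> 1 + enorm d x ^ 3" using e(2)[of d x] by linarith
  qed
  show "integrable (measure_pmf (pair_pmf p p)) (\<lambda>z. enorm d (fst z - snd z) ^ 3)"
  proof (rule Bochner_Integration.integrable_bound[where f="\<lambda>z. 8 * enorm d (fst z) ^ 3 + 8 * enorm d (snd z) ^ 3"])
    show "integrable (measure_pmf (pair_pmf p p)) (\<lambda>z. 8 * enorm d (fst z) ^ 3 + 8 * enorm d (snd z) ^ 3)"
      by (intro Bochner_Integration.integrable_add integrable_mult_right integrable_pair_pmf_fst_snd(1)[OF i] integrable_pair_pmf_fst_snd(2)[OF i])
    show "AE z in measure_pmf (pair_pmf p p). norm (enorm d (fst z - snd z) ^ 3) \<le> norm (8 * enorm d (fst z) ^ 3 + 8 * enorm d (snd z) ^ 3)"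
      using enorm_diff_cube_le by (intro AE_I2) (simp add: enorm_nonneg)
  qed simp
qed

context cube_test
begin

lemma integrable_mat_vec_avg1:
  assumes Y: "third_moment d p" and k: "k < d"
  shows "integrable (measure_pmf (pair_pmf p X)) (\<lambda>z. mat_vec d A (\<lambda>j. rvec (fst z) j - mean_vec p j) k * avg1 (fst z + snd z) k)"
proof (rule Bochner_Integration.integrable_bound)
  have "integrable (measure_pmf p) (\<lambda>y. mat_vec d A (rvec y) k)"
    unfolding mat_vec_def by (intro Bochner_Integration.integrable_sum integrable_mult_right third_moment_coord[OF Y]) auto
  then show "integrable (measure_pmf (pair_pmf p X)) (\<lambda>z. mat_vec d A (\<lambda>j. rvec (fst z) j - mean_vec p j) k)"
    unfolding mat_vec_diff by (intro Bochner_Integration.integrable_diff integrable_pair_pmf_fst_snd(1)) auto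
  show "AE z in measure_pmf (pair_pmf p X). norm (mat_vec d A (\<lambda>j. rvec (fst z) j - mean_vec p j) k * avg1 (fst z + snd z) k)
      \<le> norm (mat_vec d A (\<lambda>j. rvec (fst z) j - mean_vec p j) k)"
    using avg1_bound[OF k] by (intro AE_I2) (auto simp: abs_mult intro!: mult_left_le)
qed simp

text \<open>Here \<open>p\<close> is the law of one summand and \<open>X\<close> the law of the sum of the others.\<close>

lemma exchange_one:
  assumes X: "shift_smooth d T X" "0 \<le> T" and Y: "third_moment d p"
    and l: "0 < l" "\<And>y. (\<Sum>k<d. (mat_vec d A y k)\<^sup>2) \<le> (\<Sum>k<d. (y k)\<^sup>2) / l"
  defines "W \<equiv> map_pmf (\<lambda>(y, x). y + x) (pair_pmf p X)"
  defines "H \<equiv> (\<lambda>k l. \<integral>w. avg2 w k l \<partial>measure_pmf W)"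
  shows "\<bar>(\<integral>z. (\<Sum>k<d. mat_vec d A (\<lambda>j. rvec (fst z) j - mean_vec p j) k * avg1 (fst z + snd z) k) \<partial>measure_pmf (pair_pmf p X))
      - a / b * (\<Sum>k<d. \<Sum>l<d. H k l * (\<Sum>j<d. \<Sum>j'<d. A k j * A l j' * cov_mat p j j'))\<bar>
    \<le> a / b * (8 * T * sqrt (real d) * sym_third d p / l)"
proof -
  let ?P = "measure_pmf (pair_pmf p p)"
  define c where "c = a / b"
  have c0: "0 \<le> c" using ab by (simp add: c_def)
  define e where "e z = mat_vec d A (rvec (fst z - snd z))" for z :: "(nat \<Rightarrow> int) \<times> (nat \<Rightarrow> int)"
  note m1 = third_moment_coord[OF Y] and m2 = third_moment_coord2[OF Y] and m3 = third_moment_sym[OF Y]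
  have mean: "mean_vec p j = (\<integral>x. rvec x j \<partial>measure_pmf p)" for j by (simp add: mean_vec_def rvec_def)
  define G where "G k y = (\<integral>x. avg1 (x + y) k \<partial>measure_pmf X)" for k y
  have GB: "\<bar>G k y\<bar> \<le> 1" if "k < d" for k y
    unfolding G_def by (intro abs_expectation_le prob_space_measure_pmf avg1_bound that)
  have Gi: "integrable (measure_pmf p) (G k)" if "k < d" for k by (rule integrable_pmf_bounded[OF GB[OF that]])
  have ai: "integrable (measure_pmf X) (\<lambda>x. avg1 (x + y) k)" if "k < d" for k y by (rule integrable_pmf_bounded[OF avg1_bound[OF that]])
  have mvi: "integrable (measure_pmf p) (\<lambda>y. mat_vec d A (rvec y) k)" for k
    unfolding mat_vec_def by (intro Bochner_Integration.integrable_sum integrable_mult_right m1) auto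
  have mvm: "(\<integral>y. mat_vec d A (rvec y) k \<partial>measure_pmf p) = mat_vec d A (mean_vec p) k" for k
    unfolding mat_vec_def mean by (subst Bochner_Integration.integral_sum) (auto intro!: m1 integrable_mult_right)
  have mvG: "integrable (measure_pmf p) (\<lambda>y. mat_vec d A (rvec y) k * G k y)" if "k < d" for k
  proof (rule Bochner_Integration.integrable_bound[OF mvi[of k]])
    show "AE y in measure_pmf p. norm (mat_vec d A (rvec y) k * G k y) \<le> norm (mat_vec d A (rvec y) k)"
      using GB[OF that] by (intro AE_I2) (auto simp: abs_mult intro!: mult_left_le)
  qed simp
  note sym = pmf_symmetrization[OF mvi Gi mvG]
  have ez: "mat_vec d A (rvec (fst z)) k - mat_vec d A (rvec (snd z)) k = e z k" for z k
    by (simp add: e_def rvec_diff[abs_def] mat_vec_diff)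
  \<comment> \<open>Symmetrisation in the exchanged summand; \<open>G\<close> has already integrated
    out the remaining ones.\<close>
  have D: "(\<integral>z. (\<Sum>k<d. mat_vec d A (\<lambda>j. rvec (fst z) j - mean_vec p j) k * avg1 (fst z + snd z) k) \<partial>measure_pmf (pair_pmf p X)) =
      (\<integral>z. (\<Sum>k<d. e z k * (G k (fst z) - G k (snd z))) \<partial>?P) / 2"
  proof -
    note int = integrable_mat_vec_avg1[OF Y, where X=X]
    have "(\<integral>z. (\<Sum>k<d. mat_vec d A (\<lambda>j. rvec (fst z) j - mean_vec p j) k * avg1 (fst z + snd z) k) \<partial>measure_pmf (pair_pmf p X)) =
        (\<Sum>k<d. \<integral>z. mat_vec d A (\<lambda>j. rvec (fst z) j - mean_vec p j) k * avg1 (fst z + snd z) k \<partial>measure_pmf (pair_pmf p X))"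
      by (rule Bochner_Integration.integral_sum) (use int in simp)
    also have "\<dots> = (\<Sum>k<d. \<integral>y. (mat_vec d A (rvec y) k - (\<integral>y. mat_vec d A (rvec y) k \<partial>measure_pmf p)) * G k y \<partial>measure_pmf p)"
      by (intro sum.cong refl, subst integral_pair_pmf[OF int])
         (simp_all add: G_def mvm mat_vec_diff add.commute)
    also have "\<dots> = (\<Sum>k<d. (\<integral>z. e z k * (G k (fst z) - G k (snd z)) \<partial>?P) / 2)"
      by (intro sum.cong refl) (simp add: sym(1) ez)
    also have "\<dots> = (\<integral>z. (\<Sum>k<d. e z k * (G k (fst z) - G k (snd z))) \<partial>?P) / 2"
      unfolding sum_divide_distrib[symmetric]
      by (subst Bochner_Integration.integral_sum) (use sym(2) ez in auto)
    finally show ?thesis .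
  qed
  have DG: "(\<Sum>k<d. e z k * (G k (fst z) - G k (snd z))) = (\<integral>x. (\<Sum>k<d. e z k * (avg1 (x + fst z) k - avg1 (x + snd z) k)) \<partial>measure_pmf X)" for z
    unfolding G_def by (subst Bochner_Integration.integral_sum) (auto intro!: integrable_mult_right Bochner_Integration.integrable_diff ai sum.cong
      simp: Bochner_Integration.integral_diff ai)
  define K where "K z = (\<Sum>k<d. \<Sum>l<d. e z k * e z l * H k l)" for z
  \<comment> \<open>Averaging the independent point z over \<open>p\<close> restores the law of the
    full sum. The matrix \<open>H\<close> is therefore the same whichever summand is exchanged,
    which later allows the covariances to be added up.\<close>
  have hW: "(\<integral>y. \<integral>x. avg_hess (x + y) (e z) \<partial>measure_pmf X \<partial>measure_pmf p) = K z" for z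
  proof -
    have bd: "\<bar>avg2 w k l\<bar> \<le> 2" if "k < d" "l < d" for w k l by (rule avg2_bound[OF that])
    have hb: "\<bar>avg_hess w y\<bar> \<le> 2 * (\<Sum>k<d. (y k)\<^sup>2)" for w y
      unfolding avg_hess_def by (rule abs_expectation_le[OF prob_space_cube_law smooth_hess_bound])
    have "(\<integral>y. \<integral>x. avg_hess (x + y) (e z) \<partial>measure_pmf X \<partial>measure_pmf p) = (\<integral>w. avg_hess w (e z) \<partial>measure_pmf W)"
      unfolding W_def integral_map_pmf
      by (subst integral_pair_pmf) (auto intro!: integrable_pmf_bounded[where M="2 * (\<Sum>k<d. (e z k)\<^sup>2)"] hb simp: case_prod_beta add.commute)
    also have "\<dots> = K z"
      unfolding avg_hess_eq K_def H_def
      by (subst Bochner_Integration.integral_sum, (auto intro!: Bochner_Integration.integrable_sum integrable_mult_right integrable_pmf_bounded[OF bd])[1])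
         (intro sum.cong refl, subst Bochner_Integration.integral_sum, auto intro!: integrable_mult_right integrable_pmf_bounded[OF bd])
    finally show ?thesis .
  qed
  define \<phi> where "\<phi> y = (\<integral>z. enorm d (y - z) ^ 3 \<partial>measure_pmf p)" for y
  have i3: "integrable (measure_pmf p) (\<lambda>z. enorm d (y - z) ^ 3)" for y
  proof (rule Bochner_Integration.integrable_bound[where f="\<lambda>z. 8 * enorm d y ^ 3 + 8 * enorm d z ^ 3"])
    show "integrable (measure_pmf p) (\<lambda>z. 8 * enorm d y ^ 3 + 8 * enorm d z ^ 3)"
      using Y by (simp add: third_moment_def)
    show "AE z in measure_pmf p. norm (enorm d (y - z) ^ 3) \<le> norm (8 * enorm d y ^ 3 + 8 * enorm d z ^ 3)"
      using enorm_diff_cube_le by (intro AE_I2) (simp add: enorm_nonneg)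
  qed simp
  have \<phi>i: "integrable (measure_pmf p) \<phi>" and \<phi>E: "(\<integral>y. \<phi> y \<partial>measure_pmf p) = sym_third d p"
    using integrable_pair_pmf_fst[OF m3] integral_pair_pmf[OF m3] by (simp_all add: \<phi>_def[abs_def] sym_third_def)
  \<comment> \<open>Of the 3 cubes of |Y - Y'|, two come from the term 2 |Y - Y'| and one from
    \<open>cube_le\<close>, which also leaves \<open>\<phi>\<close>. In expectation this is 4 times
    \<open>sym_third\<close>; with the prefactor 4 and the 1/2 of the symmetrisation the constant 8
    results.\<close>
  let ?Q = "\<lambda>z. c * (4 * T * sqrt (real d) / l * (3 * enorm d (fst z - snd z) ^ 3 + \<phi> (snd z)))"
  have pt: "\<bar>(\<Sum>k<d. e z k * (G k (fst z) - G k (snd z))) - c * K z\<bar> \<le> ?Q z" for z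
  proof -
    let ?n = "enorm d (fst z - snd z)"
    have n0: "0 \<le> ?n" by (rule enorm_nonneg)
    have "\<bar>(\<Sum>k<d. e z k * (G k (fst z) - G k (snd z))) - c * K z\<bar> \<le>
        c * (4 * (\<Sum>k<d. (e z k)\<^sup>2) * T * ((\<integral>y. (\<Sum>j<d. \<bar>rvec (snd z) j - rvec y j\<bar>) \<partial>measure_pmf p) + 2 * (\<Sum>j<d. \<bar>rvec (fst z - snd z) j\<bar>)))"
      using avg1_increment[OF X m1, where y="fst z" and y'="snd z"] unfolding DG hW[symmetric] unfolding c_def e_def by (simp only:)
    also have "\<dots> \<le> c * (4 * (?n\<^sup>2 / l) * T * ((\<integral>y. sqrt (real d) * enorm d (snd z - y) \<partial>measure_pmf p) + 2 * (sqrt (real d) * ?n)))"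
    proof -
      have ie: "integrable (measure_pmf p) (\<lambda>y. enorm d (snd z - y))"
      proof (rule Bochner_Integration.integrable_bound[where f="\<lambda>y. 1 + enorm d (snd z - y) ^ 3"])
        show "AE y in measure_pmf p. norm (enorm d (snd z - y)) \<le> norm (1 + enorm d (snd z - y) ^ 3)"
          using le_one_plus_cube(1)[OF enorm_nonneg] by (intro AE_I2) (simp add: enorm_nonneg)
      qed (use i3 in auto)
      have 1: "(\<Sum>k<d. (e z k)\<^sup>2) \<le> ?n\<^sup>2 / l" unfolding e_def enorm_square by (rule l(2))
      have 2: "(\<integral>y. (\<Sum>j<d. \<bar>rvec (snd z) j - rvec y j\<bar>) \<partial>measure_pmf p) \<le> (\<integral>y. sqrt (real d) * enorm d (snd z - y) \<partial>measure_pmf p)"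
      proof (rule integral_mono)
        show "(\<Sum>j<d. \<bar>rvec (snd z) j - rvec y j\<bar>) \<le> sqrt (real d) * enorm d (snd z - y)" for y
          using sum_abs_le_enorm[where x="snd z - y" and d=d] by (simp add: rvec_diff)
      qed (auto intro!: Bochner_Integration.integrable_sum integrable_abs Bochner_Integration.integrable_diff ie m1)
      have 3: "(\<Sum>j<d. \<bar>rvec (fst z - snd z) j\<bar>) \<le> sqrt (real d) * ?n" by (rule sum_abs_le_enorm)
      show ?thesis
        by (intro mult_left_mono mult_mono add_mono 1 2 3 mult_right_mono c0 X add_nonneg_nonneg mult_nonneg_nonneg)
           (use X l in \<open>auto intro!: sum_nonneg integral_nonneg\<close>)
    qed
    also have "\<dots> = c * (4 * T * sqrt (real d) / l * ((\<integral>y. ?n\<^sup>2 * enorm d (snd z - y) \<partial>measure_pmf p) + 2 * ?n ^ 3))"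
      using l by (simp add: field_simps power2_eq_square power3_eq_cube)
    also have "\<dots> \<le> ?Q z"
    proof (intro mult_left_mono c0)
      have "(\<integral>y. ?n\<^sup>2 * enorm d (snd z - y) \<partial>measure_pmf p) \<le> (\<integral>y. ?n ^ 3 + enorm d (snd z - y) ^ 3 \<partial>measure_pmf p)"
      proof (rule integral_mono_AE')
        show "AE y in measure_pmf p. ?n\<^sup>2 * enorm d (snd z - y) \<le> ?n ^ 3 + enorm d (snd z - y) ^ 3"
          by (intro AE_I2 cube_le enorm_nonneg)
        show "AE y in measure_pmf p. 0 \<le> ?n ^ 3 + enorm d (snd z - y) ^ 3"
          by (intro AE_I2) (simp add: enorm_nonneg)
      qed (use i3 in simp)
      also have "\<dots> = ?n ^ 3 + \<phi> (snd z)" using i3 by (simp add: \<phi>_def)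
      finally show "(\<integral>y. ?n\<^sup>2 * enorm d (snd z - y) \<partial>measure_pmf p) + 2 * ?n ^ 3 \<le> 3 * ?n ^ 3 + \<phi> (snd z)" by simp
    qed (use X l in simp)
    finally show ?thesis .
  qed
  \<comment> \<open>The difference of two independent copies has twice the covariance; this 2
    cancels the 1/2 of the symmetrisation.\<close>
  have ei: "integrable ?P (\<lambda>z. e z k * e z l)" and eE: "(\<integral>z. e z k * e z l \<partial>?P) = 2 * (\<Sum>j<d. \<Sum>j'<d. A k j * A l j' * cov_mat p j j')" for k l
  proof -
    have eq: "e z k * e z l = (\<Sum>j<d. \<Sum>j'<d. A k j * A l j' * ((rvec (fst z) j - rvec (snd z) j) * (rvec (fst z) j' - rvec (snd z) j')))" for z
      unfolding e_def mat_vec_def sum_product rvec_diff by (intro sum.cong refl) (simp add: mult_ac)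
    have ci: "integrable ?P (\<lambda>z. (rvec (fst z) j - rvec (snd z) j) * (rvec (fst z) j' - rvec (snd z) j'))"
      "(\<integral>z. (rvec (fst z) j - rvec (snd z) j) * (rvec (fst z) j' - rvec (snd z) j') \<partial>?P) = 2 * cov_mat p j j'" if j: "j < d" "j' < d" for j j'
    proof -
      note s = pmf_symmetrization[OF m1[OF j(1)] m1[OF j(2)] m2[OF j]]
      show "integrable ?P (\<lambda>z. (rvec (fst z) j - rvec (snd z) j) * (rvec (fst z) j' - rvec (snd z) j'))" by (rule s(2))
      have "cov_mat p j j' = (\<integral>x. (rvec x j - mean_vec p j) * rvec x j' - mean_vec p j' * (rvec x j - mean_vec p j) \<partial>measure_pmf p)"
        unfolding cov_mat_def rvec_def[symmetric] by (simp add: algebra_simps)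
      also have "\<dots> = (\<integral>x. (rvec x j - mean_vec p j) * rvec x j' \<partial>measure_pmf p) - mean_vec p j' * (\<integral>x. rvec x j - mean_vec p j \<partial>measure_pmf p)"
      proof -
        have "integrable (measure_pmf p) (\<lambda>x. (rvec x j - mean_vec p j) * rvec x j')"
          using m2[OF j] m1[OF j(2)] by (simp add: left_diff_distrib)
        then show ?thesis using m1[OF j(1)] by simp
      qed
      also have "(\<integral>x. rvec x j - mean_vec p j \<partial>measure_pmf p) = 0" using m1[OF j(1)] by (simp add: mean)
      finally show "(\<integral>z. (rvec (fst z) j - rvec (snd z) j) * (rvec (fst z) j' - rvec (snd z) j') \<partial>?P) = 2 * cov_mat p j j'"
        using s(1) by (simp add: mean)
    qed
    show "integrable ?P (\<lambda>z. e z k * e z l)" unfolding eq by (intro Bochner_Integration.integrable_sum integrable_mult_right ci) auto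
    have "(\<integral>z. e z k * e z l \<partial>?P) = (\<Sum>j<d. \<Sum>j'<d. A k j * A l j' * (2 * cov_mat p j j'))"
      unfolding eq
      by (subst Bochner_Integration.integral_sum, (auto intro!: Bochner_Integration.integrable_sum integrable_mult_right ci)[1])
         (intro sum.cong refl, subst Bochner_Integration.integral_sum, auto intro!: integrable_mult_right ci simp: ci)
    then show "(\<integral>z. e z k * e z l \<partial>?P) = 2 * (\<Sum>j<d. \<Sum>j'<d. A k j * A l j' * cov_mat p j j')"
      by (simp add: sum_distrib_left mult_ac)
  qed
  have Ki: "integrable ?P K" unfolding K_def by (intro Bochner_Integration.integrable_sum integrable_mult_left ei)
  have KE: "(\<integral>z. K z \<partial>?P) = 2 * (\<Sum>k<d. \<Sum>l<d. H k l * (\<Sum>j<d. \<Sum>j'<d. A k j * A l j' * cov_mat p j j'))"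
  proof -
    have "(\<integral>z. K z \<partial>?P) = (\<Sum>k<d. \<Sum>l<d. (\<integral>z. e z k * e z l \<partial>?P) * H k l)"
      unfolding K_def
      by (subst Bochner_Integration.integral_sum, (auto intro!: Bochner_Integration.integrable_sum integrable_mult_left ei)[1])
         (intro sum.cong refl, subst Bochner_Integration.integral_sum, auto intro!: integrable_mult_left ei)
    then show ?thesis unfolding eE by (simp add: sum_distrib_left mult_ac)
  qed
  let ?D = "\<lambda>z. \<Sum>k<d. e z k * (G k (fst z) - G k (snd z))"
  have Di: "integrable ?P ?D" using sym(2) ez by (intro Bochner_Integration.integrable_sum) auto
  have Qi: "integrable ?P ?Q"
    by (intro integrable_mult_right Bochner_Integration.integrable_add m3 integrable_pair_pmf_fst_snd(2) \<phi>i)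
  have QE: "(\<integral>z. ?Q z \<partial>?P) = c * (4 * T * sqrt (real d) / l * (4 * sym_third d p))"
  proof -
    have "(\<integral>z. 3 * enorm d (fst z - snd z) ^ 3 + \<phi> (snd z) \<partial>?P) = 4 * sym_third d p"
      using m3 integrable_pair_pmf_fst_snd(2)[OF \<phi>i, of p] expectation_pair_pmf_snd[of p p \<phi>] by (simp add: sym_third_def[symmetric] \<phi>E)
    then show ?thesis by simp
  qed
  have "(\<integral>z. ?D z \<partial>?P) - c * (\<integral>z. K z \<partial>?P) = (\<integral>z. ?D z - c * K z \<partial>?P)"
    using Di Ki by simp
  then have "\<bar>(\<integral>z. ?D z \<partial>?P) - c * (\<integral>z. K z \<partial>?P)\<bar> \<le> (\<integral>z. \<bar>?D z - c * K z\<bar> \<partial>?P)"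
    by (simp only: integral_abs_bound)
  also have "\<dots> \<le> (\<integral>z. ?Q z \<partial>?P)"
  proof (rule integral_mono[OF _ Qi pt])
    show "integrable ?P (\<lambda>z. \<bar>?D z - c * K z\<bar>)" using Di Ki by (intro integrable_abs Bochner_Integration.integrable_diff integrable_mult_right)
  qed
  finally have "\<bar>(\<integral>z. ?D z \<partial>?P) - c * (\<integral>z. K z \<partial>?P)\<bar> \<le> (\<integral>z. ?Q z \<partial>?P)" .
  then have "\<bar>(\<integral>z. ?D z \<partial>?P) / 2 - c * (\<Sum>k<d. \<Sum>l<d. H k l * (\<Sum>j<d. \<Sum>j'<d. A k j * A l j' * cov_mat p j j'))\<bar> \<le>
      c * (8 * T * sqrt (real d) * sym_third d p / l)"
    unfolding KE QE by (simp add: abs_le_iff field_simps)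
  then show ?thesis unfolding D c_def .
qed

end

section \<open>From one exchanged summand to the whole sum\<close>

lemma rvec_sum: "rvec (\<Sum>i\<in>I. \<omega> i) j = (\<Sum>i\<in>I. rvec (\<omega> i) j)"
  by (induction I rule: infinite_finite_induct) (simp_all add: rvec_add, simp_all add: rvec_def)

text \<open>\<open>exchange_one\<close> speaks of one summand and an independent remainder; this
  realises all such pairs on one product space.\<close>

lemma map_Pi_pmf_split:
  fixes Y :: "'i \<Rightarrow> 'a::ab_group_add pmf"
  assumes "finite I" "i \<in> I"
  shows "map_pmf (\<lambda>\<omega>. (\<omega> i, \<Sum>j\<in>I - {i}. \<omega> j)) (Pi_pmf I 0 Y) = pair_pmf (Y i) (sum_pmf (I - {i}) Y)"
proof -
  have "Pi_pmf I 0 Y = map_pmf (\<lambda>(y, f). f(i := y)) (pair_pmf (Y i) (Pi_pmf (I - {i}) 0 Y))"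
    using Pi_pmf_insert[of "I - {i}" i 0 Y] assms by (simp add: insert_absorb)
  moreover have "(\<Sum>j\<in>I - {i}. (f(i := y)) j) = (\<Sum>j\<in>I - {i}. f j)" for f and y :: 'a
    by (intro sum.cong) auto
  ultimately show ?thesis
    by (simp add: sum_pmf_def pair_map_pmf2 map_pmf_comp case_prod_beta' apsnd_def map_prod_def del: fun_upd_apply)
      (simp add: case_prod_beta')
qed

lemma sum_pmf_split:
  fixes Y :: "'i \<Rightarrow> 'a::ab_group_add pmf"
  assumes "finite I" "i \<in> I"
  shows "sum_pmf I Y = map_pmf (\<lambda>(y, x). y + x) (pair_pmf (Y i) (sum_pmf (I - {i}) Y))"
  using sum_pmf_insert[of "I - {i}" i Y] assms by (simp add: insert_absorb)

lemma integrable_sum_pmf_rvec: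
  assumes "finite I" "\<And>i. i \<in> I \<Longrightarrow> integrable (measure_pmf (Y i)) (\<lambda>x. rvec x j)"
  shows "integrable (measure_pmf (sum_pmf I Y)) (\<lambda>w. rvec w j)"
proof -
  have "integrable (measure_pmf (Pi_pmf I 0 Y)) (\<lambda>\<omega>. rvec (\<omega> i) j)" if "i \<in> I" for i
  proof -
    have "integrable (measure_pmf (map_pmf (\<lambda>\<omega>. \<omega> i) (Pi_pmf I 0 Y))) (\<lambda>x. rvec x j)"
      using assms that by (simp add: Pi_pmf_component)
    then show ?thesis by simp
  qed
  then show ?thesis by (simp add: sum_pmf_def rvec_sum Bochner_Integration.integrable_sum)
qed

context cube_test
begin

definition std_law :: "(nat \<Rightarrow> int) pmf \<Rightarrow> (nat \<Rightarrow> real) measure" where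
  "std_law W = distr (measure_pmf W \<Otimes>\<^sub>M cube_law d) (vecs d) (\<lambda>z. std_vec d A mu (\<lambda>i. rvec (fst z) i + snd z i))"

lemma measurable_std_vec_pair [measurable]:
  "(\<lambda>z. std_vec d A mu (\<lambda>i. rvec (fst z) i + snd z i)) \<in> measurable (measure_pmf W \<Otimes>\<^sub>M cube_law d) (vecs d)"
proof -
  have "(\<lambda>z. \<lambda>i\<in>{..<d}. rvec (fst z) i + snd z i) \<in> measurable (measure_pmf W \<Otimes>\<^sub>M cube_law d) (vecs d)" by measurable
  from measurable_compose[OF this measurable_std_vec] show ?thesis by simp
qed

lemma std_law_prob: "prob_space (std_law W)" "sets (std_law W) = sets (vecs d)"
proof -
  interpret U: prob_space "cube_law d" by (rule prob_space_cube_law)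
  interpret W: prob_space "measure_pmf W" by (rule prob_space_measure_pmf)
  interpret P: pair_prob_space "measure_pmf W" "cube_law d" ..
  show "prob_space (std_law W)" unfolding std_law_def by (rule P.prob_space_distr) measurable
qed (simp add: std_law_def)

lemma integrable_pair_cube_fst:
  assumes "integrable (measure_pmf W) h"
  shows "integrable (measure_pmf W \<Otimes>\<^sub>M cube_law d) (\<lambda>z. h (fst z) :: real)"
proof -
  interpret U: prob_space "cube_law d" by (rule prob_space_cube_law)
  interpret W: prob_space "measure_pmf W" by (rule prob_space_measure_pmf)
  interpret P: pair_prob_space "measure_pmf W" "cube_law d" ..
  show ?thesis
  proof (rule P.Fubini_integrable)
    show "(\<lambda>z. h (fst z)) \<in> borel_measurable (measure_pmf W \<Otimes>\<^sub>M cube_law d)"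
      by (rule measurable_compose[OF measurable_fst]) simp
  qed (use assms U.prob_space in auto)
qed

lemma integrable_pair_cube_snd:
  assumes h: "integrable (cube_law d) h"
  shows "integrable (measure_pmf W \<Otimes>\<^sub>M cube_law d) (\<lambda>z. h (snd z) :: real)"
proof -
  interpret U: prob_space "cube_law d" by (rule prob_space_cube_law)
  interpret W: prob_space "measure_pmf W" by (rule prob_space_measure_pmf)
  interpret P: pair_prob_space "measure_pmf W" "cube_law d" ..
  show ?thesis
  proof (rule P.Fubini_integrable)
    show "(\<lambda>z. h (snd z)) \<in> borel_measurable (measure_pmf W \<Otimes>\<^sub>M cube_law d)"
      by (rule measurable_compose[OF measurable_snd]) (use h in auto)
  qed (use h in auto)
qed

lemma mat_vec_cube:
  assumes k: "k < d"
  shows "integrable (cube_law d) (\<lambda>u. mat_vec d A u k)" "(\<integral>u. mat_vec d A u k \<partial>cube_law d) = 0"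
proof -
  show "integrable (cube_law d) (\<lambda>u. mat_vec d A u k)"
    unfolding mat_vec_def by (intro Bochner_Integration.integrable_sum integrable_mult_right integrable_cube_law_coord) auto
  show "(\<integral>u. mat_vec d A u k \<partial>cube_law d) = 0"
    unfolding mat_vec_def
    by (subst Bochner_Integration.integral_sum) (auto intro!: integrable_mult_right integrable_cube_law_coord simp: integral_cube_law_coord)
qed

lemma integrable_test_bounded:
  fixes h g :: "'b \<Rightarrow> real"
  assumes "integrable M h" "g \<in> borel_measurable M" "\<And>x. \<bar>g x\<bar> \<le> 1"
  shows "integrable M (\<lambda>x. h x * g x)"
proof (rule Bochner_Integration.integrable_bound[OF assms(1)])
  show "AE x in M. norm (h x * g x) \<le> norm (h x)"
    using assms(3) by (intro AE_I2) (auto simp: abs_mult intro!: mult_left_le)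
qed (use assms in measurable)

text \<open>The cube variable is centred, so subtracting the value at the centre of the cube makes its
  contribution second order.\<close>

lemma cube_term_bound:
  assumes l: "0 < l" "\<And>y. (\<Sum>k<d. (mat_vec d A y k)\<^sup>2) \<le> (\<Sum>k<d. (y k)\<^sup>2) / l"
  shows "\<bar>\<integral>u. (\<Sum>k<d. mat_vec d A u k * smooth1 d f a b (std_vec d A mu (\<lambda>i. x i + u i)) k) \<partial>cube_law d\<bar> \<le> a / b * (real d / (2 * l))"
proof -
  interpret U: prob_space "cube_law d" by (rule prob_space_cube_law)
  let ?v = "std_vec d A mu x"
  let ?g = "\<lambda>u k. smooth1 d f a b (std_vec d A mu (\<lambda>i. x i + u i)) k"
  have i1: "integrable (cube_law d) (\<lambda>u. mat_vec d A u k * ?g u k)" if k: "k < d" for k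
    by (rule integrable_test_bounded[OF mat_vec_cube(1)[OF k] borel_measurable_integrable[OF integrable_cube_smooth(1)[OF k]] smooth1_bound[OF k]])
  have i2: "integrable (cube_law d) (\<lambda>u. mat_vec d A u k * smooth1 d f a b ?v k)" if k: "k < d" for k
    by (intro integrable_mult_left mat_vec_cube k)
  have v: "std_vec d A mu (\<lambda>i. x i + u i) i = ?v i + mat_vec d A u i" if "i < d" for i u
    using std_vec_add[OF that, of A mu x 1 u] by simp
  have z: "(\<integral>u. (\<Sum>k<d. mat_vec d A u k * smooth1 d f a b ?v k) \<partial>cube_law d) = 0"
    by (subst Bochner_Integration.integral_sum) (use i2 mat_vec_cube in auto)
  have I1: "integrable (cube_law d) (\<lambda>u. \<Sum>k<d. mat_vec d A u k * ?g u k)" and I2: "integrable (cube_law d) (\<lambda>u. \<Sum>k<d. mat_vec d A u k * smooth1 d f a b ?v k)"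
    using i1 i2 by (auto intro!: Bochner_Integration.integrable_sum)
  have eq: "(\<integral>u. (\<Sum>k<d. mat_vec d A u k * ?g u k) \<partial>cube_law d) = (\<integral>u. (\<Sum>k<d. mat_vec d A u k * (?g u k - smooth1 d f a b ?v k)) \<partial>cube_law d)"
    using Bochner_Integration.integral_diff[OF I1 I2] z by (simp add: right_diff_distrib sum_subtractf)
  have I: "integrable (cube_law d) (\<lambda>u. \<Sum>k<d. mat_vec d A u k * (?g u k - smooth1 d f a b ?v k))"
    using Bochner_Integration.integrable_diff[OF I1 I2] by (simp add: right_diff_distrib sum_subtractf)
  have pt: "AE u in cube_law d. \<bar>\<Sum>k<d. mat_vec d A u k * (?g u k - smooth1 d f a b ?v k)\<bar> \<le> a / b * (real d / (2 * l))"
    using AE_cube_law_abs[of d]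
  proof eventually_elim
    fix u :: "nat \<Rightarrow> real" assume u: "\<forall>k<d. \<bar>u k\<bar> \<le> 1 / 2"
    have "?g u k = smooth1 d f a b (\<lambda>i. ?v i + mat_vec d A u i) k" for k
      by (subst smooth_cong(2)[OF v]) auto
    then have "\<bar>\<Sum>k<d. mat_vec d A u k * (?g u k - smooth1 d f a b ?v k)\<bar> \<le> a / b * (2 * (\<Sum>k<d. (mat_vec d A u k)\<^sup>2))"
      using smooth1_increment_bound[OF ab(2,1), of "mat_vec d A u" ?v] by simp
    \<comment> \<open>|u_k| <= 1/2 gives |u|^2 <= d/4, and the whitening divides by at most
      \<open>l\<close>.\<close>
    also have "\<dots> \<le> a / b * (2 * (real d * (1 / 4) / l))"
    proof (intro mult_left_mono order_trans[OF l(2)] divide_right_mono)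
      have "(\<Sum>k<d. (u k)\<^sup>2) \<le> (\<Sum>k<d. 1 / 4)"
      proof (intro sum_mono)
        fix k assume "k \<in> {..<d}"
        then have "(u k)\<^sup>2 \<le> (1 / 2)\<^sup>2" using u by (intro abs_le_square_iff[THEN iffD1]) auto
        then show "(u k)\<^sup>2 \<le> 1 / 4" by (simp add: power2_eq_square)
      qed
      then show "(\<Sum>k<d. (u k)\<^sup>2) \<le> real d * (1 / 4)" by simp
    qed (use ab l in auto)
    also have "\<dots> = a / b * (real d / (2 * l))" by simp
    finally show "\<bar>\<Sum>k<d. mat_vec d A u k * (?g u k - smooth1 d f a b ?v k)\<bar> \<le> a / b * (real d / (2 * l))" .
  qed
  have "\<bar>\<integral>u. (\<Sum>k<d. mat_vec d A u k * (?g u k - smooth1 d f a b ?v k)) \<partial>cube_law d\<bar> \<le>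
      (\<integral>u. \<bar>\<Sum>k<d. mat_vec d A u k * (?g u k - smooth1 d f a b ?v k)\<bar> \<partial>cube_law d)"
    by (rule integral_abs_bound)
  also have "\<dots> \<le> (\<integral>u. a / b * (real d / (2 * l)) \<partial>cube_law d)"
    by (rule integral_mono_AE[OF integrable_abs[OF I] _ pt]) simp
  also have "\<dots> = a / b * (real d / (2 * l))" using U.prob_space by simp
  finally show ?thesis unfolding eq .
qed

text \<open>The drift A (W - \<mu>) is a sum over the summands, each treated by
  \<open>exchange_one\<close> with the same matrix of mean second derivatives. The covariances then
  add up to A S A^T = I, leaving exactly the trace that the Stein operator subtracts.\<close>

lemma exchange_sum:
  fixes Y :: "nat \<Rightarrow> (nat \<Rightarrow> int) pmf" and I :: "nat set"
  assumes I: "finite I" and T: "0 \<le> T" "\<And>i. i \<in> I \<Longrightarrow> shift_smooth d T (sum_pmf (I - {i}) Y)"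
    and Y: "\<And>i. i \<in> I \<Longrightarrow> third_moment d (Y i)"
    and l: "0 < l" "\<And>y. (\<Sum>k<d. (mat_vec d A y k)\<^sup>2) \<le> (\<Sum>k<d. (y k)\<^sup>2) / l"
    and mu: "\<And>j. j < d \<Longrightarrow> mu j = (\<Sum>i\<in>I. mean_vec (Y i) j)"
    and cov: "\<And>k l. k < d \<Longrightarrow> l < d \<Longrightarrow> (\<Sum>j<d. \<Sum>j'<d. A k j * A l j' * (\<Sum>i\<in>I. cov_mat (Y i) j j')) = (if k = l then 1 else 0)"
  defines "W \<equiv> sum_pmf I Y"
  shows "\<bar>(\<integral>w. (\<Sum>k<d. mat_vec d A (\<lambda>j. rvec w j - mu j) k * avg1 w k) \<partial>measure_pmf W) - a / b * (\<Sum>k<d. \<integral>w. avg2 w k k \<partial>measure_pmf W)\<bar>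
    \<le> a / b * (8 * T * sqrt (real d) * (\<Sum>i\<in>I. sym_third d (Y i)) / l)"
proof -
  define H where "H k l = (\<integral>w. avg2 w k l \<partial>measure_pmf W)" for k l
  define F where "F i z = (\<Sum>k<d. mat_vec d A (\<lambda>j. rvec (fst z) j - mean_vec (Y i) j) k * avg1 (fst z + snd z) k)"
    for i and z :: "(nat \<Rightarrow> int) \<times> (nat \<Rightarrow> int)"
  define C where "C i = (\<Sum>k<d. \<Sum>l<d. H k l * (\<Sum>j<d. \<Sum>j'<d. A k j * A l j' * cov_mat (Y i) j j'))" for i
  have one: "\<bar>(\<integral>z. F i z \<partial>measure_pmf (pair_pmf (Y i) (sum_pmf (I - {i}) Y))) - a / b * C i\<bar> \<le> a / b * (8 * T * sqrt (real d) * sym_third d (Y i) / l)"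
    if i: "i \<in> I" for i
    using exchange_one[OF T(2)[OF i] T(1) Y[OF i] l] unfolding F_def C_def H_def W_def sum_pmf_split[OF I i] .
  have Fi: "integrable (measure_pmf (pair_pmf (Y i) (sum_pmf (I - {i}) Y))) (F i)" if i: "i \<in> I" for i
    unfolding F_def by (intro Bochner_Integration.integrable_sum integrable_mat_vec_avg1 Y i) auto
  let ?\<Omega> = "measure_pmf (Pi_pmf I 0 Y)"
  let ?s = "\<lambda>i \<omega>. (\<omega> i, \<Sum>j\<in>I - {i}. \<omega> j)"
  have Fo: "integrable ?\<Omega> (\<lambda>\<omega>. F i (?s i \<omega>))" "(\<integral>\<omega>. F i (?s i \<omega>) \<partial>?\<Omega>) = (\<integral>z. F i z \<partial>measure_pmf (pair_pmf (Y i) (sum_pmf (I - {i}) Y)))"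
    if i: "i \<in> I" for i
    using Fi[OF i] unfolding map_Pi_pmf_split[OF I i, symmetric] by simp_all
  have dec: "(\<Sum>k<d. mat_vec d A (\<lambda>j. rvec (\<Sum>i\<in>I. \<omega> i) j - mu j) k * avg1 (\<Sum>i\<in>I. \<omega> i) k) = (\<Sum>i\<in>I. F i (?s i \<omega>))" for \<omega>
  proof -
    have "mat_vec d A (\<lambda>j. rvec (\<Sum>i\<in>I. \<omega> i) j - mu j) k = (\<Sum>i\<in>I. mat_vec d A (\<lambda>j. rvec (\<omega> i) j - mean_vec (Y i) j) k)" for k
    proof -
      have "mat_vec d A (\<lambda>j. rvec (\<Sum>i\<in>I. \<omega> i) j - mu j) k = (\<Sum>j<d. \<Sum>i\<in>I. A k j * (rvec (\<omega> i) j - mean_vec (Y i) j))"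
        unfolding mat_vec_def by (intro sum.cong refl) (simp add: rvec_sum mu sum_subtractf[symmetric] sum_distrib_left)
      then show ?thesis unfolding mat_vec_def by (subst sum.swap) simp
    qed
    moreover have "\<omega> i + (\<Sum>j\<in>I - {i}. \<omega> j) = (\<Sum>i\<in>I. \<omega> i)" if "i \<in> I" for i
      using that I by (simp add: sum.remove)
    ultimately show ?thesis
      unfolding F_def by (simp add: sum_distrib_right) (rule sum.swap)
  qed
  have L: "(\<integral>w. (\<Sum>k<d. mat_vec d A (\<lambda>j. rvec w j - mu j) k * avg1 w k) \<partial>measure_pmf W) =
      (\<Sum>i\<in>I. \<integral>z. F i z \<partial>measure_pmf (pair_pmf (Y i) (sum_pmf (I - {i}) Y)))"
    unfolding W_def sum_pmf_def[of I] integral_map_pmf dec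
    by (subst Bochner_Integration.integral_sum) (use Fo in auto)
  \<comment> \<open>By \<open>cov\<close> the summed and whitened covariances are the identity, so
    only the diagonal of \<open>H\<close> survives.\<close>
  have R: "(\<Sum>k<d. H k k) = (\<Sum>i\<in>I. C i)"
  proof -
    have "(\<Sum>i\<in>I. C i) = (\<Sum>k<d. \<Sum>l<d. \<Sum>i\<in>I. H k l * (\<Sum>j<d. \<Sum>j'<d. A k j * A l j' * cov_mat (Y i) j j'))"
      unfolding C_def by (subst sum.swap) (intro sum.cong refl sum.swap)
    also have "\<dots> = (\<Sum>k<d. \<Sum>l<d. H k l * (if k = l then 1 else 0))"
    proof (intro sum.cong refl)
      fix k l assume kl: "k \<in> {..<d}" "l \<in> {..<d}"
      have "(\<Sum>i\<in>I. \<Sum>j<d. \<Sum>j'<d. A k j * A l j' * cov_mat (Y i) j j') = (\<Sum>j<d. \<Sum>j'<d. A k j * A l j' * (\<Sum>i\<in>I. cov_mat (Y i) j j'))"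
        unfolding sum_distrib_left by (subst sum.swap) (intro sum.cong refl sum.swap)
      then show "(\<Sum>i\<in>I. H k l * (\<Sum>j<d. \<Sum>j'<d. A k j * A l j' * cov_mat (Y i) j j')) = H k l * (if k = l then 1 else 0)"
        using cov[of k l] kl by (simp add: sum_distrib_left[symmetric])
    qed
    also have "\<dots> = (\<Sum>k<d. H k k)" by (intro sum.cong refl) (simp add: sum_delta_lessThan)
    finally show ?thesis ..
  qed
  have "(\<Sum>i\<in>I. \<integral>z. F i z \<partial>measure_pmf (pair_pmf (Y i) (sum_pmf (I - {i}) Y))) - a / b * (\<Sum>i\<in>I. C i) =
      (\<Sum>i\<in>I. (\<integral>z. F i z \<partial>measure_pmf (pair_pmf (Y i) (sum_pmf (I - {i}) Y))) - a / b * C i)"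
    by (simp add: sum_subtractf sum_distrib_left)
  then have "\<bar>(\<Sum>i\<in>I. \<integral>z. F i z \<partial>measure_pmf (pair_pmf (Y i) (sum_pmf (I - {i}) Y))) - a / b * (\<Sum>i\<in>I. C i)\<bar> \<le>
      (\<Sum>i\<in>I. a / b * (8 * T * sqrt (real d) * sym_third d (Y i) / l))"
    by (simp only:) (intro order_trans[OF sum_abs] sum_mono one)
  also have "\<dots> = a / b * (8 * T * sqrt (real d) * (\<Sum>i\<in>I. sym_third d (Y i)) / l)"
    by (simp add: sum_distrib_left sum_divide_distrib)
  finally show ?thesis unfolding L R[unfolded H_def] .
qed

text \<open>The vector V splits into A (W - \<mu>) and A U. The first part is balanced against the
  trace by \<open>exchange_sum\<close>; the second, having no counterpart in the covariance, is only
  a small error, bounded by \<open>cube_term_bound\<close>.\<close>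

lemma std_law_deriv_bound:
  fixes Y :: "nat \<Rightarrow> (nat \<Rightarrow> int) pmf" and I :: "nat set"
  assumes I: "finite I" and T: "0 \<le> T" "\<And>i. i \<in> I \<Longrightarrow> shift_smooth d T (sum_pmf (I - {i}) Y)"
    and Y: "\<And>i. i \<in> I \<Longrightarrow> third_moment d (Y i)"
    and l: "0 < l" "\<And>y. (\<Sum>k<d. (mat_vec d A y k)\<^sup>2) \<le> (\<Sum>k<d. (y k)\<^sup>2) / l"
    and mu: "\<And>j. j < d \<Longrightarrow> mu j = (\<Sum>i\<in>I. mean_vec (Y i) j)"
    and cov: "\<And>k l. k < d \<Longrightarrow> l < d \<Longrightarrow> (\<Sum>j<d. \<Sum>j'<d. A k j * A l j' * (\<Sum>i\<in>I. cov_mat (Y i) j j')) = (if k = l then 1 else 0)"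
  defines "Q \<equiv> std_law (sum_pmf I Y)"
  shows "k < d \<Longrightarrow> integrable Q (\<lambda>v. v k)"
    and "\<bar>\<integral>v. - (\<Sum>k<d. v k * smooth1 d f a b v k) + a / b * (\<Sum>k<d. smooth2 d f a b v k k) \<partial>Q\<bar>
      \<le> a / b * (8 * T * sqrt (real d) * (\<Sum>i\<in>I. sym_third d (Y i)) / l + real d / (2 * l))"
proof -
  define W where "W = sum_pmf I Y"
  interpret U: prob_space "cube_law d" by (rule prob_space_cube_law)
  interpret W: prob_space "measure_pmf W" by (rule prob_space_measure_pmf)
  interpret P: pair_prob_space "measure_pmf W" "cube_law d" ..
  let ?P = "measure_pmf W \<Otimes>\<^sub>M cube_law d"
  let ?V = "\<lambda>z. std_vec d A mu (\<lambda>i. rvec (fst z) i + snd z i)"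
  have Wi: "integrable (measure_pmf W) (\<lambda>w. mat_vec d A (\<lambda>j. rvec w j - mu j) k)" for k
    unfolding mat_vec_diff mat_vec_def W_def
    by (intro Bochner_Integration.integrable_diff Bochner_Integration.integrable_sum integrable_mult_right
        integrable_sum_pmf_rvec I third_moment_coord) (auto intro: Y)
  have Vk: "?V z k = mat_vec d A (\<lambda>j. rvec (fst z) j - mu j) k + mat_vec d A (snd z) k" if "k < d" for z k
    using that by (simp add: std_vec_def mat_vec_def sum.distrib[symmetric] algebra_simps)
  have p1: "integrable ?P (\<lambda>z. mat_vec d A (\<lambda>j. rvec (fst z) j - mu j) k)" for k
    by (rule integrable_pair_cube_fst[OF Wi])
  have p2: "integrable ?P (\<lambda>z. mat_vec d A (snd z) k)" if "k < d" for k
    by (rule integrable_pair_cube_snd[OF mat_vec_cube(1)[OF that]])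
  show "integrable Q (\<lambda>v. v k)" if k: "k < d" for k
    unfolding Q_def std_law_def W_def[symmetric]
    by (subst integrable_distr_eq) (use k p1 p2[OF k] in \<open>auto simp: Vk\<close>)
  have s1: "\<bar>smooth1 d f a b v k\<bar> \<le> 1" if "k < d" for v k by (rule smooth1_bound[OF that])
  have q1: "integrable ?P (\<lambda>z. mat_vec d A (\<lambda>j. rvec (fst z) j - mu j) k * smooth1 d f a b (?V z) k)" if k: "k < d" for k
    by (rule integrable_test_bounded[OF p1]) (use k s1 in measurable)
  have q2: "integrable ?P (\<lambda>z. mat_vec d A (snd z) k * smooth1 d f a b (?V z) k)" if k: "k < d" for k
    by (rule integrable_test_bounded[OF p2[OF k]]) (use k s1 in measurable)
  have q3: "integrable ?P (\<lambda>z. smooth2 d f a b (?V z) k k)" if k: "k < d" for k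
    by (rule P.integrable_const_bound[where B=2]) (use k smooth2_bound[OF k k] in auto)
  define N1 where "N1 z = (\<Sum>k<d. mat_vec d A (\<lambda>j. rvec (fst z) j - mu j) k * smooth1 d f a b (?V z) k)" for z
  define N2 where "N2 z = (\<Sum>k<d. mat_vec d A (snd z) k * smooth1 d f a b (?V z) k)" for z
  define N3 where "N3 z = (\<Sum>k<d. smooth2 d f a b (?V z) k k)" for z
  have Ni: "integrable ?P N1" "integrable ?P N2" "integrable ?P N3"
    unfolding N1_def N2_def N3_def using q1 q2 q3 by (auto intro!: Bochner_Integration.integrable_sum)
  have E1: "(\<integral>z. N1 z \<partial>?P) = (\<integral>w. (\<Sum>k<d. mat_vec d A (\<lambda>j. rvec w j - mu j) k * avg1 w k) \<partial>measure_pmf W)"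
  proof -
    have "(\<integral>z. N1 z \<partial>?P) = (\<integral>w. \<integral>u. N1 (w, u) \<partial>cube_law d \<partial>measure_pmf W)" by (rule P.integral_fst'[OF Ni(1), symmetric])
    also have "(\<lambda>w. \<integral>u. N1 (w, u) \<partial>cube_law d) = (\<lambda>w. \<Sum>k<d. mat_vec d A (\<lambda>j. rvec w j - mu j) k * avg1 w k)"
      unfolding N1_def avg1_def by (rule ext, subst Bochner_Integration.integral_sum) (auto intro!: integrable_mult_right integrable_cube_smooth)
    finally show ?thesis .
  qed
  have E3: "(\<integral>z. N3 z \<partial>?P) = (\<Sum>k<d. \<integral>w. avg2 w k k \<partial>measure_pmf W)"
    unfolding N3_def avg2_def
    by (subst Bochner_Integration.integral_sum) (use q3 P.integral_fst'[OF q3] in auto)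
  have E2: "\<bar>\<integral>z. N2 z \<partial>?P\<bar> \<le> a / b * (real d / (2 * l))"
  proof -
    have "(\<integral>z. N2 z \<partial>?P) = (\<integral>w. \<integral>u. N2 (w, u) \<partial>cube_law d \<partial>measure_pmf W)" by (rule P.integral_fst'[OF Ni(2), symmetric])
    then show ?thesis
      using abs_expectation_le[OF prob_space_measure_pmf cube_term_bound[OF l], of W rvec] by (simp only: N2_def fst_conv snd_conv)
  qed
  have "(\<integral>v. - (\<Sum>k<d. v k * smooth1 d f a b v k) + a / b * (\<Sum>k<d. smooth2 d f a b v k k) \<partial>Q) =
      (\<integral>z. - (\<Sum>k<d. ?V z k * smooth1 d f a b (?V z) k) + a / b * (\<Sum>k<d. smooth2 d f a b (?V z) k k) \<partial>?P)"
    unfolding Q_def std_law_def W_def[symmetric] by (rule integral_distr) measurable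
  also have "(\<lambda>z. - (\<Sum>k<d. ?V z k * smooth1 d f a b (?V z) k) + a / b * (\<Sum>k<d. smooth2 d f a b (?V z) k k)) = (\<lambda>z. - N1 z - N2 z + a / b * N3 z)"
    unfolding N1_def N2_def N3_def by (rule ext) (simp add: Vk distrib_right sum.distrib)
  also have "(\<integral>z. - N1 z - N2 z + a / b * N3 z \<partial>?P) = - (\<integral>z. N1 z \<partial>?P) - (\<integral>z. N2 z \<partial>?P) + a / b * (\<integral>z. N3 z \<partial>?P)"
    using Ni by simp
  finally have eq: "(\<integral>v. - (\<Sum>k<d. v k * smooth1 d f a b v k) + a / b * (\<Sum>k<d. smooth2 d f a b v k k) \<partial>Q) =
      - (\<integral>z. N1 z \<partial>?P) - (\<integral>z. N2 z \<partial>?P) + a / b * (\<integral>z. N3 z \<partial>?P)" .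
  have ex: "\<bar>(\<integral>z. N1 z \<partial>?P) - a / b * (\<integral>z. N3 z \<partial>?P)\<bar> \<le> a / b * (8 * T * sqrt (real d) * (\<Sum>i\<in>I. sym_third d (Y i)) / l)"
    unfolding E1 E3 unfolding W_def by (rule exchange_sum[OF I T Y l mu cov])
  show "\<bar>\<integral>v. - (\<Sum>k<d. v k * smooth1 d f a b v k) + a / b * (\<Sum>k<d. smooth2 d f a b v k k) \<partial>Q\<bar>
      \<le> a / b * (8 * T * sqrt (real d) * (\<Sum>i\<in>I. sym_third d (Y i)) / l + real d / (2 * l))"
    unfolding eq distrib_left using ex E2 by linarith
qed

end

section \<open>The discrete normal law\<close>

lemma countable_zvec: "countable (zvec d)"
proof -
  have "zvec d \<subseteq> (\<lambda>f k. if k < d then f k else 0) ` (Pi\<^sub>E {..<d} (\<lambda>_. UNIV :: int set))"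
  proof
    fix x assume x: "x \<in> zvec d"
    have "x = (\<lambda>k. if k < d then (restrict x {..<d}) k else 0)" using x by (auto simp: zvec_def fun_eq_iff)
    then show "x \<in> (\<lambda>f k. if k < d then f k else 0) ` (Pi\<^sub>E {..<d} (\<lambda>_. UNIV :: int set))"
      by (intro image_eqI[where x="restrict x {..<d}"]) (assumption, simp)
  qed
  moreover have "countable (Pi\<^sub>E {..<d} (\<lambda>_. UNIV :: int set))" by (intro countable_PiE) auto
  ultimately show ?thesis by (rule countable_subset[OF _ countable_image])
qed

text \<open>Every subset of the target is measurable, although there are uncountably many integer
  sequences. The map takes values in the countable set \<open>zvec d\<close>, so preimages of single
  points suffice.\<close>

lemma measurable_round_box: "round_box d \<in> measurable (vecs d) (count_space UNIV)"
proof (rule measurableI)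
  fix E :: "(nat \<Rightarrow> int) set"
  have single: "{x \<in> space (vecs d). \<forall>k\<in>{..<d}. \<lfloor>x k + 1 / 2\<rfloor> = a k} \<in> sets (vecs d)" for a :: "nat \<Rightarrow> int"
    by measurable
  have "round_box d -` E \<inter> space (vecs d) = (\<Union>a\<in>E \<inter> zvec d. {x \<in> space (vecs d). \<forall>k\<in>{..<d}. \<lfloor>x k + 1 / 2\<rfloor> = a k})"
  proof (rule equalityI; rule subsetI)
    fix x assume "x \<in> round_box d -` E \<inter> space (vecs d)"
    then show "x \<in> (\<Union>a\<in>E \<inter> zvec d. {x \<in> space (vecs d). \<forall>k\<in>{..<d}. \<lfloor>x k + 1 / 2\<rfloor> = a k})"
      by (intro UN_I[of "round_box d x"]) (auto simp: round_box_def zvec_def)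
  next
    fix x assume "x \<in> (\<Union>a\<in>E \<inter> zvec d. {x \<in> space (vecs d). \<forall>k\<in>{..<d}. \<lfloor>x k + 1 / 2\<rfloor> = a k})"
    then obtain a where a: "a \<in> E" "a \<in> zvec d" "x \<in> space (vecs d)" "\<forall>k<d. \<lfloor>x k + 1 / 2\<rfloor> = a k" by auto
    then have "round_box d x = a" by (auto simp: round_box_def zvec_def fun_eq_iff)
    then show "x \<in> round_box d -` E \<inter> space (vecs d)" using a by simp
  qed
  also have "\<dots> \<in> sets (vecs d)"
    by (intro sets.countable_UN'' countable_Int2 countable_zvec single)
  finally show "round_box d -` E \<inter> space (vecs d) \<in> sets (vecs d)" .
qed simp

definition round_test :: "nat \<Rightarrow> (nat \<Rightarrow> nat \<Rightarrow> real) \<Rightarrow> (nat \<Rightarrow> real) \<Rightarrow> (nat \<Rightarrow> int) set \<Rightarrow> (nat \<Rightarrow> real) \<Rightarrow> real" where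
  "round_test d B mu E g = indicator E (round_box d (\<lambda>i\<in>{..<d}. mu i + (\<Sum>j<d. B i j * g j)))"

lemma measurable_round_test [measurable]: "round_test d B mu E \<in> borel_measurable (vecs d)"
proof -
  have "(\<lambda>g. \<lambda>i\<in>{..<d}. mu i + (\<Sum>j<d. B i j * g j)) \<in> measurable (vecs d) (vecs d)" by measurable
  from measurable_compose[OF measurable_compose[OF this measurable_round_box], of "indicator E" borel]
  show ?thesis by (simp add: round_test_def[abs_def])
qed

lemma bounded_test_round_test: "bounded_test d (round_test d B mu E)"
  by unfold_locales (auto simp: round_test_def indicator_def)

text \<open>At the image of x the quadratic form is |A B x|^2 = |x|^2, and det S is the square of
  the product of the diagonal of B, so the determinant factor of the density cancels the
  Jacobian.\<close>

lemma normal_d_eq_distr: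
  assumes B: "is_cholesky d S B" and A: "is_lower_inverse d B A"
  shows "normal_d d mu S = distr (std_gauss d) (vecs d) (\<lambda>x. \<lambda>i\<in>{..<d}. mu i + (\<Sum>j<d. B i j * x j))"
  unfolding normal_d_def
proof (rule distr_std_gauss_lower_triangular[symmetric])
  show "B i j = 0" if "i < j" for i j using B that by (simp add: is_cholesky_def)
  show "0 < B i i" if "i < d" for i using B that by (simp add: is_cholesky_def)
  show "normal_density_d d mu S \<in> borel_measurable (vecs d)"
    unfolding normal_density_d_def by measurable
  fix x :: "nat \<Rightarrow> real"
  let ?T = "\<lambda>i\<in>{..<d}. mu i + (\<Sum>j<d. B i j * x j)"
  have D: "0 < (\<Prod>i<d. B i i)" using B by (intro prod_pos) (auto simp: is_cholesky_def)
  have T: "?T i - mu i = mat_vec d B x i" if "i < d" for i using that by (simp add: mat_vec_def)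
  have "(\<Sum>i<d. \<Sum>j<d. (?T i - mu i) * mat_inv d S i j * (?T j - mu j)) =
      (\<Sum>i<d. \<Sum>j<d. \<Sum>k<d. A k i * mat_vec d B x i * (A k j * mat_vec d B x j))"
  proof (intro sum.cong refl)
    fix i j assume ij: "i \<in> {..<d}" "j \<in> {..<d}"
    have inv: "mat_inv d S i j = (\<Sum>k<d. A k i * A k j)" using mat_inv_cholesky[OF B A] ij by simp
    have T': "?T i - mu i = mat_vec d B x i" "?T j - mu j = mat_vec d B x j" using T ij by auto
    show "(?T i - mu i) * mat_inv d S i j * (?T j - mu j) = (\<Sum>k<d. A k i * mat_vec d B x i * (A k j * mat_vec d B x j))"
      unfolding T' inv sum_distrib_left sum_distrib_right by (intro sum.cong refl) (simp add: mult_ac)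
  qed
  also have "\<dots> = (\<Sum>i<d. \<Sum>k<d. \<Sum>j<d. A k i * mat_vec d B x i * (A k j * mat_vec d B x j))"
    by (intro sum.cong refl sum.swap)
  also have "\<dots> = (\<Sum>k<d. \<Sum>i<d. \<Sum>j<d. A k i * mat_vec d B x i * (A k j * mat_vec d B x j))" by (rule sum.swap)
  also have "\<dots> = (\<Sum>k<d. (mat_vec d A (mat_vec d B x) k)\<^sup>2)"
    unfolding mat_vec_def[of d A] power2_eq_square sum_product ..
  also have "\<dots> = (\<Sum>k<d. (x k)\<^sup>2)" by (intro sum.cong refl) (simp add: mat_vec_inverse(1)[OF A])
  finally have q: "(\<Sum>i<d. \<Sum>j<d. (?T i - mu i) * mat_inv d S i j * (?T j - mu j)) = (\<Sum>k<d. (x k)\<^sup>2)" .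
  have p: "(2 * pi) powr (- real d / 2) = (1 / sqrt (2 * pi)) ^ d"
  proof -
    have "(2 * pi) powr (- real d / 2) = ((2 * pi) powr (- 1 / 2)) powr real d" by (simp add: powr_powr)
    also have "\<dots> = ((2 * pi) powr (- 1 / 2)) ^ d" by (simp add: powr_realpow)
    also have "(2 * pi) powr (- 1 / 2) = 1 / sqrt (2 * pi)"
      using powr_half_sqrt[of "2 * pi"] by (simp add: powr_minus_divide)
    finally show ?thesis .
  qed
  have dt: "mat_det d S powr (- 1 / 2) = 1 / (\<Prod>i<d. B i i)"
  proof -
    have "mat_det d S powr (- 1 / 2) = 1 / (mat_det d S powr (1 / 2))" by (simp add: powr_minus_divide)
    also have "mat_det d S powr (1 / 2) = (\<Prod>i<d. B i i)"
      unfolding mat_det_cholesky[OF B] using D by (simp add: powr_half_sqrt)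
    finally show ?thesis .
  qed
  show "(\<Prod>i<d. B i i) * normal_density_d d mu S ?T = (\<Prod>i<d. std_normal_density (x i))"
  proof -
    have "P * (c * (1 / P) * e) = c * e" if "0 < P" for P c e :: real using that by simp
    from this[OF D] show ?thesis unfolding normal_density_d_def q p dt prod_std_normal_density by simp
  qed
qed

lemma measure_discrete_normal:
  assumes B: "is_cholesky d S B" and A: "is_lower_inverse d B A"
  shows "measure (discrete_normal d mu S) E = (\<integral>g. round_test d B mu E g \<partial>std_gauss d)"
proof -
  let ?T = "\<lambda>x. \<lambda>i\<in>{..<d}. mu i + (\<Sum>j<d. B i j * x j)"
  have T: "?T \<in> measurable (std_gauss d) (vecs d)" by measurable
  have R: "round_box d \<in> measurable (distr (std_gauss d) (vecs d) ?T) (count_space UNIV)"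
    using measurable_round_box by simp
  interpret G: prob_space "std_gauss d" by (rule prob_space_std_gauss)
  have R': "(\<lambda>x. round_box d (?T x)) \<in> measurable (std_gauss d) (count_space UNIV)"
    by (rule measurable_compose[OF T measurable_round_box])
  have "discrete_normal d mu S = distr (std_gauss d) (count_space UNIV) (\<lambda>x. round_box d (?T x))"
    unfolding discrete_normal_def normal_d_eq_distr[OF B A]
    by (subst distr_distr[OF measurable_round_box T]) (simp add: comp_def)
  then have "measure (discrete_normal d mu S) E = (\<integral>z. indicator E z \<partial>distr (std_gauss d) (count_space UNIV) (\<lambda>x. round_box d (?T x)))"
    by simp
  also have "\<dots> = (\<integral>g. round_test d B mu E g \<partial>std_gauss d)"
    unfolding round_test_def by (rule integral_distr[OF R']) simp
  finally show ?thesis .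
qed

text \<open>A displacement of size \<rho> can leave the cell only from within \<rho> of an endpoint,
  and the two strips there have length \<rho> each.\<close>

lemma unif_half_boundary:
  assumes "0 \<le> \<rho>"
  shows "(\<integral>x. (if 1 / 2 \<le> \<bar>x\<bar> + \<rho> then 1 else 0) \<partial>unif_half) \<le> 2 * \<rho>"
proof -
  let ?U = "{-1/2..-1/2 + \<rho>} :: real set" and ?V = "{1/2 - \<rho>..1/2} :: real set"
  have i: "integrable lborel (indicator ?U :: real \<Rightarrow> real)" "integrable lborel (indicator ?V :: real \<Rightarrow> real)"
    using assms by (auto intro!: integrable_real_indicator)
  have "(\<integral>x. (if 1 / 2 \<le> \<bar>x\<bar> + \<rho> then 1 else 0) \<partial>unif_half) =
      (\<integral>x. indicator {-1/2..<1/2} x * (if 1 / 2 \<le> \<bar>x\<bar> + \<rho> then 1 else 0 :: real) \<partial>lborel)"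
    unfolding unif_half_def by (subst integral_density) auto
  also have "\<dots> \<le> (\<integral>x. indicator ?U x + indicator ?V x \<partial>lborel)"
  proof (rule integral_mono_AE')
    show "integrable lborel (\<lambda>x. indicator ?U x + indicator ?V x :: real)" by (rule Bochner_Integration.integrable_add[OF i])
  qed (auto simp: indicator_def abs_if)
  also have "\<dots> = 2 * \<rho>" using i assms by simp
  finally show ?thesis .
qed

locale chol_test =
  fixes d :: nat and S B A :: "nat \<Rightarrow> nat \<Rightarrow> real" and mu :: "nat \<Rightarrow> real" and E :: "(nat \<Rightarrow> int) set"
  assumes B: "is_cholesky d S B" and A: "is_lower_inverse d B A"
begin

sublocale bounded_test d "round_test d B mu E"
  by (rule bounded_test_round_test)

text \<open>Since B undoes A, the point to be rounded is w + u plus the displacement -(1 - a) (w -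
  \<mu> + u) + b B g. Rounding still returns w unless this displacement carries some u_k across a
  cell boundary, an event controlled by the strip estimate.\<close>

lemma smooth0_start:
  assumes w: "w \<in> zvec d" and a: "0 \<le> a" "a \<le> 1" and b: "0 < b"
  shows "\<bar>(\<integral>u. smooth0 d (round_test d B mu E) a b (std_vec d A mu (\<lambda>i. rvec w i + u i)) \<partial>cube_law d) - indicator E w\<bar>
    \<le> (\<Sum>k<d. 2 * ((1 - a) * (\<bar>rvec w k - mu k\<bar> + 1 / 2) + b * ((1 + S k k) / 2)))"
proof -
  interpret U: prob_space "cube_law d" by (rule prob_space_cube_law)
  interpret G: prob_space "std_gauss d" by (rule prob_space_std_gauss)
  interpret P: pair_prob_space "cube_law d" "std_gauss d" ..
  let ?f = "round_test d B mu E"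
  let ?V = "\<lambda>u. std_vec d A mu (\<lambda>i. rvec w i + u i)"
  define \<rho> where "\<rho> k g = (1 - a) * (\<bar>rvec w k - mu k\<bar> + 1 / 2) + b * \<bar>mat_vec d B g k\<bar>" for k g
  \<comment> \<open>An indicator dominating misrounding in coordinate \<open>k\<close>;
    \<open>\<rho> k g\<close> bounds the displacement whenever |u_k| <= 1/2.\<close>
  define J where "J k u g = (if 1 / 2 \<le> \<bar>u k\<bar> + \<rho> k g then 1 else 0 :: real)" for k and u g :: "nat \<Rightarrow> real"
  have \<rho>0: "0 \<le> \<rho> k g" for k g
    unfolding \<rho>_def by (intro add_nonneg_nonneg mult_nonneg_nonneg) (use a b in simp_all)
  have pos: "mu i + (\<Sum>j<d. B i j * affine_vec d a (?V u) b g j) = mu i + a * (rvec w i + u i - mu i) + b * mat_vec d B g i"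
    if i: "i < d" for i u g
  proof -
    have "(\<Sum>j<d. B i j * affine_vec d a (?V u) b g j) = a * mat_vec d B (mat_vec d A (\<lambda>j. rvec w j + u j - mu j)) i + b * mat_vec d B g i"
    proof -
      have "(\<Sum>j<d. B i j * affine_vec d a (?V u) b g j) =
          (\<Sum>j<d. a * (B i j * mat_vec d A (\<lambda>j. rvec w j + u j - mu j) j) + b * (B i j * g j))"
      proof (intro sum.cong refl)
        fix j assume "j \<in> {..<d}"
        then have "affine_vec d a (?V u) b g j = a * mat_vec d A (\<lambda>j. rvec w j + u j - mu j) j + b * g j"
          by (simp add: affine_vec_def std_vec_def)
        then show "B i j * affine_vec d a (?V u) b g j = a * (B i j * mat_vec d A (\<lambda>j. rvec w j + u j - mu j) j) + b * (B i j * g j)"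
          by (simp only: distrib_left mult.left_commute)
      qed
      then show ?thesis unfolding mat_vec_def[of d B] sum.distrib sum_distrib_left .
    qed
    then show ?thesis using mat_vec_inverse(2)[OF A i] by simp
  qed
  have pt: "\<bar>?f (affine_vec d a (?V u) b g) - indicator E w\<bar> \<le> (\<Sum>k<d. J k u g)" if u: "\<forall>k<d. \<bar>u k\<bar> \<le> 1 / 2" for u g
  proof (cases "\<exists>k<d. 1 / 2 \<le> \<bar>u k\<bar> + \<rho> k g")
    case True
    then obtain k where k: "k < d" "1 / 2 \<le> \<bar>u k\<bar> + \<rho> k g" by blast
    have "J k u g \<le> (\<Sum>k<d. J k u g)" by (rule member_le_sum) (use k in \<open>auto simp: J_def\<close>)
    moreover have "\<bar>?f (affine_vec d a (?V u) b g) - indicator E w\<bar> \<le> 1" by (auto simp: round_test_def indicator_def)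
    ultimately show ?thesis using k by (simp add: J_def)
  next
    case False
    have "round_box d (\<lambda>i\<in>{..<d}. mu i + (\<Sum>j<d. B i j * affine_vec d a (?V u) b g j)) = w"
    proof (rule ext)
      fix k
      show "round_box d (\<lambda>i\<in>{..<d}. mu i + (\<Sum>j<d. B i j * affine_vec d a (?V u) b g j)) k = w k"
      proof (cases "k < d")
        case k: True
        let ?r = "- (1 - a) * (rvec w k - mu k + u k) + b * mat_vec d B g k"
        have "\<bar>?r\<bar> \<le> \<bar>(1 - a) * (rvec w k - mu k + u k)\<bar> + \<bar>b * mat_vec d B g k\<bar>" by linarith
        also have "\<dots> \<le> \<rho> k g"
        proof -
          have "\<bar>rvec w k - mu k + u k\<bar> \<le> \<bar>rvec w k - mu k\<bar> + 1 / 2" using u k by (intro order_trans[OF abs_triangle_ineq]) auto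
          then show ?thesis unfolding \<rho>_def abs_mult using a b by (intro add_mono mult_mono) auto
        qed
        finally have "\<bar>?r\<bar> \<le> \<rho> k g" .
        moreover have "\<bar>u k\<bar> + \<rho> k g < 1 / 2" using False k by (meson not_le)
        ultimately have "\<bar>u k + ?r\<bar> < 1 / 2" using abs_triangle_ineq[of "u k" ?r] by linarith
        moreover have "mu k + a * (rvec w k + u k - mu k) + b * mat_vec d B g k = rvec w k + (u k + ?r)" by (simp add: algebra_simps)
        ultimately have "\<lfloor>mu k + a * (rvec w k + u k - mu k) + b * mat_vec d B g k + 1 / 2\<rfloor> = w k"
          unfolding rvec_def floor_eq_iff abs_less_iff by linarith
        then show ?thesis using k pos[OF k] by (simp add: round_box_def add.assoc)
      next
        case k: False
        then show ?thesis using w by (simp add: round_box_def zvec_def)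
      qed
    qed
    then show ?thesis by (simp add: round_test_def J_def sum_nonneg)
  qed
  have gm[measurable]: "(\<lambda>z. snd z k) \<in> borel_measurable (cube_law d \<Otimes>\<^sub>M std_gauss d)" if "k < d" for k
  proof -
    have "snd \<in> measurable (cube_law d \<Otimes>\<^sub>M std_gauss d) (vecs d)" using measurable_snd[of "cube_law d" "std_gauss d"] by simp
    then show ?thesis by (rule measurable_compose) (use that in simp)
  qed
  have um[measurable]: "(\<lambda>z. fst z k) \<in> borel_measurable (cube_law d \<Otimes>\<^sub>M std_gauss d)" if "k < d" for k
  proof -
    have "fst \<in> measurable (cube_law d \<Otimes>\<^sub>M std_gauss d) (vecs d)" using measurable_fst[of "cube_law d" "std_gauss d"] by simp
    then show ?thesis by (rule measurable_compose) (use that in simp)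
  qed
  have Ji: "integrable (cube_law d \<Otimes>\<^sub>M std_gauss d) (\<lambda>(u, g). J k u g)" if k: "k < d" for k
  proof (rule P.integrable_const_bound[where B=1])
    have "(\<lambda>z. \<bar>fst z k\<bar> + \<rho> k (snd z)) \<in> borel_measurable (cube_law d \<Otimes>\<^sub>M std_gauss d)"
      unfolding \<rho>_def mat_vec_def using k by measurable
    then show "(\<lambda>(u, g). J k u g) \<in> borel_measurable (cube_law d \<Otimes>\<^sub>M std_gauss d)"
      unfolding J_def case_prod_beta by measurable
  qed (auto simp: J_def)
  have Jg: "integrable (std_gauss d) (\<lambda>g. J k u g)" if k: "k < d" for k u
  proof (rule G.integrable_const_bound[where B=1])
    have [measurable]: "(\<lambda>g. \<rho> k g) \<in> borel_measurable (vecs d)" unfolding \<rho>_def mat_vec_def by measurable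
    show "(\<lambda>g. J k u g) \<in> borel_measurable (std_gauss d)" unfolding J_def by measurable
  qed (auto simp: J_def)
  have fi: "integrable (std_gauss d) (\<lambda>g. ?f (affine_vec d a v b g))" for v
    using integrable_test_mult[of "\<lambda>_. 1" a v b] by simp
  have s0: "\<bar>smooth0 d ?f a b v\<bar> \<le> 1" for v
    unfolding smooth0_def by (rule abs_expectation_le[OF prob_space_std_gauss f_bound])
  have Vm: "(\<lambda>u. ?V u) \<in> measurable (cube_law d) (vecs d)"
  proof -
    have "(\<lambda>u. \<lambda>i\<in>{..<d}. rvec w i + u i) \<in> measurable (vecs d) (vecs d)" by measurable
    from measurable_compose[OF this measurable_std_vec] show ?thesis by simp
  qed
  have s0m: "(\<lambda>u. smooth0 d ?f a b (?V u)) \<in> borel_measurable (cube_law d)"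
    by (rule measurable_smooth(1)[OF measurable_round_test _ _ Vm]) auto
  have s0i: "integrable (cube_law d) (\<lambda>u. smooth0 d ?f a b (?V u))"
    by (rule U.integrable_const_bound[where B=1]) (use s0 s0m in auto)
  have eq: "(\<integral>u. smooth0 d ?f a b (?V u) \<partial>cube_law d) - indicator E w = (\<integral>u. smooth0 d ?f a b (?V u) - indicator E w \<partial>cube_law d)"
    using s0i U.prob_space by simp
  have "\<bar>(\<integral>u. smooth0 d ?f a b (?V u) \<partial>cube_law d) - indicator E w\<bar> \<le> (\<integral>u. \<bar>smooth0 d ?f a b (?V u) - indicator E w\<bar> \<partial>cube_law d)"
    unfolding eq by (rule integral_abs_bound)
  also have "\<dots> \<le> (\<integral>u. (\<Sum>k<d. \<integral>g. J k u g \<partial>std_gauss d) \<partial>cube_law d)"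
  proof (rule integral_mono_AE)
    show "integrable (cube_law d) (\<lambda>u. \<bar>smooth0 d ?f a b (?V u) - indicator E w\<bar>)" using s0i by simp
    show "integrable (cube_law d) (\<lambda>u. \<Sum>k<d. \<integral>g. J k u g \<partial>std_gauss d)"
      by (intro Bochner_Integration.integrable_sum P.integrable_fst Ji) auto
    show "AE u in cube_law d. \<bar>smooth0 d ?f a b (?V u) - indicator E w\<bar> \<le> (\<Sum>k<d. \<integral>g. J k u g \<partial>std_gauss d)"
      using AE_cube_law_abs[of d]
    proof eventually_elim
      fix u :: "nat \<Rightarrow> real" assume u: "\<forall>k<d. \<bar>u k\<bar> \<le> 1 / 2"
      have e: "smooth0 d ?f a b (?V u) - indicator E w = (\<integral>g. ?f (affine_vec d a (?V u) b g) - indicator E w \<partial>std_gauss d)"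
        unfolding smooth0_def using fi G.prob_space by simp
      have "\<bar>smooth0 d ?f a b (?V u) - indicator E w\<bar> \<le> (\<integral>g. \<bar>?f (affine_vec d a (?V u) b g) - indicator E w\<bar> \<partial>std_gauss d)"
        unfolding e by (rule integral_abs_bound)
      also have "\<dots> \<le> (\<integral>g. (\<Sum>k<d. J k u g) \<partial>std_gauss d)"
        by (rule integral_mono[OF _ _ pt[OF u]]) (use fi Jg in \<open>auto intro!: Bochner_Integration.integrable_sum\<close>)
      also have "\<dots> = (\<Sum>k<d. \<integral>g. J k u g \<partial>std_gauss d)" by (rule Bochner_Integration.integral_sum) (use Jg in auto)
      finally show "\<bar>smooth0 d ?f a b (?V u) - indicator E w\<bar> \<le> (\<Sum>k<d. \<integral>g. J k u g \<partial>std_gauss d)" .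
    qed
  qed
  also have "\<dots> = (\<Sum>k<d. \<integral>u. \<integral>g. J k u g \<partial>std_gauss d \<partial>cube_law d)"
    by (rule Bochner_Integration.integral_sum) (use P.integrable_fst[OF Ji] in auto)
  also have "\<dots> \<le> (\<Sum>k<d. 2 * ((1 - a) * (\<bar>rvec w k - mu k\<bar> + 1 / 2) + b * ((1 + S k k) / 2)))"
  proof (intro sum_mono)
    fix k assume "k \<in> {..<d}"
    then have k: "k < d" by simp
    \<comment> \<open>With g fixed the strip width is a constant, and only the uniform variable u_k
      is random. Afterwards |t| <= (1 + t^2) / 2 lets E (B G)_k^2 = S_kk finish the
      estimate.\<close>
    have "(\<integral>u. \<integral>g. J k u g \<partial>std_gauss d \<partial>cube_law d) = (\<integral>g. \<integral>u. J k u g \<partial>cube_law d \<partial>std_gauss d)"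
      by (rule P.Fubini_integral[OF Ji[OF k], symmetric])
    also have "\<dots> \<le> (\<integral>g. 2 * ((1 - a) * (\<bar>rvec w k - mu k\<bar> + 1 / 2) + b * ((1 + (mat_vec d B g k)\<^sup>2) / 2)) \<partial>std_gauss d)"
    proof (rule integral_mono)
      show "integrable (std_gauss d) (\<lambda>g. \<integral>u. J k u g \<partial>cube_law d)" by (rule P.integrable_snd[OF Ji[OF k]])
      show "integrable (std_gauss d) (\<lambda>g. 2 * ((1 - a) * (\<bar>rvec w k - mu k\<bar> + 1 / 2) + b * ((1 + (mat_vec d B g k)\<^sup>2) / 2)))"
        unfolding mat_vec_def using std_gauss_integrable_linear_square(1)[of "B k"] by simp
      fix g
      have "(\<integral>u. J k u g \<partial>cube_law d) = (\<integral>x. (if 1 / 2 \<le> \<bar>x\<bar> + \<rho> k g then 1 else 0) \<partial>distr (cube_law d) unif_half (\<lambda>u. u k))"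
        unfolding J_def by (rule integral_distr[OF measurable_cube_law_component[OF k], symmetric]) measurable
      also have "\<dots> \<le> 2 * \<rho> k g" unfolding distr_cube_law_component[OF k] by (rule unif_half_boundary[OF \<rho>0])
      also have "\<dots> \<le> 2 * ((1 - a) * (\<bar>rvec w k - mu k\<bar> + 1 / 2) + b * ((1 + (mat_vec d B g k)\<^sup>2) / 2))"
      proof -
        have "\<bar>mat_vec d B g k\<bar> \<le> (1 + (mat_vec d B g k)\<^sup>2) / 2"
          using zero_le_power2[of "\<bar>mat_vec d B g k\<bar> - 1"] by (simp add: power2_eq_square algebra_simps)
        then show ?thesis unfolding \<rho>_def using b by (intro mult_left_mono add_left_mono) auto
      qed
      finally show "(\<integral>u. J k u g \<partial>cube_law d) \<le> 2 * ((1 - a) * (\<bar>rvec w k - mu k\<bar> + 1 / 2) + b * ((1 + (mat_vec d B g k)\<^sup>2) / 2))" .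
    qed
    also have "\<dots> = 2 * ((1 - a) * (\<bar>rvec w k - mu k\<bar> + 1 / 2) + b * ((1 + S k k) / 2))"
    proof -
      have "S k k = (\<Sum>j<d. (B k j)\<^sup>2)" using B k by (simp add: is_cholesky_def power2_eq_square)
      then have "integrable (std_gauss d) (\<lambda>g. (mat_vec d B g k)\<^sup>2)" "(\<integral>g. (mat_vec d B g k)\<^sup>2 \<partial>std_gauss d) = S k k"
        unfolding mat_vec_def using std_gauss_integrable_linear_square[of "B k"] by simp_all
      then show ?thesis using G.prob_space by simp
    qed
    finally show "(\<integral>u. \<integral>g. J k u g \<partial>std_gauss d \<partial>cube_law d) \<le> 2 * ((1 - a) * (\<bar>rvec w k - mu k\<bar> + 1 / 2) + b * ((1 + S k k) / 2))" .
  qed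
  finally show ?thesis .
qed

end

text \<open>A S A^T = (A B) (A B)^T, the identity.\<close>

lemma cholesky_whitening:
  assumes B: "is_cholesky d S B" and A: "is_lower_inverse d B A" and "k < d" "l < d"
  shows "(\<Sum>j<d. \<Sum>j'<d. A k j * A l j' * S j j') = (if k = l then 1 else 0)"
proof -
  have "(\<Sum>j<d. \<Sum>j'<d. A k j * A l j' * S j j') = (\<Sum>j<d. \<Sum>j'<d. \<Sum>n<d. A k j * B j n * (A l j' * B j' n))"
  proof (intro sum.cong refl)
    fix j j' assume "j \<in> {..<d}" "j' \<in> {..<d}"
    then have "S j j' = (\<Sum>n<d. B j n * B j' n)" using B by (simp add: is_cholesky_def)
    then show "A k j * A l j' * S j j' = (\<Sum>n<d. A k j * B j n * (A l j' * B j' n))"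
      by (simp only: sum_distrib_left) (simp add: mult_ac)
  qed
  also have "\<dots> = (\<Sum>j<d. \<Sum>n<d. \<Sum>j'<d. A k j * B j n * (A l j' * B j' n))"
    by (intro sum.cong refl sum.swap)
  also have "\<dots> = (\<Sum>n<d. \<Sum>j<d. \<Sum>j'<d. A k j * B j n * (A l j' * B j' n))" by (rule sum.swap)
  also have "\<dots> = (\<Sum>n<d. (\<Sum>j<d. A k j * B j n) * (\<Sum>j'<d. A l j' * B j' n))"
    by (simp add: sum_product)
  also have "\<dots> = (\<Sum>n<d. (if k = n then 1 else 0) * (if l = n then 1 else 0))"
    using A assms(3,4) by (intro sum.cong refl) (simp add: is_lower_inverse_def)
  also have "\<dots> = (if k = l then 1 else 0)" using assms(3) by (subst sum_delta_lessThan) auto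
  finally show ?thesis .
qed

section \<open>Assembling the total variation bound\<close>

context chol_test
begin

text \<open>The logarithmic term is the interpolation from sin \<phi> = b up to \<pi>/2, and the
  term linear in \<open>b\<close> is the rounding error at the start. \<open>b\<close> stays free
  here, to be balanced against the number of summands later.\<close>

lemma total_bound:
  fixes Y :: "nat \<Rightarrow> (nat \<Rightarrow> int) pmf" and I :: "nat set"
  assumes I: "finite I" and T: "0 \<le> T" "\<And>i. i \<in> I \<Longrightarrow> shift_smooth d T (sum_pmf (I - {i}) Y)"
    and Y: "\<And>i. i \<in> I \<Longrightarrow> third_moment d (Y i)" and Yz: "\<And>i. i \<in> I \<Longrightarrow> set_pmf (Y i) \<subseteq> zvec d"
    and l: "0 < l" "\<And>v. l * (\<Sum>k<d. (v k)\<^sup>2) \<le> quad_form d S v"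
    and mu: "\<And>j. mu j = (\<Sum>i\<in>I. mean_vec (Y i) j)"
    and S: "\<And>j k. S j k = (\<Sum>i\<in>I. cov_mat (Y i) j k)"
    and b: "0 < b" "b \<le> 1"
  shows "\<bar>measure (measure_pmf (sum_pmf I Y)) E - measure (discrete_normal d mu S) E\<bar> \<le>
    (8 * T * sqrt (real d) * (\<Sum>i\<in>I. sym_third d (Y i)) / l + real d / (2 * l)) * ln (1 / b)
    + b * (real d * (real (card I) + 2) + 2 * mat_trace d S)"
proof -
  let ?f = "round_test d B mu E"
  define W where "W = sum_pmf I Y"
  define \<phi>0 where "\<phi>0 = arcsin b"
  have \<phi>0: "0 < \<phi>0" "\<phi>0 \<le> pi / 2" "sin \<phi>0 = b"
    using b arcsin_less_arcsin[of 0 b] arcsin_bounded[of b] by (auto simp: \<phi>0_def)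
  define a where "a = cos \<phi>0"
  have a0: "0 \<le> a" "a \<le> 1" using \<phi>0 cos_ge_zero[of \<phi>0] by (auto simp: a_def)
  have a1: "1 - a \<le> b"
  proof -
    \<comment> \<open>On the unit circle in the first quadrant a + b >= a^2 + b^2 = 1.\<close>
    have "a\<^sup>2 + b\<^sup>2 = 1" using \<phi>0(3) by (simp add: a_def flip: \<phi>0(3))
    moreover have "a\<^sup>2 \<le> a" "b\<^sup>2 \<le> b" using a0 b by (simp_all add: power2_eq_square mult_left_le_one_le)
    ultimately show ?thesis by linarith
  qed
  define K where "K = 8 * T * sqrt (real d) * (\<Sum>i\<in>I. sym_third d (Y i)) / l + real d / (2 * l)"
  have Al: "(\<Sum>k<d. (mat_vec d A y k)\<^sup>2) \<le> (\<Sum>k<d. (y k)\<^sup>2) / l" for y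
    by (rule cholesky_inverse_norm_le[OF B A l])
  have cov: "(\<Sum>j<d. \<Sum>j'<d. A k j * A l j' * (\<Sum>i\<in>I. cov_mat (Y i) j j')) = (if k = l then 1 else 0)" if "k < d" "l < d" for k l
    using cholesky_whitening[OF B A that] by (simp add: S)
  have ct: "cube_test d ?f (cos \<phi>) (sin \<phi>)" if "\<phi>0 \<le> \<phi>" "\<phi> \<le> pi / 2" for \<phi>
  proof unfold_locales
    show "0 \<le> cos \<phi>" using that \<phi>0 by (intro cos_ge_zero) auto
    show "0 < sin \<phi>" using that \<phi>0 pi_gt_zero by (intro sin_gt_zero) auto
  qed
  interpret c0: cube_test d ?f "cos \<phi>0" "sin \<phi>0" A mu by (rule ct) (use \<phi>0 in auto)
  define Q where "Q = c0.std_law W"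
  have Qp: "prob_space Q" "sets Q = sets (vecs d)" unfolding Q_def by (rule c0.std_law_prob)+
  have Qi: "integrable Q (\<lambda>v. v k)" if "k < d" for k
    unfolding Q_def W_def by (rule c0.std_law_deriv_bound(1)[OF I T Y l(1) Al _ cov that]) (simp_all add: mu)
  have J: "\<bar>\<integral>v. angle_deriv \<phi> v \<partial>Q\<bar> \<le> K * (cos \<phi> / sin \<phi>)" if \<phi>: "\<phi>0 \<le> \<phi>" "\<phi> \<le> pi / 2" for \<phi>
  proof -
    interpret c: cube_test d ?f "cos \<phi>" "sin \<phi>" A mu by (rule ct[OF \<phi>])
    show ?thesis
      unfolding Q_def W_def angle_deriv_def K_def mult.commute[of _ "cos \<phi> / sin \<phi>"]
      by (rule c.std_law_deriv_bound(2)[OF I T Y l(1) Al _ cov]) (simp_all add: mu)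
  qed
  have main: "\<bar>(\<integral>v. smooth0 d ?f a b v \<partial>Q) - (\<integral>g. ?f g \<partial>std_gauss d)\<bar> \<le> K * ln (1 / b)"
    using smooth0_interpolation[OF Qp Qi \<phi>0(1,2) J] unfolding a_def \<phi>0(3) by simp
  interpret U: prob_space "cube_law d" by (rule prob_space_cube_law)
  interpret W: prob_space "measure_pmf W" by (rule prob_space_measure_pmf)
  interpret P: pair_prob_space "measure_pmf W" "cube_law d" ..
  let ?h = "\<lambda>w. \<integral>u. smooth0 d ?f a b (std_vec d A mu (\<lambda>i. rvec w i + u i)) \<partial>cube_law d"
  have s0: "\<bar>smooth0 d ?f a b v\<bar> \<le> 1" for v
    unfolding smooth0_def by (rule abs_expectation_le[OF prob_space_std_gauss f_bound])
  have s0m: "smooth0 d ?f a b \<in> borel_measurable (vecs d)"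
    by (rule measurable_smooth(1)[OF measurable_round_test]) auto
  have QW: "(\<integral>v. smooth0 d ?f a b v \<partial>Q) = (\<integral>w. ?h w \<partial>measure_pmf W)"
  proof -
    have "(\<integral>v. smooth0 d ?f a b v \<partial>Q) = (\<integral>z. smooth0 d ?f a b (std_vec d A mu (\<lambda>i. rvec (fst z) i + snd z i)) \<partial>(measure_pmf W \<Otimes>\<^sub>M cube_law d))"
      unfolding Q_def c0.std_law_def by (rule integral_distr[OF c0.measurable_std_vec_pair s0m])
    also have "\<dots> = (\<integral>w. ?h w \<partial>measure_pmf W)"
    proof -
      have "integrable (measure_pmf W \<Otimes>\<^sub>M cube_law d) (\<lambda>z. smooth0 d ?f a b (std_vec d A mu (\<lambda>i. rvec (fst z) i + snd z i)))"
        by (rule P.integrable_const_bound[where B=1])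
           (use s0 measurable_compose[OF c0.measurable_std_vec_pair s0m] in auto)
      from P.integral_fst'[OF this] show ?thesis by simp
    qed
    finally show ?thesis .
  qed
  have hb: "\<bar>?h w\<bar> \<le> 1" for w by (rule abs_expectation_le[OF prob_space_cube_law s0])
  have hi: "integrable (measure_pmf W) ?h" by (rule integrable_pmf_bounded[OF hb])
  have Wz: "AE w in measure_pmf W. w \<in> zvec d"
  proof -
    have "w \<in> zvec d" if "w \<in> set_pmf W" for w
    proof -
      have "w \<in> (\<lambda>\<omega>. \<Sum>i\<in>I. \<omega> i) ` set_pmf (Pi_pmf I 0 Y)"
        using that unfolding W_def sum_pmf_def set_map_pmf .
      then obtain \<omega> where \<omega>: "\<omega> \<in> set_pmf (Pi_pmf I 0 Y)" "w = (\<Sum>i\<in>I. \<omega> i)"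
        by (elim imageE)
      have "\<omega> i \<in> zvec d" if "i \<in> I" for i
      proof -
        have "\<omega> i \<in> set_pmf (Y i)" using \<omega>(1) set_Pi_pmf_subset[OF I, of 0 Y] that I by (auto simp: set_Pi_pmf PiE_dflt_def)
        then show ?thesis using Yz[OF that] by blast
      qed
      then have "rvec w k = 0" if "k \<ge> d" for k
        unfolding \<omega>(2) rvec_sum using that by (intro sum.neutral) (auto simp: zvec_def rvec_def)
      then show ?thesis by (simp add: zvec_def rvec_def)
    qed
    then show ?thesis by (simp add: AE_measure_pmf_iff)
  qed
  have absi: "integrable (measure_pmf W) (\<lambda>w. \<bar>rvec w k - mu k\<bar>)" if "k < d" for k
    unfolding W_def by (intro integrable_abs Bochner_Integration.integrable_diff integrable_sum_pmf_rvec I) (auto intro!: third_moment_coord[OF Y] that)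
  \<comment> \<open>The triangle inequality over the summands gives a bound linear in their number.
    This crude growth is harmless, because it is multiplied by a starting value \<open>b\<close>
    that can be chosen tiny.\<close>
  have absE: "(\<integral>w. \<bar>rvec w k - mu k\<bar> \<partial>measure_pmf W) \<le> (real (card I) + S k k) / 2" if k: "k < d" for k
  proof -
    let ?\<Omega> = "measure_pmf (Pi_pmf I 0 Y)"
    have y1: "integrable (measure_pmf (Y i)) (\<lambda>y. rvec y k)" and y2: "integrable (measure_pmf (Y i)) (\<lambda>y. rvec y k * rvec y k)" if "i \<in> I" for i
      using third_moment_coord[OF Y[OF that] k] third_moment_coord2[OF Y[OF that] k k] by auto
    have marg: "integrable ?\<Omega> (\<lambda>\<omega>. F (\<omega> i))" "(\<integral>\<omega>. F (\<omega> i) \<partial>?\<Omega>) = (\<integral>y. F y \<partial>measure_pmf (Y i))"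
      if "i \<in> I" "integrable (measure_pmf (Y i)) F" for i and F :: "(nat \<Rightarrow> int) \<Rightarrow> real"
    proof -
      have e: "map_pmf (\<lambda>\<omega>. \<omega> i) (Pi_pmf I 0 Y) = Y i" using that I by (simp add: Pi_pmf_component)
      show "integrable ?\<Omega> (\<lambda>\<omega>. F (\<omega> i))" using that(2) unfolding e[symmetric] by simp
      show "(\<integral>\<omega>. F (\<omega> i) \<partial>?\<Omega>) = (\<integral>y. F y \<partial>measure_pmf (Y i))" unfolding e[symmetric] by simp
    qed
    have ya: "integrable (measure_pmf (Y i)) (\<lambda>y. \<bar>rvec y k - mean_vec (Y i) k\<bar>)" if "i \<in> I" for i using y1[OF that] by simp
    have "(\<integral>w. \<bar>rvec w k - mu k\<bar> \<partial>measure_pmf W) = (\<integral>\<omega>. \<bar>\<Sum>i\<in>I. rvec (\<omega> i) k - mean_vec (Y i) k\<bar> \<partial>?\<Omega>)"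
      unfolding W_def sum_pmf_def integral_map_pmf rvec_sum mu sum_subtractf ..
    also have "\<dots> \<le> (\<integral>\<omega>. (\<Sum>i\<in>I. \<bar>rvec (\<omega> i) k - mean_vec (Y i) k\<bar>) \<partial>?\<Omega>)"
    proof (rule integral_mono_AE')
      show "integrable ?\<Omega> (\<lambda>\<omega>. \<Sum>i\<in>I. \<bar>rvec (\<omega> i) k - mean_vec (Y i) k\<bar>)"
        by (intro Bochner_Integration.integrable_sum marg(1) ya)
    qed (auto intro!: sum_nonneg)
    also have "\<dots> = (\<Sum>i\<in>I. \<integral>\<omega>. \<bar>rvec (\<omega> i) k - mean_vec (Y i) k\<bar> \<partial>?\<Omega>)"
      by (rule Bochner_Integration.integral_sum) (rule marg(1)[OF _ ya])
    also have "\<dots> = (\<Sum>i\<in>I. \<integral>y. \<bar>rvec y k - mean_vec (Y i) k\<bar> \<partial>measure_pmf (Y i))"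
      by (intro sum.cong refl marg(2) ya)
    also have "\<dots> \<le> (\<Sum>i\<in>I. (1 + cov_mat (Y i) k k) / 2)"
    proof (intro sum_mono)
      fix i assume i: "i \<in> I"
      have sq: "integrable (measure_pmf (Y i)) (\<lambda>y. (rvec y k - mean_vec (Y i) k) * (rvec y k - mean_vec (Y i) k))"
        using y1[OF i] y2[OF i] by (simp add: left_diff_distrib right_diff_distrib)
      have "(\<integral>y. \<bar>rvec y k - mean_vec (Y i) k\<bar> \<partial>measure_pmf (Y i)) \<le>
          (\<integral>y. (1 + (rvec y k - mean_vec (Y i) k) * (rvec y k - mean_vec (Y i) k)) / 2 \<partial>measure_pmf (Y i))"
      proof (rule integral_mono[OF ya[OF i]])
        show "\<bar>rvec y k - mean_vec (Y i) k\<bar> \<le> (1 + (rvec y k - mean_vec (Y i) k) * (rvec y k - mean_vec (Y i) k)) / 2" for y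
        proof -
          have "\<bar>t\<bar> \<le> (1 + t * t) / 2" for t :: real
            using zero_le_power2[of "\<bar>t\<bar> - 1"] by (simp add: power2_eq_square algebra_simps)
          then show ?thesis .
        qed
      qed (use sq in simp)
      also have "\<dots> = (1 + cov_mat (Y i) k k) / 2"
        using sq by (simp add: cov_mat_def rvec_def)
      finally show "(\<integral>y. \<bar>rvec y k - mean_vec (Y i) k\<bar> \<partial>measure_pmf (Y i)) \<le> (1 + cov_mat (Y i) k k) / 2" .
    qed
    also have "\<dots> = (real (card I) + S k k) / 2" by (simp add: S sum_divide_distrib[symmetric] sum.distrib)
    finally show ?thesis .
  qed
  let ?r = "\<lambda>w. \<Sum>k<d. 2 * ((1 - a) * (\<bar>rvec w k - mu k\<bar> + 1 / 2) + b * ((1 + S k k) / 2))"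
  have ri: "integrable (measure_pmf W) ?r"
    by (intro Bochner_Integration.integrable_sum integrable_mult_right Bochner_Integration.integrable_add absi) auto
  have Skk: "0 \<le> S k k" if "k < d" for k
  proof -
    have "S k k = (\<Sum>n<d. (B k n)\<^sup>2)" using B that by (simp add: is_cholesky_def power2_eq_square)
    then show ?thesis by (simp add: sum_nonneg)
  qed
  have ind: "(\<integral>w. indicator E w \<partial>measure_pmf W) = measure (measure_pmf W) E" by simp
  have start: "\<bar>(\<integral>w. ?h w \<partial>measure_pmf W) - measure (measure_pmf W) E\<bar> \<le> b * (real d * (real (card I) + 2) + 2 * mat_trace d S)"
  proof -
    have ii: "integrable (measure_pmf W) (indicator E :: _ \<Rightarrow> real)" by (rule integrable_pmf_bounded[where M=1]) (auto simp: indicator_def)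
    have e: "(\<integral>w. ?h w \<partial>measure_pmf W) - measure (measure_pmf W) E = (\<integral>w. ?h w - indicator E w \<partial>measure_pmf W)"
      unfolding ind[symmetric] by (rule Bochner_Integration.integral_diff[OF hi ii, symmetric])
    have "\<bar>(\<integral>w. ?h w \<partial>measure_pmf W) - measure (measure_pmf W) E\<bar> \<le> (\<integral>w. \<bar>?h w - indicator E w\<bar> \<partial>measure_pmf W)"
      unfolding e by (rule integral_abs_bound)
    also have "\<dots> \<le> (\<integral>w. ?r w \<partial>measure_pmf W)"
    proof (rule integral_mono_AE[OF _ ri])
      show "integrable (measure_pmf W) (\<lambda>w. \<bar>?h w - indicator E w\<bar>)" by (intro integrable_abs Bochner_Integration.integrable_diff hi ii)
      show "AE w in measure_pmf W. \<bar>?h w - indicator E w\<bar> \<le> ?r w"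
        using Wz by eventually_elim (rule smooth0_start[OF _ a0 b(1)])
    qed
    also have "\<dots> = (\<Sum>k<d. 2 * ((1 - a) * ((\<integral>w. \<bar>rvec w k - mu k\<bar> \<partial>measure_pmf W) + 1 / 2) + b * ((1 + S k k) / 2)))"
      by (subst Bochner_Integration.integral_sum) (use absi in \<open>auto intro!: sum.cong integrable_mult_right Bochner_Integration.integrable_add\<close>)
    also have "\<dots> \<le> (\<Sum>k<d. 2 * (b * ((real (card I) + S k k) / 2 + 1 / 2) + b * ((1 + S k k) / 2)))"
      by (intro sum_mono mult_left_mono add_mono mult_mono absE a1) (use b a0 Skk in \<open>auto intro!: integral_nonneg add_nonneg_nonneg\<close>)
    also have "\<dots> = (\<Sum>k<d. b * (real (card I) + 2) + b * (2 * S k k))"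
      by (intro sum.cong refl) (simp add: field_simps)
    also have "\<dots> = b * (real d * (real (card I) + 2) + 2 * mat_trace d S)"
      by (simp add: sum.distrib mat_trace_def sum_distrib_left algebra_simps)
    finally show ?thesis .
  qed
  show ?thesis
    using main start unfolding QW measure_discrete_normal[OF B A] W_def[symmetric] K_def by linarith
qed

end

section \<open>Rates and constants\<close>

lemma sum_law_eq_sum_pmf: "sum_law m Y = sum_pmf {..<m} Y"
proof -
  have "(\<lambda>k. \<Sum>i\<in>I. \<omega> i k) = (\<Sum>i\<in>I. \<omega> i)" for \<omega> :: "nat \<Rightarrow> nat \<Rightarrow> int" and I :: "nat set"
    by (induction I rule: infinite_finite_induct) (simp_all add: fun_eq_iff)
  then show ?thesis by (simp add: sum_law_def sum_pmf_def func_zero)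
qed

lemma dtv_leI:
  assumes "\<And>E. E \<in> sets M \<Longrightarrow> E \<in> sets N \<Longrightarrow> \<bar>measure M E - measure N E\<bar> \<le> c"
  shows "dtv M N \<le> c"
  unfolding dtv_def
proof (rule cSup_least)
  show "{\<bar>measure M A - measure N A\<bar> |A. A \<in> sets M \<inter> sets N} \<noteq> {}" using sets.empty_sets by blast
qed (use assms in auto)

text \<open>Here \<delta> is d, \<tau> the normalised trace and lam the smallest eigenvalue of S/m,
  \<kappa> is \<chi>, and b = m^(-2). The constant (2 \<tau>)^(3/2) undoes the trace factor of L,
  and 16 is 8 times the 2 of ln(m^2) = 2 ln m. The powers of \<delta> are compared
  generously.\<close>

lemma rate_arithmetic:
  fixes m \<kappa> \<tau> lam s \<delta> :: real
  assumes m: "2 \<le> m" and \<delta>: "1 \<le> \<delta>" and lam: "0 < lam" and \<tau>: "0 < \<tau>" and \<kappa>: "0 \<le> \<kappa>" and s: "0 < s" "s \<le> m"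
  shows "(8 * (1 / sqrt s) * sqrt \<delta> * (m * \<kappa>) / (m * lam) + \<delta> / (2 * (m * lam))) * ln (m\<^sup>2)
      + 1 / m\<^sup>2 * (\<delta> * (m + 2) + 2 * (m * \<delta> * \<tau>))
    \<le> (16 / lam * (2 * \<tau>) powr (3/2) + (1 / lam + 2 * (3 + 2 * \<tau>))) * \<delta> powr (7/2) * ln m
      * (m powr (-1/2) * \<kappa> * (\<delta> * (2 * \<tau>)) powr (-3/2) + sqrt (\<delta> / m)) * sqrt (m / s)"
proof -
  define r where "r = 1 / sqrt s"
  define q where "q = ln m"
  define p where "p = (2 * \<tau>) powr (3/2)"
  have p: "0 < p" using \<tau> by (simp add: p_def)
  have r0: "0 < r" using s by (simp add: r_def)
  \<comment> \<open>From ln(1/2) <= -1/2. It lets the terms that carry no logarithm be absorbed by 2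
    ln m, which explains the factor 2 in front of 3 + 2 \<tau>.\<close>
  have q: "1 / 2 \<le> q"
  proof -
    have "1 / 2 \<le> ln (2::real)" using ln_2_less_1 ln_add_one_self_le_self2[of "-1/2"] by (simp add: ln_div)
    also have "\<dots> \<le> q" using m by (simp add: q_def)
    finally show ?thesis .
  qed
  \<comment> \<open>Turns errors of order 1/m into the common rate s^(-1/2); it holds because s <= m
    <= m^2.\<close>
  have mr: "1 / m \<le> r"
  proof -
    have "sqrt s \<le> sqrt m" using s by simp
    also have "\<dots> \<le> m" using m by (intro real_le_lsqrt) (auto simp: self_le_power)
    finally show ?thesis unfolding r_def using s m by (intro divide_left_mono) auto
  qed
  have sm: "sqrt (m / s) = sqrt m * r" by (simp add: r_def real_sqrt_divide)
  \<comment> \<open>m^(-1/2) cancels the root of m in sqrt(m/s), and \<delta>^(7/2) against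
    \<delta>^(-3/2) leaves \<delta>^2, which exceeds the sqrt \<delta> to be bounded.\<close>
  have e1: "\<delta> powr (7/2) * (m powr (-1/2) * \<kappa> * (\<delta> * (2 * \<tau>)) powr (-3/2)) * sqrt (m / s) = \<delta>\<^sup>2 * \<kappa> / p * r"
  proof -
    have "(\<delta> * (2 * \<tau>)) powr (-3/2) = \<delta> powr (-3/2) * (1 / p)"
      using \<delta> \<tau> by (simp add: powr_mult p_def powr_minus_divide)
    moreover have "\<delta> powr (7/2) * \<delta> powr (-3/2) = \<delta>\<^sup>2"
      using \<delta> by (simp add: powr_add[symmetric])
    moreover have "m powr (-1/2) * sqrt m = 1"
      using m by (simp add: powr_half_sqrt[symmetric] powr_add[symmetric])
    moreover have "\<delta> powr (7/2) * (m powr (-1/2) * \<kappa> * (\<delta> powr (-3/2) * (1 / p))) * (sqrt m * r) =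
        (\<delta> powr (7/2) * \<delta> powr (-3/2)) * (m powr (-1/2) * sqrt m) * (\<kappa> / p * r)" by simp
    ultimately show ?thesis unfolding sm by simp
  qed
  have e2: "\<delta> powr (7/2) * sqrt (\<delta> / m) * sqrt (m / s) = \<delta> ^ 4 * r"
  proof -
    have "sqrt (\<delta> / m) * sqrt m = \<delta> powr (1/2)" using m \<delta> by (simp add: real_sqrt_divide powr_half_sqrt)
    moreover have "\<delta> powr (7/2) * \<delta> powr (1/2) = \<delta> ^ 4" using \<delta> by (simp add: powr_add[symmetric])
    moreover have "\<delta> powr (7/2) * sqrt (\<delta> / m) * (sqrt m * r) = \<delta> powr (7/2) * (sqrt (\<delta> / m) * sqrt m) * r" by simp
    ultimately show ?thesis unfolding sm by simp
  qed
  let ?c1 = "16 / lam" and ?c2 = "1 / lam + 2 * (3 + 2 * \<tau>)"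
  have rhs: "(?c1 * p + ?c2) * \<delta> powr (7/2) * q * (m powr (-1/2) * \<kappa> * (\<delta> * (2 * \<tau>)) powr (-3/2) + sqrt (\<delta> / m)) * sqrt (m / s)
      = (?c1 * p + ?c2) * q * (\<delta>\<^sup>2 * \<kappa> / p * r + \<delta> ^ 4 * r)"
    unfolding e1[symmetric] e2[symmetric] by (simp add: algebra_simps)
  have c2: "0 \<le> ?c2" using lam \<tau> by simp
  have D4: "\<delta> \<le> \<delta> ^ 4" "sqrt \<delta> \<le> \<delta>\<^sup>2"
  proof -
    show "\<delta> \<le> \<delta> ^ 4" using \<delta> by (simp add: self_le_power)
    have "sqrt \<delta> \<le> \<delta>" using \<delta> by (simp add: real_le_lsqrt self_le_power)
    also have "\<dots> \<le> \<delta>\<^sup>2" using \<delta> by (simp add: self_le_power)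
    finally show "sqrt \<delta> \<le> \<delta>\<^sup>2" .
  qed
  have q0: "0 \<le> q" using q by simp
  have t1: "?c1 * q * (sqrt \<delta> * \<kappa> * r) \<le> ?c1 * q * (\<delta>\<^sup>2 * \<kappa> * r)"
    using D4 lam q0 \<kappa> r0 by (intro mult_left_mono mult_right_mono) auto
  have t2: "1 / lam * q * (\<delta> * (1 / m)) \<le> 1 / lam * q * (\<delta> ^ 4 * r)"
    using D4 lam q0 r0 mr m \<delta> by (intro mult_left_mono mult_mono) auto
  have t3: "\<delta> * (1 / m) * (3 + 2 * \<tau>) \<le> 2 * q * ((\<delta> ^ 4 * r) * (3 + 2 * \<tau>))"
  proof -
    have "\<delta> * (1 / m) * (3 + 2 * \<tau>) \<le> (\<delta> ^ 4 * r) * (3 + 2 * \<tau>)"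
      using D4 r0 mr m \<delta> \<tau> by (intro mult_right_mono mult_mono) auto
    also have "\<dots> \<le> (2 * q) * ((\<delta> ^ 4 * r) * (3 + 2 * \<tau>))"
      using q r0 \<delta> \<tau> mult_right_mono[of 1 "2 * q" "(\<delta> ^ 4 * r) * (3 + 2 * \<tau>)"] by simp
    finally show ?thesis .
  qed
  have "1 / m\<^sup>2 * (\<delta> * (m + 2) + 2 * (m * \<delta> * \<tau>)) = \<delta> * (1 / m) * (1 + 2 / m + 2 * \<tau>)"
    using m by (simp add: field_simps power2_eq_square)
  also have "\<dots> \<le> \<delta> * (1 / m) * (3 + 2 * \<tau>)"
    using m \<delta> by (intro mult_left_mono) (auto simp: field_simps)
  finally have a3: "1 / m\<^sup>2 * (\<delta> * (m + 2) + 2 * (m * \<delta> * \<tau>)) \<le> \<delta> * (1 / m) * (3 + 2 * \<tau>)" .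
  have ln2: "ln (m\<^sup>2) = 2 * q" using m by (simp add: q_def ln_realpow)
  have a12: "(8 * r * sqrt \<delta> * (m * \<kappa>) / (m * lam) + \<delta> / (2 * (m * lam))) * (2 * q) =
      ?c1 * q * (sqrt \<delta> * \<kappa> * r) + 1 / lam * q * (\<delta> * (1 / m))"
    using m lam by (simp add: field_simps)
  have "?c1 * q * (\<delta>\<^sup>2 * \<kappa> * r) + ?c2 * q * (\<delta> ^ 4 * r) \<le> (?c1 * p + ?c2) * q * (\<delta>\<^sup>2 * \<kappa> / p * r + \<delta> ^ 4 * r)"
  proof -
    have "(?c1 * p + ?c2) * q * (\<delta>\<^sup>2 * \<kappa> / p * r + \<delta> ^ 4 * r) =
        ?c1 * q * (\<delta>\<^sup>2 * \<kappa> * r) + ?c2 * q * (\<delta> ^ 4 * r) + ?c1 * p * q * (\<delta> ^ 4 * r) + ?c2 * q * (\<delta>\<^sup>2 * \<kappa> / p * r)"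
    proof -
      have "(X * p + Z) * q * (U / p * r + V) = X * q * (U * r) + Z * q * V + X * p * q * V + Z * q * (U / p * r)" for X Z U V :: real
        using p by (simp add: field_simps)
      then show ?thesis .
    qed
    moreover have "0 \<le> ?c1 * p * q * (\<delta> ^ 4 * r)" using lam p q0 r0 \<delta> by simp
    moreover have "0 \<le> ?c2 * q * (\<delta>\<^sup>2 * \<kappa> / p * r)" using c2 p q0 r0 \<kappa> by (intro mult_nonneg_nonneg divide_nonneg_nonneg) auto
    ultimately show ?thesis by linarith
  qed
  moreover have "?c2 * q * (\<delta> ^ 4 * r) = 1 / lam * q * (\<delta> ^ 4 * r) + 2 * q * ((\<delta> ^ 4 * r) * (3 + 2 * \<tau>))"
    by (simp add: algebra_simps)
  ultimately show ?thesis
    using t1 t2 t3 a3 unfolding r_def[symmetric] q_def[symmetric] p_def[symmetric] ln2 a12 rhs by linarith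
qed

text \<open>The bound with its explicit constant. The abbreviations enter as equations, so that
  after unfolding the theorem they are discharged by reflexivity.\<close>

lemma discrete_normal_approximation:
  fixes Y :: "nat \<Rightarrow> (nat \<Rightarrow> int) pmf"
  assumes S: "S = (\<lambda>j k. \<Sum>i<m. cov_mat (Y i) j k)"
    and mu: "mu = (\<lambda>k. \<Sum>i<m. mean_vec (Y i) k)"
    and u: "u = (\<lambda>i. Min ((\<lambda>j. 1 - dtv (measure_pmf (Y i)) (measure_pmf (map_pmf (unit_shift j) (Y i)))) ` {..<d}))"
    and s': "s' = (\<Sum>i<m. u i) - Max (u ` {..<m})"
    and chi: "chi = (1 / real m) * (\<Sum>i<m. measure_pmf.expectation (pair_pmf (Y i) (Y i)) (\<lambda>(y', y). enorm d (y' - y) ^ 3))"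
    and Sm: "Sm = (\<lambda>j k. S j k / real m)"
    and d: "d \<ge> 1" and m: "m \<ge> 1" and Yz: "\<forall>i<m. set_pmf (Y i) \<subseteq> zvec d"
    and Y3: "\<forall>i<m. integrable (measure_pmf (Y i)) (\<lambda>x. enorm d x ^ 3)"
    and pd: "pos_def d S" and s'0: "s' > 0"
  shows "dtv (measure_pmf (sum_law m Y)) (discrete_normal d mu S)
    \<le> (16 / lambda_min d Sm * (2 * (mat_trace d Sm / real d)) powr (3/2) + (1 / lambda_min d Sm + 2 * (3 + 2 * (mat_trace d Sm / real d))))
      * real d powr (7/2) * ln (real m)
      * (real m powr (-1/2) * chi * mat_trace d (\<lambda>j k. 2 * S j k / real m) powr (-3/2) + sqrt (real d / real m)) * sqrt (real m / s')"
proof (rule dtv_leI)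
  fix E :: "(nat \<Rightarrow> int) set"
  have dpos: "0 < d" and mpos: "0 < real m" using d m by auto
  have us: "unit_shift j = (\<lambda>x. x + int_unit j)" for j by (simp add: unit_shift_def int_unit_def fun_eq_iff)
  have uo: "u i \<le> shift_overlap (int_unit j) (Y i)" if "j < d" for i j
  proof -
    have "u i \<le> 1 - dtv (measure_pmf (Y i)) (measure_pmf (map_pmf (unit_shift j) (Y i)))"
      unfolding u using that by (intro Min_le) auto
    also have "\<dots> \<le> shift_overlap (int_unit j) (Y i)" unfolding us by (rule dtv_pmf_le_shift_overlap)
    finally show ?thesis .
  qed
  \<comment> \<open>Whichever summand is exchanged, the overlaps of the others still add up to at
    least s', in every coordinate direction.\<close>
  have so: "s' \<le> (\<Sum>i'\<in>{..<m} - {i}. shift_overlap (int_unit j) (Y i'))" if "i < m" "j < d" for i j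
  proof -
    have "u i \<le> Max (u ` {..<m})" using that by (intro Max_ge) auto
    then have "s' \<le> (\<Sum>i'\<in>{..<m} - {i}. u i')" unfolding s' using that by (simp add: sum.remove[of "{..<m}" i])
    also have "\<dots> \<le> (\<Sum>i'\<in>{..<m} - {i}. shift_overlap (int_unit j) (Y i'))" by (intro sum_mono uo that)
    finally show ?thesis .
  qed
  \<comment> \<open>A single summand leaves nothing after its removal, so s' could not be positive.
    With m >= 2 the factor ln m is bounded away from 0.\<close>
  have m2: "2 \<le> m"
  proof (rule ccontr)
    assume "\<not> 2 \<le> m"
    then have "m = 1" using m by simp
    then show False using so[of 0 0] dpos s'0 by (simp add: lessThan_Suc)
  qed
  have sm: "s' \<le> real m"
  proof -
    have "s' \<le> (\<Sum>i'\<in>{..<m} - {0}. shift_overlap (int_unit 0) (Y i'))" using so[of 0 0] m dpos by simp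
    also have "\<dots> \<le> (\<Sum>i'\<in>{..<m} - {0}. 1)" by (intro sum_mono shift_overlap_bounds)
    also have "\<dots> \<le> real m" using card_Diff1_le[of "{..<m}" 0] by simp
    finally show ?thesis .
  qed
  have T: "shift_smooth d (1 / sqrt s') (sum_pmf ({..<m} - {i}) Y)" if "i \<in> {..<m}" for i
    unfolding shift_smooth_def
  proof (intro allI impI)
    fix j M and f :: "(nat \<Rightarrow> int) \<Rightarrow> real" assume j: "j < d" and M: "\<forall>x. \<bar>f x\<bar> \<le> M"
    show "\<bar>(\<integral>w. f (w + int_unit j) \<partial>measure_pmf (sum_pmf ({..<m} - {i}) Y)) - (\<integral>w. f w \<partial>measure_pmf (sum_pmf ({..<m} - {i}) Y))\<bar> \<le> 2 * M * (1 / sqrt s')"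
      using expectation_sum_pmf_shift_le[of "{..<m} - {i}" f M s' "int_unit j" Y] so[of i j] that j M s'0 by simp
  qed
  let ?lam = "lambda_min d Sm" and ?tau = "mat_trace d Sm / real d"
  have qSm: "quad_form d Sm v = quad_form d S v / real m" for v
    by (simp add: quad_form_def Sm sum_divide_distrib)
  have pdm: "pos_def d Sm"
    unfolding pos_def_def
  proof (intro conjI allI impI)
    show "Sm j k = Sm k j" if "j < d" "k < d" for j k using pd that by (simp add: pos_def_def Sm)
    fix v :: "nat \<Rightarrow> real" assume "\<exists>k<d. v k \<noteq> 0"
    then have "0 < quad_form d S v" using pd unfolding pos_def_def quad_form_def by blast
    then have "0 < quad_form d Sm v" using mpos by (simp add: qSm)
    then show "0 < (\<Sum>j<d. \<Sum>k<d. v j * Sm j k * v k)" by (simp add: quad_form_def)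
  qed
  obtain B where B: "is_cholesky d S B" using cholesky_exists[OF pd] by blast
  obtain A where A: "is_lower_inverse d B A" using cholesky_inverse_exists[OF B] by blast
  interpret chol_test d S B A mu E by unfold_locales (rule B, rule A)
  have psd: "0 \<le> quad_form d Sm v" for v
    using mpos by (simp add: qSm quad_form_cholesky[OF B] sum_nonneg)
  have symm: "\<forall>j<d. \<forall>k<d. Sm j k = Sm k j" using pdm by (simp add: pos_def_def)
  note lm = quad_form_ge_lambda_min[OF symm psd dpos]
  have lam: "0 < ?lam" by (rule eigenvalue_pos[OF pdm lm(2)])
  \<comment> \<open>The coercivity constant of S itself is m times the smallest eigenvalue of S/m;
    the growth with m sits in this factor.\<close>
  have l: "real m * ?lam * (\<Sum>k<d. (v k)\<^sup>2) \<le> quad_form d S v" for v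
    using lm(1)[of v] mpos by (simp add: qSm field_simps)
  have Skk: "0 < S k k" if "k < d" for k
  proof -
    have "S k k = (\<Sum>n<d. (B k n)\<^sup>2)" using B that by (simp add: is_cholesky_def power2_eq_square)
    also have "\<dots> > 0" using B that by (intro sum_pos2[of _ k]) (auto simp: is_cholesky_def)
    finally show ?thesis .
  qed
  have tr: "mat_trace d S = real m * real d * ?tau" "mat_trace d (\<lambda>j k. 2 * S j k / real m) = real d * (2 * ?tau)"
    using dpos mpos by (simp_all add: mat_trace_def Sm sum_divide_distrib[symmetric] sum_distrib_left[symmetric])
  have tau: "0 < ?tau"
    using dpos mpos Skk unfolding mat_trace_def Sm by (intro divide_pos_pos sum_pos) auto
  have chi': "(\<Sum>i<m. sym_third d (Y i)) = real m * chi"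
    using mpos by (simp add: chi sym_third_def case_prod_unfold)
  have chi0: "0 \<le> chi"
    unfolding chi by (intro mult_nonneg_nonneg sum_nonneg Bochner_Integration.integral_nonneg) (auto simp: enorm_nonneg)
  have b: "0 < 1 / (real m)\<^sup>2" "1 / (real m)\<^sup>2 \<le> 1" using m by (auto simp: power2_eq_square mult_ge1_I divide_le_eq)
  have "\<bar>measure (measure_pmf (sum_law m Y)) E - measure (discrete_normal d mu S) E\<bar> \<le>
      (8 * (1 / sqrt s') * sqrt (real d) * (\<Sum>i<m. sym_third d (Y i)) / (real m * ?lam) + real d / (2 * (real m * ?lam))) * ln (1 / (1 / (real m)\<^sup>2))
      + 1 / (real m)\<^sup>2 * (real d * (real (card {..<m}) + 2) + 2 * mat_trace d S)"
    unfolding sum_law_eq_sum_pmf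
    by (rule total_bound) (use T Y3 Yz s'0 mpos lam l b mu S in \<open>auto simp: third_moment_def\<close>)
  also have "\<dots> \<le> (16 / ?lam * (2 * ?tau) powr (3/2) + (1 / ?lam + 2 * (3 + 2 * ?tau))) * real d powr (7/2) * ln (real m)
      * (real m powr (-1/2) * chi * mat_trace d (\<lambda>j k. 2 * S j k / real m) powr (-3/2) + sqrt (real d / real m)) * sqrt (real m / s')"
    unfolding chi' tr using rate_arithmetic[of "real m" "real d" ?lam ?tau chi s'] m2 d lam tau chi0 s'0 sm by simp
  finally show "\<bar>measure (measure_pmf (sum_law m Y)) E - measure (discrete_normal d mu S) E\<bar> \<le>
      (16 / ?lam * (2 * ?tau) powr (3/2) + (1 / ?lam + 2 * (3 + 2 * ?tau))) * real d powr (7/2) * ln (real m)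
      * (real m powr (-1/2) * chi * mat_trace d (\<lambda>j k. 2 * S j k / real m) powr (-3/2) + sqrt (real d / real m)) * sqrt (real m / s')" .
qed

theorem theorem4p2:
  "\<exists>C :: real \<Rightarrow> real \<Rightarrow> real \<Rightarrow> real.
   \<forall>(d::nat) (m::nat) (Y :: nat \<Rightarrow> (nat \<Rightarrow> int) pmf).
     let S = (\<lambda>j k. \<Sum>i<m. cov_mat (Y i) j k);
         mu = (\<lambda>k. \<Sum>i<m. mean_vec (Y i) k);
         u = (\<lambda>i. Min ((\<lambda>j. 1 - dtv (measure_pmf (Y i)) (measure_pmf (map_pmf (unit_shift j) (Y i)))) ` {..<d}));
         s = (\<Sum>i<m. u i);
         s' = s - Max (u ` {..<m});
         chi = (1 / real m) * (\<Sum>i<m. measure_pmf.expectation (pair_pmf (Y i) (Y i))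
                                  (\<lambda>(y', y). enorm d (y' - y) ^ 3));
         sigma2 = (\<lambda>j k. 2 * S j k / real m);
         L = real m powr (-1/2) * chi * mat_trace d sigma2 powr (-3/2);
         Sm = (\<lambda>j k. S j k / real m)
     in (d \<ge> 1 \<and> m \<ge> 1 \<and>
         (\<forall>i<m. set_pmf (Y i) \<subseteq> zvec d) \<and>
         (\<forall>i<m. integrable (measure_pmf (Y i)) (\<lambda>x. enorm d x ^ 3)) \<and>
         pos_def d S \<and> s' > 0)
        \<longrightarrow> dtv (measure_pmf (sum_law m Y)) (discrete_normal d mu S)
            \<le> C (lambda_min d Sm) (lambda_max d Sm) (mat_trace d Sm / real d)
               * real d powr (7/2) * ln (real m) * (L + sqrt (real d / real m))
               * sqrt (real m / s')"
  unfolding Let_def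
\<comment> \<open>The witness is the constant of \<open>rate_arithmetic\<close>, with
  \<open>l\<close> the smallest eigenvalue and \<open>t\<close> the normalised trace of S/m.\<close>
proof (intro exI[of _ "\<lambda>l _ t. 16 / l * (2 * t) powr (3/2) + (1 / l + 2 * (3 + 2 * t))"] allI impI, elim conjE)
qed (rule discrete_normal_approximation[OF refl refl refl refl refl refl])

end
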